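(* Fix $p \in (1,\infty)$ and let $\mathcal{X}$ be a class of Banach spaces which fulfills Assumptions (A) with respect to $p$. Let $X \in \mathcal{X}$ and let $\mathcal{T} \subseteq \mathcal{L}(X)$ be a set of operators that has a simultaneous dilation in $\mathcal{X}$. Then the closure of the convex hull $\operatorname{conv}(\mathcal{T})$ in the weak operator topology also has a simultaneous dilation in $\mathcal{X}$.
   Context: All Banach spaces are over one fixed scalar field, either $\mathbb{R}$ or $\mathbb{C}$. $\mathcal{L}(X)$ denotes the bounded linear operators on $X$. A contraction is a linear operator of norm at most $1$. For $n \in \mathbb{N}$, $\ell^p_n(X)$ is $X^n$ with norm $\|(x_1,\dots,x_n)\|_p = (\sum_{k=1}^n \|x_k\|^p)^{1/p}$. For a family $(X_i)_{i\in I}$ of Banach spaces and an ultrafilter $\mathcal{U}$ on the non-empty set $I$, $\prod_{\mathcal{U}} X_i$ is the usual Banach space ultraproduct (bounded families modulo families whose norms tend to $0$ along $\mathcal{U}$). Assumptions (A) with respect to $p$, for a class $\mathcal{X}$ of Banach spaces: (a) for every $X \in \mathcal{X}$ and every $n \in \mathbb{N}$, $\ell^p_n(X) \in \mathcal{X}$; (b) for every family $(X_i)_{i \in I}$ in $\mathcal{X}$ and every ultrafilter $\mathcal{U}$ on $I$, $\prod_{\mathcal{U}} X_i \in \mathcal{X}$; (c) every $X \in \mathcal{X}$ is reflexive. Simultaneous dilation: let $\mathcal{X}$ be a class of Banach spaces and $X \in \mathcal{X}$. A set $\mathcal{T} \subseteq \mathcal{L}(X)$ has a simultaneous dilation in $\mathcal{X}$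 if there exist $Y \in \mathcal{X}$, linear contractions $J\colon X \to Y$ and $Q\colon Y \to X$, and linear invertible isometries $U_T \in \mathcal{L}(Y)$ (one for each $T \in \mathcal{T}$) such that $T_1 \cdots T_n = Q\, U_{T_1} \cdots U_{T_n}\, J$ for all $n \in \mathbb{N}_0$ and all $T_1,\dots,T_n \in \mathcal{T}$ (the empty product being the identity operator). *)

theory Defs
  imports "HOL-Analysis.Analysis" "HOL-Algebra.Module" "HOL-Algebra.AbelCoset"
begin

subsection \<open>Scalars\<close>

text \<open>The scalar field is the field of real or of complex numbers, in either case with the usual
  absolute value. A type class lets one statement cover both.\<close>

class real_or_complex = real_normed_field +
  assumes real_or_complex:
    "(\<forall>x. \<exists>r. x = r *\<^sub>R 1) \<or>
     (\<exists>i. i * i = - 1 \<and>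
       (\<forall>x. \<exists>a b. x = a *\<^sub>R 1 + b *\<^sub>R i \<and> norm x = sqrt (a\<^sup>2 + b\<^sup>2)))"

instance real :: real_or_complex
  by standard auto

instance complex :: real_or_complex
proof
  have "\<exists>a b. x = a *\<^sub>R 1 + b *\<^sub>R \<i> \<and> norm x = sqrt (a\<^sup>2 + b\<^sup>2)" for x :: complex
    by (rule exI[of _ "Re x"], rule exI[of _ "Im x"]) (auto simp: complex_eq_iff cmod_def)
  then show "(\<forall>x::complex. \<exists>r. x = r *\<^sub>R 1) \<or>
     (\<exists>i::complex. i * i = - 1 \<and>
       (\<forall>x. \<exists>a b. x = a *\<^sub>R 1 + b *\<^sub>R i \<and> norm x = sqrt (a\<^sup>2 + b\<^sup>2)))"
    by (intro disjI2 exI[of _ \<i>]) auto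
qed

definition scalar_ring :: "'k::real_or_complex ring" where
  "scalar_ring = \<lparr>carrier = UNIV, mult = (*), one = 1, zero = 0, add = (+)\<rparr>"


subsection \<open>Banach spaces\<close>

text \<open>Classes of Banach spaces require spaces to be objects rather than types. The library's
  module record is extended by a norm; its ring fields \<open>mult\<close> and \<open>one\<close> carry no information
  for a module and are left unspecified in the constructions below.\<close>

record ('k, 'a) normed_module = "('k, 'a) module" +
  vnorm :: "'a \<Rightarrow> real"

text \<open>The distance is set to 0 off the carrier because the locale \<open>Metric_space\<close> requires
  nonnegativity and symmetry on the whole type.\<close>

definition vdist :: "('k, 'a) normed_module \<Rightarrow> 'a \<Rightarrow> 'a \<Rightarrow> real" where
  "vdist V x y = (if x \<in> carrier V \<and> y \<in> carrier V then vnorm V (x \<ominus>\<^bsub>V\<^esub> y) else 0)"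

definition normed_space :: "('k::real_or_complex, 'a) normed_module \<Rightarrow> bool" where
  "normed_space V \<longleftrightarrow>
     Module.module scalar_ring V \<and>
     (\<forall>x\<in>carrier V. 0 \<le> vnorm V x \<and> (vnorm V x = 0 \<longleftrightarrow> x = \<zero>\<^bsub>V\<^esub>)) \<and>
     (\<forall>c. \<forall>x\<in>carrier V. vnorm V (c \<odot>\<^bsub>V\<^esub> x) = norm c * vnorm V x) \<and>
     (\<forall>x\<in>carrier V. \<forall>y\<in>carrier V. vnorm V (x \<oplus>\<^bsub>V\<^esub> y) \<le> vnorm V x + vnorm V y)"

definition banach_space :: "('k::real_or_complex, 'a) normed_module \<Rightarrow> bool" where
  "banach_space V \<longleftrightarrow> normed_space V \<and> Metric_space.mcomplete (carrier V) (vdist V)"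


subsection \<open>Operators\<close>

text \<open>Operators are extensional functions on the carrier, so that equality of operators is
  equality of functions.\<close>

definition linear_maps ::
    "('k, 'a) normed_module \<Rightarrow> ('k, 'b) normed_module \<Rightarrow> ('a \<Rightarrow> 'b) set" where
  "linear_maps V W = {f \<in> carrier V \<rightarrow>\<^sub>E carrier W.
     (\<forall>x\<in>carrier V. \<forall>y\<in>carrier V. f (x \<oplus>\<^bsub>V\<^esub> y) = f x \<oplus>\<^bsub>W\<^esub> f y) \<and>
     (\<forall>c. \<forall>x\<in>carrier V. f (c \<odot>\<^bsub>V\<^esub> x) = c \<odot>\<^bsub>W\<^esub> f x)}"

definition bounded_ops ::
    "('k, 'a) normed_module \<Rightarrow> ('k, 'b) normed_module \<Rightarrow> ('k, 'a \<Rightarrow> 'b) normed_module" where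
  "bounded_ops V W =
     \<lparr>carrier = {f \<in> linear_maps V W. \<exists>C. \<forall>x\<in>carrier V. vnorm W (f x) \<le> C * vnorm V x},
      mult = undefined, one = undefined,
      zero = (\<lambda>x\<in>carrier V. \<zero>\<^bsub>W\<^esub>),
      add = (\<lambda>f g. \<lambda>x\<in>carrier V. f x \<oplus>\<^bsub>W\<^esub> g x),
      smult = (\<lambda>c f. \<lambda>x\<in>carrier V. c \<odot>\<^bsub>W\<^esub> f x),
      vnorm = (\<lambda>f. Sup ((\<lambda>x. vnorm W (f x)) ` {x \<in> carrier V. vnorm V x \<le> 1}))\<rparr>"

definition contractions ::
    "('k, 'a) normed_module \<Rightarrow> ('k, 'b) normed_module \<Rightarrow> ('a \<Rightarrow> 'b) set" where
  "contractions V W = {f \<in> carrier (bounded_ops V W). vnorm (bounded_ops V W) f \<le> 1}"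

text \<open>Surjective linear isometries; injectivity is part of \<open>bij_betw\<close>.\<close>

definition isometric_isos ::
    "('k, 'a) normed_module \<Rightarrow> ('k, 'b) normed_module \<Rightarrow> ('a \<Rightarrow> 'b) set" where
  "isometric_isos V W = {f \<in> linear_maps V W.
     bij_betw f (carrier V) (carrier W) \<and> (\<forall>x\<in>carrier V. vnorm W (f x) = vnorm V x)}"

definition scalar_space :: "('k::real_or_complex, 'k) normed_module" where
  "scalar_space = \<lparr>carrier = UNIV, mult = (*), one = 1, zero = 0, add = (+),
                   smult = (*), vnorm = norm\<rparr>"

definition dual :: "('k::real_or_complex, 'a) normed_module \<Rightarrow> ('k, 'a \<Rightarrow> 'k) normed_module" where
  "dual V = bounded_ops V scalar_space"

definition reflexive :: "('k::real_or_complex, 'a) normed_module \<Rightarrow> bool" where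
  "reflexive V \<longleftrightarrow>
     (\<forall>\<Phi>\<in>carrier (dual (dual V)). \<exists>x\<in>carrier V. \<forall>f\<in>carrier (dual V). \<Phi> f = f x)"

text \<open>The weak operator topology on the bounded operators on \<open>V\<close>: the coarsest topology for
  which all maps \<open>T \<mapsto> f (T x)\<close> are continuous.\<close>

definition weak_operator_topology ::
    "('k::real_or_complex, 'a) normed_module \<Rightarrow> ('a \<Rightarrow> 'a) topology" where
  "weak_operator_topology V = topology_generated_by
     {{T \<in> carrier (bounded_ops V V). f (T x) \<in> G} | f x G.
        f \<in> carrier (dual V) \<and> x \<in> carrier V \<and> open G}"

definition convex_in :: "('k::real_or_complex, 'a) normed_module \<Rightarrow> 'a set \<Rightarrow> bool" where
  "convex_in V C \<longleftrightarrow> C \<subseteq> carrier V \<and>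
     (\<forall>x\<in>C. \<forall>y\<in>C. \<forall>u\<ge>0. \<forall>v\<ge>0. u + v = 1 \<longrightarrow>
        (of_real u \<odot>\<^bsub>V\<^esub> x) \<oplus>\<^bsub>V\<^esub> (of_real v \<odot>\<^bsub>V\<^esub> y) \<in> C)"

definition conv :: "('k::real_or_complex, 'a) normed_module \<Rightarrow> 'a set \<Rightarrow> 'a set" where
  "conv V S = convex_in V hull S"


subsection \<open>Powers and ultraproducts\<close>

definition lp_power :: "real \<Rightarrow> nat \<Rightarrow> ('k, 'a) normed_module \<Rightarrow> ('k, nat \<Rightarrow> 'a) normed_module" where
  "lp_power p n V =
     \<lparr>carrier = (\<Pi>\<^sub>E k\<in>{..<n}. carrier V),
      mult = undefined, one = undefined,
      zero = (\<lambda>k\<in>{..<n}. \<zero>\<^bsub>V\<^esub>),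
      add = (\<lambda>x y. \<lambda>k\<in>{..<n}. x k \<oplus>\<^bsub>V\<^esub> y k),
      smult = (\<lambda>c x. \<lambda>k\<in>{..<n}. c \<odot>\<^bsub>V\<^esub> x k),
      vnorm = (\<lambda>x. (\<Sum>k<n. vnorm V (x k) powr p) powr (1 / p))\<rparr>"

definition linf_sum ::
    "'i set \<Rightarrow> ('i \<Rightarrow> ('k, 'a) normed_module) \<Rightarrow> ('k, 'i \<Rightarrow> 'a) normed_module" where
  "linf_sum I X =
     \<lparr>carrier = {x \<in> (\<Pi>\<^sub>E i\<in>I. carrier (X i)). bdd_above ((\<lambda>i. vnorm (X i) (x i)) ` I)},
      mult = undefined, one = undefined,
      zero = (\<lambda>i\<in>I. \<zero>\<^bsub>X i\<^esub>),
      add = (\<lambda>x y. \<lambda>i\<in>I. x i \<oplus>\<^bsub>X i\<^esub> y i),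
      smult = (\<lambda>c x. \<lambda>i\<in>I. c \<odot>\<^bsub>X i\<^esub> x i),
      vnorm = (\<lambda>x. Sup ((\<lambda>i. vnorm (X i) (x i)) ` I))\<rparr>"

text \<open>The quotient of \<open>V\<close> by a closed subspace \<open>N\<close>, consisting of cosets and with the quotient
  norm. Scalar multiplication is given on representatives, so that \<open>0 \<odot> A = N\<close>.\<close>

definition quotient_space ::
    "('k, 'a) normed_module \<Rightarrow> 'a set \<Rightarrow> ('k, 'a set) normed_module" where
  "quotient_space V N =
     \<lparr>carrier = a_rcosets\<^bsub>V\<^esub> N,
      mult = undefined, one = undefined,
      zero = N,
      add = (\<lambda>A B. A <+>\<^bsub>V\<^esub> B),
      smult = (\<lambda>c A. \<Union>a\<in>A. N +>\<^bsub>V\<^esub> (c \<odot>\<^bsub>V\<^esub> a)),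
      vnorm = (\<lambda>A. Inf (vnorm V ` A))\<rparr>"

text \<open>An ultrafilter on the set \<open>I\<close>, as a filter on the ambient type that contains \<open>I\<close>.\<close>

definition ultrafilter_on :: "'i set \<Rightarrow> 'i filter \<Rightarrow> bool" where
  "ultrafilter_on I \<U> \<longleftrightarrow> \<U> \<noteq> bot \<and> \<U> \<le> principal I \<and>
     (\<forall>P. eventually P \<U> \<or> eventually (\<lambda>i. \<not> P i) \<U>)"

definition null_families ::
    "'i set \<Rightarrow> 'i filter \<Rightarrow> ('i \<Rightarrow> ('k, 'a) normed_module) \<Rightarrow> ('i \<Rightarrow> 'a) set" where
  "null_families I \<U> X =
     {x \<in> carrier (linf_sum I X). ((\<lambda>i. vnorm (X i) (x i)) \<longlongrightarrow> 0) \<U>}"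

definition ultraproduct ::
    "'i set \<Rightarrow> 'i filter \<Rightarrow> ('i \<Rightarrow> ('k, 'a) normed_module) \<Rightarrow> ('k, ('i \<Rightarrow> 'a) set) normed_module" where
  "ultraproduct I \<U> X = quotient_space (linf_sum I X) (null_families I \<U> X)"


subsection \<open>Classes of Banach spaces\<close>

text \<open>A class is a set of Banach spaces whose carriers are subsets of a common type \<open>'u\<close>. Powers and
  ultraproducts have carriers in other types, so membership of these spaces is understood up to
  isometric isomorphism.\<close>

definition belongs_to :: "('k, 'a) normed_module \<Rightarrow> ('k, 'u) normed_module set \<Rightarrow> bool" where
  "belongs_to V \<X> \<longleftrightarrow> (\<exists>Z\<in>\<X>. isometric_isos V Z \<noteq> {})"

text \<open>The set \<open>K\<close> only bounds the cardinality of the index sets of ultraproducts, relative to which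
  the class has to be closed. A class of spaces on one fixed type cannot be closed under ultraproducts
  over index sets of every cardinality, since these have unbounded cardinality (as soon as some
  space in the class is nonzero). The smaller \<open>K\<close> is, the weaker is the assumption.\<close>

definition assumptions_A ::
    "real \<Rightarrow> 'u set \<Rightarrow> ('k::real_or_complex, 'u) normed_module set \<Rightarrow> bool" where
  "assumptions_A p K \<X> \<longleftrightarrow>
     (\<forall>X\<in>\<X>. \<forall>n\<ge>1. belongs_to (lp_power p n X) \<X>) \<and>
     (\<forall>(I :: 'u set) X \<U>. I \<noteq> {} \<and> I \<lesssim> K \<and> (\<forall>i\<in>I. X i \<in> \<X>) \<and> ultrafilter_on I \<U> \<longrightarrow>
        belongs_to (ultraproduct I \<U> X) \<X>) \<and>
     (\<forall>X\<in>\<X>. reflexive X)"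

definition simultaneous_dilation ::
    "('k::real_or_complex, 'u) normed_module set \<Rightarrow> ('k, 'u) normed_module \<Rightarrow> ('u \<Rightarrow> 'u) set \<Rightarrow> bool"
  where
  "simultaneous_dilation \<X> X \<T> \<longleftrightarrow>
     (\<exists>Y\<in>\<X>. \<exists>J\<in>contractions X Y. \<exists>Q\<in>contractions Y X. \<exists>U.
        (\<forall>T\<in>\<T>. U T \<in> isometric_isos Y Y) \<and>
        (\<forall>Ts. set Ts \<subseteq> \<T> \<longrightarrow>
           (\<forall>x\<in>carrier X. foldr (\<circ>) Ts id x = Q (foldr (\<circ>) (map U Ts) id (J x)))))"

end

theory Submission
  imports Defs "HOL-Algebra.Free_Abelian_Groups"
begin

text \<open>Let \<open>J\<close>, \<open>Q\<close>, \<open>U\<close> be a dilation of \<open>\<T>\<close> on \<open>Y\<close>. The proof dilates words of bounded length in means of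
finitely many elements of \<open>\<T>\<close>, and then passes to the closure by an ultraproduct.

Means. Let \<open>S = (\<tau> 0 + \<dots> + \<tau> (M - 1)) / M\<close> with \<open>\<tau> k \<in> \<T>\<close>. A product of at most \<open>N\<close> such means is the
average, over the words of \<open>N\<close> digits below \<open>M\<close>, of products of elements of \<open>\<T>\<close>. Therefore take the
power \<open>Y^(M^N)\<close>, with coordinates indexed by these digit words, embed \<open>X\<close> diagonally and average on
the way back; the normalising factors turn both maps into contractions for the \<open>p\<close>-norm, the second
one by the power mean inequality. The isometry for \<open>S\<close> rotates the digits of the index and applies in
each coordinate the isometry of the element of \<open>\<T>\<close> that the lowest digit selects. Rotating means that
the next factor of a product reads the next digit, so one isometry serves \<open>S\<close> at every position. This
is \<open>finite_dilation_of_means\<close>.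

Closure. An operator \<open>S\<close> in the weak operator closure of the convex hull is a strong limit of elements of
the hull, by Hahn-Banach (\<open>wot_closure_convex_strong_approx\<close>), hence a strong limit of means, and for
uniformly bounded operators strong convergence passes to products (\<open>word_strong_convergence\<close>). In an
ultraproduct of the dilations of means, the map back to \<open>X\<close> is the weak limit along the ultrafilter,
which exists because \<open>X\<close> is reflexive (\<open>ultraproduct_dilation\<close>).

Cardinality. The index set of the ultraproduct must not be larger than \<open>X\<close>, whereas the closure may
contain more operators than \<open>X\<close> has elements, so the index cannot record finite sets of operators. It is
a pair of a finite set \<open>F\<close> of vectors and a number \<open>n\<close>, and all operators are approximated at once: at
\<open>(F, n)\<close>, each one by a mean of \<open>n + 1\<close> elements that is closer than 1 to it on \<open>F\<close>, if there is one. How large \<open>n\<close> has to be for a good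
approximation depends on \<open>F\<close> and on the operator. This does no harm, because the ultrafilter refines the
iterated limit, first in \<open>n\<close> and then in \<open>F\<close> (\<open>iterated_limit\<close>), rather than the limit in the product order.\<close>

section \<open>The Hahn-Banach theorem\<close>

text \<open>The module laws over \<open>scalar_ring\<close> are restated with the arithmetic of the type \<open>'k\<close>, so that scalars are
simplified by the usual rules for fields.\<close>

locale vec_space = Module.module scalar_ring V
  for V :: "('k::real_or_complex, 'a) normed_module" (structure)
begin

lemma sm_closed [simp, intro]: "x \<in> carrier V \<Longrightarrow> c \<odot> x \<in> carrier V"
  using smult_closed by (simp add: scalar_ring_def)

lemma sm_add_left: "x \<in> carrier V \<Longrightarrow> (a + b) \<odot> x = a \<odot> x \<oplus> b \<odot> x"
  using smult_l_distr[of a b x] by (simp add: scalar_ring_def)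

lemma sm_add_right: "x \<in> carrier V \<Longrightarrow> y \<in> carrier V \<Longrightarrow> c \<odot> (x \<oplus> y) = c \<odot> x \<oplus> c \<odot> y"
  using smult_r_distr[of c x y] by (simp add: scalar_ring_def)

lemma sm_assoc: "x \<in> carrier V \<Longrightarrow> a \<odot> (b \<odot> x) = (a * b) \<odot> x"
  using smult_assoc1[of a b x] by (simp add: scalar_ring_def)

lemma sm_one [simp]: "x \<in> carrier V \<Longrightarrow> 1 \<odot> x = x"
  using smult_one[of x] by (simp add: scalar_ring_def)

lemma sm_zero_left [simp]: "x \<in> carrier V \<Longrightarrow> 0 \<odot> x = \<zero>"
  using smult_l_null[of x] by (simp add: scalar_ring_def)

lemma sm_zero_right [simp]: "c \<odot> \<zero> = \<zero>"
  using smult_r_null[of c] by (simp add: scalar_ring_def)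

lemma neg_eq_sm: "x \<in> carrier V \<Longrightarrow> \<ominus> x = (-1) \<odot> x"
proof -
  assume x: "x \<in> carrier V"
  have "x \<oplus> (-1) \<odot> x = \<zero>"
    using sm_add_left[OF x, of 1 "-1"] x by simp
  then show ?thesis using x
    by (metis M.add.inv_equality M.add.m_comm sm_closed)
qed

lemma minus_eq_sm: "y \<in> carrier V \<Longrightarrow> x \<ominus> y = x \<oplus> (-1) \<odot> y"
  by (simp add: a_minus_def neg_eq_sm)

end

text \<open>The inequality for positive factors is an equality, as one sees by applying it to the inverse factor;
in particular \<open>q 0 = 0\<close>.\<close>

definition sublinear :: "('k::real_or_complex, 'a) normed_module \<Rightarrow> ('a \<Rightarrow> real) \<Rightarrow> bool" where
  "sublinear V q \<longleftrightarrow>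
     (\<forall>x\<in>carrier V. \<forall>y\<in>carrier V. q (x \<oplus>\<^bsub>V\<^esub> y) \<le> q x + q y) \<and>
     (\<forall>r>0. \<forall>x\<in>carrier V. q (of_real r \<odot>\<^bsub>V\<^esub> x) \<le> r * q x)"

definition real_linear :: "('k::real_or_complex, 'a) normed_module \<Rightarrow> ('a \<Rightarrow> real) \<Rightarrow> bool" where
  "real_linear V \<phi> \<longleftrightarrow>
     (\<forall>x\<in>carrier V. \<forall>y\<in>carrier V. \<phi> (x \<oplus>\<^bsub>V\<^esub> y) = \<phi> x + \<phi> y) \<and>
     (\<forall>r. \<forall>x\<in>carrier V. \<phi> (of_real r \<odot>\<^bsub>V\<^esub> x) = r * \<phi> x)"

context vec_space
begin

lemma convex_in_singleton:
  assumes a: "a \<in> carrier V"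
  shows "convex_in V {a}"
proof -
  have "of_real u \<odot> a \<oplus> of_real v \<odot> a = a" if uv: "u + v = 1" for u v :: real
  proof -
    have "of_real u \<odot> a \<oplus> of_real v \<odot> a = of_real (u + v) \<odot> a"
      using a by (simp add: sm_add_left)
    then show ?thesis using a uv by simp
  qed
  then show ?thesis using a by (simp add: convex_in_def)
qed

lemma sublinear_add: "sublinear V q \<Longrightarrow> x \<in> carrier V \<Longrightarrow> y \<in> carrier V \<Longrightarrow> q (x \<oplus> y) \<le> q x + q y"
  by (simp add: sublinear_def)

lemma sublinear_scale:
  assumes "sublinear V q" "r > 0" "x \<in> carrier V"
  shows "q (of_real r \<odot> x) = r * q x"
proof (rule antisym)
  show "q (of_real r \<odot> x) \<le> r * q x" using assms by (simp add: sublinear_def)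
  have x: "x = of_real (inverse r) \<odot> (of_real r \<odot> x)"
    using assms by (simp add: sm_assoc)
  have "q (of_real (inverse r) \<odot> (of_real r \<odot> x)) \<le> inverse r * q (of_real r \<odot> x)"
    using assms by (simp only: sublinear_def) (meson positive_imp_inverse_positive sm_closed)
  then have "q x \<le> inverse r * q (of_real r \<odot> x)"
    by (simp only: x[symmetric])
  then show "r * q x \<le> q (of_real r \<odot> x)"
    using assms by (simp add: field_simps)
qed

lemma sublinear_zero: "sublinear V q \<Longrightarrow> q \<zero> = 0"
  using sublinear_scale[of q 2 \<zero>] by simp

lemma sublinear_neg: "sublinear V q \<Longrightarrow> x \<in> carrier V \<Longrightarrow> - q (\<ominus> x) \<le> q x"
  using sublinear_add[of q x "\<ominus> x"] by (simp add: sublinear_zero M.r_neg)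

text \<open>The functional \<open>q' x = inf {q (x + t c) - t \<alpha> | t \<ge> 0, c \<in> C}\<close> is the largest sublinear functional below \<open>q\<close>
with \<open>q' (- c) \<le> - \<alpha>\<close> on \<open>C\<close>. Convexity of \<open>C\<close> gives subadditivity, since \<open>t c + s d\<close> is \<open>t + s\<close> times an
element of \<open>C\<close>; the bound \<open>\<alpha> \<le> q\<close> on \<open>C\<close> keeps the infimum finite.\<close>

lemma sublinear_shift:
  assumes q: "sublinear V q" and C: "convex_in V C" "C \<noteq> {}" and \<alpha>: "\<And>c. c \<in> C \<Longrightarrow> \<alpha> \<le> q c"
  obtains q' where "sublinear V q'" "\<And>x. x \<in> carrier V \<Longrightarrow> q' x \<le> q x"
    "\<And>c. c \<in> C \<Longrightarrow> q' (\<ominus> c) \<le> - \<alpha>"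
proof -
  have CV: "c \<in> carrier V" if "c \<in> C" for c using C that by (auto simp: convex_in_def)
  define A where "A x = {q (x \<oplus> of_real t \<odot> c) - t * \<alpha> | t c. t \<ge> 0 \<and> c \<in> C}" for x
  have AI: "q (x \<oplus> of_real t \<odot> c) - t * \<alpha> \<in> A x" if "t \<ge> 0" "c \<in> C" for x t c
    using that by (auto simp: A_def)
  have qc: "t * \<alpha> \<le> q (of_real t \<odot> c)" if "t \<ge> 0" "c \<in> C" for t c
  proof (cases "t = 0")
    case True then show ?thesis using CV[OF that(2)] sublinear_zero[OF q] by simp
  next
    case False then show ?thesis
      using that CV[OF that(2)] \<alpha>[OF that(2)] by (simp add: sublinear_scale[OF q])
  qed
  have low: "- q (\<ominus> x) \<le> a" if x: "x \<in> carrier V" and a: "a \<in> A x" for x a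
  proof -
    obtain t c where t: "t \<ge> 0" "c \<in> C" "a = q (x \<oplus> of_real t \<odot> c) - t * \<alpha>"
      using a by (auto simp: A_def)
    let ?tc = "of_real t \<odot> c"
    have tc: "?tc \<in> carrier V" using CV[OF t(2)] by simp
    have "\<ominus> x \<oplus> (x \<oplus> ?tc) = ?tc" using x tc by (simp add: M.r_neg1)
    then have "q ?tc \<le> q (\<ominus> x) + q (x \<oplus> ?tc)"
      using sublinear_add[OF q, of "\<ominus> x" "x \<oplus> ?tc"] x tc by simp
    then show ?thesis using qc[OF t(1,2)] t(3) by linarith
  qed
  define q' where "q' x = Inf (A x)" for x
  have bdd: "bdd_below (A x)" if "x \<in> carrier V" for x
    by (rule bdd_belowI[of _ "- q (\<ominus> x)"]) (rule low[OF that])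
  have ne: "A x \<noteq> {}" for x using C(2) AI[of 0] by blast
  have le: "q' x \<le> q (x \<oplus> of_real t \<odot> c) - t * \<alpha>" if "x \<in> carrier V" "t \<ge> 0" "c \<in> C" for x t c
    unfolding q'_def using that by (intro cInf_lower bdd AI)
  have comb: "\<exists>e\<in>C. of_real t \<odot> c \<oplus> of_real s \<odot> d = of_real (t + s) \<odot> e"
    if t: "t \<ge> 0" "s \<ge> 0" and cd: "c \<in> C" "d \<in> C" for t s :: real and c d
  proof (cases "t + s = 0")
    case True
    then have "t = 0" "s = 0" using t by auto
    then show ?thesis using cd CV by auto
  next
    case False
    let ?u = "t / (t + s)" and ?v = "s / (t + s)"
    have uv: "?u \<ge> 0" "?v \<ge> 0" "?u + ?v = 1"
      using t False by (auto simp flip: add_divide_distrib)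
    have e: "of_real ?u \<odot> c \<oplus> of_real ?v \<odot> d \<in> C"
      using C(1) uv cd unfolding convex_in_def by blast
    have "of_real (t + s) \<odot> (of_real ?u \<odot> c \<oplus> of_real ?v \<odot> d)
        = of_real ((t + s) * ?u) \<odot> c \<oplus> of_real ((t + s) * ?v) \<odot> d"
      using cd CV by (simp add: sm_add_right sm_assoc del: of_real_divide of_real_add flip: of_real_mult)
    also have "\<dots> = of_real t \<odot> c \<oplus> of_real s \<odot> d" using False by simp
    finally show ?thesis using e by metis
  qed
  have "sublinear V q'"
    unfolding sublinear_def
  proof (intro conjI ballI allI impI)
    fix x y assume x: "x \<in> carrier V" and y: "y \<in> carrier V"
    have *: "q' (x \<oplus> y) \<le> a + b" if a: "a \<in> A x" and b: "b \<in> A y" for a b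
    proof -
      obtain t c where t: "t \<ge> 0" "c \<in> C" "a = q (x \<oplus> of_real t \<odot> c) - t * \<alpha>"
        using a by (auto simp: A_def)
      obtain s d where s: "s \<ge> 0" "d \<in> C" "b = q (y \<oplus> of_real s \<odot> d) - s * \<alpha>"
        using b by (auto simp: A_def)
      obtain e where e: "e \<in> C" "of_real t \<odot> c \<oplus> of_real s \<odot> d = of_real (t + s) \<odot> e"
        using comb t s by blast
      have "q' (x \<oplus> y) \<le> q (x \<oplus> y \<oplus> of_real (t + s) \<odot> e) - (t + s) * \<alpha>"
        using x y t s e by (intro le) auto
      also have "x \<oplus> y \<oplus> of_real (t + s) \<odot> e = (x \<oplus> of_real t \<odot> c) \<oplus> (y \<oplus> of_real s \<odot> d)"
        unfolding e(2)[symmetric] using x y CV[OF t(2)] CV[OF s(2)] by (simp add: M.a_ac)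
      also have "q \<dots> \<le> q (x \<oplus> of_real t \<odot> c) + q (y \<oplus> of_real s \<odot> d)"
        using x y CV[OF t(2)] CV[OF s(2)] by (intro sublinear_add[OF q]) auto
      finally show ?thesis using t s by (simp add: algebra_simps)
    qed
    have "q' (x \<oplus> y) - a \<le> q' y" if "a \<in> A x" for a
      unfolding q'_def[of y] using *[OF that] by (intro cInf_greatest ne) (simp add: algebra_simps)
    then have "q' (x \<oplus> y) - q' y \<le> q' x"
      unfolding q'_def[of x] by (intro cInf_greatest ne) (simp add: algebra_simps)
    then show "q' (x \<oplus> y) \<le> q' x + q' y" by simp
  next
    fix r :: real and x assume r: "r > 0" and x: "x \<in> carrier V"
    have "q' (of_real r \<odot> x) / r \<le> a" if a: "a \<in> A x" for a
    proof -
      obtain t c where t: "t \<ge> 0" "c \<in> C" "a = q (x \<oplus> of_real t \<odot> c) - t * \<alpha>"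
        using a by (auto simp: A_def)
      have "q' (of_real r \<odot> x) \<le> q (of_real r \<odot> x \<oplus> of_real (r * t) \<odot> c) - (r * t) * \<alpha>"
        using x t r by (intro le) auto
      also have "of_real r \<odot> x \<oplus> of_real (r * t) \<odot> c = of_real r \<odot> (x \<oplus> of_real t \<odot> c)"
        using x CV[OF t(2)] by (simp add: sm_add_right sm_assoc)
      also have "q \<dots> = r * q (x \<oplus> of_real t \<odot> c)"
        using x CV[OF t(2)] r by (intro sublinear_scale[OF q]) auto
      finally have "q' (of_real r \<odot> x) \<le> r * a" unfolding t(3) by (simp add: algebra_simps)
      then show ?thesis using r by (simp add: field_simps)
    qed
    then have "q' (of_real r \<odot> x) / r \<le> q' x"
      unfolding q'_def[of x] by (intro cInf_greatest ne)
    then show "q' (of_real r \<odot> x) \<le> r * q' x" using r by (simp add: field_simps)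
  qed
  moreover have "q' x \<le> q x" if x: "x \<in> carrier V" for x
  proof -
    obtain c where "c \<in> C" using C(2) by blast
    then show ?thesis using le[OF x, of 0 c] CV x by simp
  qed
  moreover have "q' (\<ominus> c) \<le> - \<alpha>" if c: "c \<in> C" for c
    using le[of "\<ominus> c" 1 c] c CV[OF c] sublinear_zero[OF q] by (simp add: M.l_neg)
  ultimately show ?thesis by (rule that)
qed

text \<open>Zorn's lemma: the infimum of a chain of sublinear functionals below \<open>p\<close> is finite, since each of them is
at least \<open>- p (- x)\<close> at \<open>x\<close>, and it is again sublinear.\<close>

lemma minimal_sublinear_below:
  assumes p: "sublinear V p"
  obtains q where "sublinear V q" "\<And>x. x \<in> carrier V \<Longrightarrow> q x \<le> p x"
    "\<And>q' x. sublinear V q' \<Longrightarrow> (\<And>y. y \<in> carrier V \<Longrightarrow> q' y \<le> q y) \<Longrightarrow> x \<in> carrier V \<Longrightarrow> q' x = q x"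
proof -
  \<comment> \<open>Fixing the value 0 off the carrier makes the pointwise order antisymmetric.\<close>
  define A where "A = {q. sublinear V q \<and> (\<forall>x\<in>carrier V. q x \<le> p x) \<and> (\<forall>x. x \<notin> carrier V \<longrightarrow> q x = 0)}"
  define P where "P q q' \<longleftrightarrow> (\<forall>x. q' x \<le> (q x :: real))" for q q' :: "'a \<Rightarrow> real"
  have cut: "sublinear V (\<lambda>x. if x \<in> carrier V then q x else 0)" if "sublinear V q" for q
    using that by (auto simp: sublinear_def)
  have pA: "(\<lambda>x. if x \<in> carrier V then p x else 0) \<in> A"
    using cut[OF p] by (auto simp: A_def)
  have "\<exists>m\<in>A. \<forall>a\<in>A. P m a \<longrightarrow> a = m"
  proof (rule predicate_Zorn)
    show "partial_order_on A (relation_of P A)"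
    proof (rule partial_order_on_relation_ofI)
      show "P a a" for a by (simp add: P_def)
      show "P a c" if "P a b" "P b c" for a b c
        using that unfolding P_def by (meson order_trans)
      show "a = b" if "P a b" "P b a" for a b
        using that unfolding P_def by (intro ext antisym) auto
    qed
  next
    fix C assume C: "C \<in> Chains (relation_of P A)"
    have CA: "C \<subseteq> A" and total: "\<And>q q'. q \<in> C \<Longrightarrow> q' \<in> C \<Longrightarrow> P q q' \<or> P q' q"
      using C by (auto simp: Chains_def relation_of_def)
    show "\<exists>u\<in>A. \<forall>a\<in>C. P a u"
    proof (cases "C = {}")
      case True then show ?thesis using pA by auto
    next
      case False
      define u where "u x = (if x \<in> carrier V then Inf ((\<lambda>q. q x) ` C) else 0)" for x
      have bdd: "bdd_below ((\<lambda>q. q x) ` C)" if x: "x \<in> carrier V" for x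
      proof (rule bdd_belowI2)
        fix q assume "q \<in> C"
        then have "sublinear V q" "q (\<ominus> x) \<le> p (\<ominus> x)" using CA x by (auto simp: A_def)
        then show "- p (\<ominus> x) \<le> q x" using sublinear_neg[of q x] x by simp
      qed
      have low: "u x \<le> q x" if "x \<in> carrier V" "q \<in> C" for x q
        using that bdd by (auto simp: u_def intro: cInf_lower)
      have great: "a \<le> u x" if "x \<in> carrier V" "\<And>q. q \<in> C \<Longrightarrow> a \<le> q x" for x a
        using that False by (auto simp: u_def intro!: cInf_greatest)
      have "sublinear V u" unfolding sublinear_def
      proof (intro conjI ballI allI impI)
        fix x y assume x: "x \<in> carrier V" and y: "y \<in> carrier V"
        have *: "u (x \<oplus> y) \<le> q1 x + q2 y" if q: "q1 \<in> C" "q2 \<in> C" for q1 q2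
        proof -
          obtain q where q: "q \<in> C" "P q1 q" "P q2 q"
          proof (cases "P q1 q2")
            case True
            then show ?thesis using that[of q2] q by (simp add: P_def)
          next
            case False
            then have "P q2 q1" using total[OF q] by simp
            then show ?thesis using that[of q1] q by (simp add: P_def)
          qed
          have "u (x \<oplus> y) \<le> q (x \<oplus> y)" using low q x y by simp
          also have "\<dots> \<le> q x + q y"
            using q CA x y by (intro sublinear_add) (auto simp: A_def)
          also have "\<dots> \<le> q1 x + q2 y" using q(2,3) by (simp add: P_def add_mono)
          finally show ?thesis .
        qed
        have "u (x \<oplus> y) - q1 x \<le> u y" if "q1 \<in> C" for q1
          using *[OF that] y by (intro great) (auto simp: algebra_simps)
        then have "u (x \<oplus> y) - u y \<le> u x"
          using x by (intro great) (auto simp: algebra_simps)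
        then show "u (x \<oplus> y) \<le> u x + u y" by simp
      next
        fix r :: real and x assume r: "r > 0" and x: "x \<in> carrier V"
        have "u (of_real r \<odot> x) / r \<le> u x"
        proof (rule great[OF x])
          fix q assume q: "q \<in> C"
          then have "q (of_real r \<odot> x) = r * q x"
            using CA r x by (intro sublinear_scale) (auto simp: A_def)
          then show "u (of_real r \<odot> x) / r \<le> q x"
            using low[of "of_real r \<odot> x" q] q x r by (simp add: field_simps)
        qed
        then show "u (of_real r \<odot> x) \<le> r * u x" using r by (simp add: field_simps)
      qed
      moreover have "u x \<le> p x" if "x \<in> carrier V" for x
      proof -
        obtain q where "q \<in> C" using False by blast
        then have "u x \<le> q x" "q x \<le> p x" using low[OF that, of q] CA that by (auto simp: A_def)
        then show ?thesis by simp
      qed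
      ultimately have "u \<in> A" by (auto simp: A_def u_def)
      moreover have "P q u" if "q \<in> C" for q
        using low[OF _ that] that CA by (auto simp: P_def A_def u_def subset_iff)
      ultimately show ?thesis by blast
    qed
  qed
  then obtain m where m: "m \<in> A" "\<And>a. a \<in> A \<Longrightarrow> P m a \<Longrightarrow> a = m" by blast
  show ?thesis
  proof (rule that)
    show "sublinear V m" "\<And>x. x \<in> carrier V \<Longrightarrow> m x \<le> p x" using m(1) by (auto simp: A_def)
    fix q' x assume q': "sublinear V q'" "\<And>y. y \<in> carrier V \<Longrightarrow> q' y \<le> m y" and x: "x \<in> carrier V"
    have "q' y \<le> p y" if "y \<in> carrier V" for y
      using q'(2)[OF that] m(1) that by (force simp: A_def)
    then have "(\<lambda>x. if x \<in> carrier V then q' x else 0) = m"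
      using q'(2) m(1) cut[OF q'(1)] by (intro m(2)) (auto simp: A_def P_def)
    from fun_cong[OF this, of x] show "q' x = m x" using x by simp
  qed
qed

text \<open>A minimal sublinear functional is linear: shifting it along \<open>{a}\<close> with \<open>\<alpha> = q a\<close> does not change it, so
\<open>q (- a) \<le> - q a\<close>, and a sublinear functional that is odd is additive.\<close>

lemma linear_below_sublinear:
  assumes "sublinear V p"
  obtains \<phi> where "real_linear V \<phi>" "\<And>x. x \<in> carrier V \<Longrightarrow> \<phi> x \<le> p x"
proof -
  obtain q where q: "sublinear V q" "\<And>x. x \<in> carrier V \<Longrightarrow> q x \<le> p x"
    and min: "\<And>q' x. sublinear V q' \<Longrightarrow> (\<And>y. y \<in> carrier V \<Longrightarrow> q' y \<le> q y) \<Longrightarrow> x \<in> carrier V \<Longrightarrow> q' x = q x"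
    using minimal_sublinear_below[OF assms] by blast
  have neg: "q (\<ominus> a) = - q a" if a: "a \<in> carrier V" for a
  proof -
    obtain q' where q': "sublinear V q'" "\<And>x. x \<in> carrier V \<Longrightarrow> q' x \<le> q x"
        "\<And>c. c \<in> {a} \<Longrightarrow> q' (\<ominus> c) \<le> - q a"
      by (rule sublinear_shift[OF q(1) convex_in_singleton[OF a], of "q a"]) simp_all
    have "q' (\<ominus> a) = q (\<ominus> a)" using a by (intro min q') auto
    then have "q (\<ominus> a) \<le> - q a" using q'(3)[of a] by simp
    then show ?thesis using sublinear_neg[OF q(1) a] by simp
  qed
  have add: "q (x \<oplus> y) = q x + q y" if x: "x \<in> carrier V" and y: "y \<in> carrier V" for x y
  proof (rule antisym)
    show "q (x \<oplus> y) \<le> q x + q y" using sublinear_add[OF q(1) x y] .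
    have "(x \<oplus> y) \<oplus> \<ominus> y = x" using x y by (simp add: M.add.m_assoc M.r_neg)
    then show "q x + q y \<le> q (x \<oplus> y)"
      using sublinear_add[OF q(1), of "x \<oplus> y" "\<ominus> y"] neg[OF y] x y by simp
  qed
  have "q (of_real r \<odot> x) = r * q x" if x: "x \<in> carrier V" for r x
  proof (cases "r > 0")
    case True then show ?thesis using sublinear_scale[OF q(1)] x by simp
  next
    case False
    show ?thesis
    proof (cases "r = 0")
      case True then show ?thesis using sublinear_zero[OF q(1)] x by simp
    next
      case False
      with \<open>\<not> r > 0\<close> have "q (of_real (- r) \<odot> x) = - r * q x"
        using sublinear_scale[OF q(1), of "- r" x] x by simp
      moreover have "\<ominus> (of_real (- r) \<odot> x) = of_real r \<odot> x"
        using x by (simp add: neg_eq_sm sm_assoc)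
      ultimately show ?thesis using neg[of "of_real (- r) \<odot> x"] x by simp
    qed
  qed
  then have "real_linear V q" using add by (simp add: real_linear_def)
  then show ?thesis using that[of q] q(2) by simp
qed

text \<open>A linear functional below the functional obtained by shifting \<open>q\<close> along \<open>C\<close> is at least \<open>\<alpha>\<close> on \<open>C\<close>.\<close>

lemma separation:
  assumes "sublinear V q" "convex_in V C" "C \<noteq> {}" "\<And>c. c \<in> C \<Longrightarrow> \<alpha> \<le> q c"
  obtains \<phi> where "real_linear V \<phi>" "\<And>x. x \<in> carrier V \<Longrightarrow> \<phi> x \<le> q x" "\<And>c. c \<in> C \<Longrightarrow> \<alpha> \<le> \<phi> c"
proof -
  obtain q' where q': "sublinear V q'" "\<And>x. x \<in> carrier V \<Longrightarrow> q' x \<le> q x"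
    "\<And>c. c \<in> C \<Longrightarrow> q' (\<ominus> c) \<le> - \<alpha>"
    using sublinear_shift[OF assms] by blast
  obtain \<phi> where \<phi>: "real_linear V \<phi>" "\<And>x. x \<in> carrier V \<Longrightarrow> \<phi> x \<le> q' x"
    using linear_below_sublinear[OF q'(1)] by blast
  show ?thesis
  proof (rule that[OF \<phi>(1)])
    show "\<phi> x \<le> q x" if "x \<in> carrier V" for x using \<phi>(2)[OF that] q'(2)[OF that] by simp
    show "\<alpha> \<le> \<phi> c" if c: "c \<in> C" for c
    proof -
      have cV: "c \<in> carrier V" using assms(2) c by (auto simp: convex_in_def)
      have "\<phi> (of_real (-1) \<odot> c) = - \<phi> c"
        using \<phi>(1)[unfolded real_linear_def, THEN conjunct2, rule_format, OF cV, of "-1"] by simp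
      then have "\<phi> (\<ominus> c) = - \<phi> c" using cV by (simp add: neg_eq_sm)
      then show ?thesis using \<phi>(2)[of "\<ominus> c"] q'(3)[OF c] cV by simp
    qed
  qed
qed

end

section \<open>Normed spaces, operators and functionals\<close>

locale nspace =
  fixes V :: "('k::real_or_complex, 'a) normed_module" (structure)
  assumes normed: "normed_space V"
begin

sublocale vec_space V
  using normed by (simp add: normed_space_def vec_space_def)

lemma norm_nonneg [simp]: "x \<in> carrier V \<Longrightarrow> 0 \<le> vnorm V x"
  using normed by (simp add: normed_space_def)

lemma norm_eq_zero: "x \<in> carrier V \<Longrightarrow> vnorm V x = 0 \<longleftrightarrow> x = \<zero>"
  using normed by (simp add: normed_space_def)

lemma norm_zero [simp]: "vnorm V \<zero> = 0"
  by (simp add: norm_eq_zero)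

lemma norm_sm: "x \<in> carrier V \<Longrightarrow> vnorm V (c \<odot> x) = norm c * vnorm V x"
  using normed by (simp add: normed_space_def)

lemma norm_add: "x \<in> carrier V \<Longrightarrow> y \<in> carrier V \<Longrightarrow> vnorm V (x \<oplus> y) \<le> vnorm V x + vnorm V y"
  using normed by (simp add: normed_space_def)

lemma norm_neg [simp]: "x \<in> carrier V \<Longrightarrow> vnorm V (\<ominus> x) = vnorm V x"
  by (simp add: neg_eq_sm norm_sm)

lemma norm_minus_triangle:
  assumes "x \<in> carrier V" "y \<in> carrier V" "z \<in> carrier V"
  shows "vnorm V (x \<ominus> z) \<le> vnorm V (x \<ominus> y) + vnorm V (y \<ominus> z)"
proof -
  have "x \<ominus> z = (x \<ominus> y) \<oplus> (y \<ominus> z)"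
    using assms by (simp add: a_minus_def M.a_assoc M.r_neg1)
  then show ?thesis using norm_add[of "x \<ominus> y" "y \<ominus> z"] assms by simp
qed

lemma sublinear_norm: "sublinear V (vnorm V)"
  by (auto simp: sublinear_def norm_add norm_sm)

end

lemma cring_scalar_ring: "cring (scalar_ring :: 'k::real_or_complex ring)"
  by (rule cringI; (rule abelian_groupI comm_monoidI)?)
    (auto simp: scalar_ring_def algebra_simps intro: exI[of _ "- x" for x])

lemma normed_space_scalar_space: "normed_space (scalar_space :: ('k::real_or_complex, 'k) normed_module)"
proof -
  have ag: "abelian_group (scalar_space :: ('k, 'k) normed_module)"
    by (rule abelian_groupI) (auto simp: scalar_space_def algebra_simps intro: exI[of _ "- x" for x])
  have "Module.module scalar_ring (scalar_space :: ('k, 'k) normed_module)"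
    by (rule moduleI[OF cring_scalar_ring ag]) (auto simp: scalar_space_def scalar_ring_def algebra_simps)
  then show ?thesis
    by (auto simp: normed_space_def scalar_space_def norm_mult norm_triangle_ineq)
qed

lemma scalar_space_simps [simp]:
  "carrier scalar_space = UNIV" "x \<oplus>\<^bsub>scalar_space\<^esub> y = x + y" "c \<odot>\<^bsub>scalar_space\<^esub> x = c * x"
  "\<zero>\<^bsub>scalar_space\<^esub> = 0" "vnorm scalar_space = norm"
  by (simp_all add: scalar_space_def)

lemma linear_mapsD:
  assumes "f \<in> linear_maps V W"
  shows "x \<in> carrier V \<Longrightarrow> f x \<in> carrier W"
    "x \<in> carrier V \<Longrightarrow> y \<in> carrier V \<Longrightarrow> f (x \<oplus>\<^bsub>V\<^esub> y) = f x \<oplus>\<^bsub>W\<^esub> f y"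
    "x \<in> carrier V \<Longrightarrow> f (c \<odot>\<^bsub>V\<^esub> x) = c \<odot>\<^bsub>W\<^esub> f x"
  using assms by (auto simp: linear_maps_def)

lemma linear_maps_minus:
  assumes "vec_space V" "vec_space W" "f \<in> linear_maps V W" "x \<in> carrier V" "y \<in> carrier V"
  shows "f (x \<ominus>\<^bsub>V\<^esub> y) = f x \<ominus>\<^bsub>W\<^esub> f y"
  using assms linear_mapsD[OF assms(3)]
  by (simp add: vec_space.minus_eq_sm vec_space.sm_closed)

lemma linear_maps_zero:
  assumes "vec_space V" "vec_space W" "f \<in> linear_maps V W"
  shows "f \<zero>\<^bsub>V\<^esub> = \<zero>\<^bsub>W\<^esub>"
proof -
  interpret V: vec_space V by fact
  interpret W: vec_space W by fact
  have "f (0 \<odot>\<^bsub>V\<^esub> \<zero>\<^bsub>V\<^esub>) = 0 \<odot>\<^bsub>W\<^esub> f \<zero>\<^bsub>V\<^esub>"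
    by (rule linear_mapsD(3)[OF assms(3)]) simp
  then show ?thesis using linear_mapsD(1)[OF assms(3), of "\<zero>\<^bsub>V\<^esub>"] by simp
qed

lemma bounded_ops_bound:
  assumes "normed_space V" "normed_space W" "f \<in> carrier (bounded_ops V W)" "x \<in> carrier V"
  shows "vnorm W (f x) \<le> vnorm (bounded_ops V W) f * vnorm V x"
proof -
  interpret V: nspace V using assms(1) by (rule nspace.intro)
  interpret W: nspace W using assms(2) by (rule nspace.intro)
  have lin: "f \<in> linear_maps V W" using assms(3) by (simp add: bounded_ops_def)
  obtain C where C: "\<And>x. x \<in> carrier V \<Longrightarrow> vnorm W (f x) \<le> C * vnorm V x"
    using assms(3) by (auto simp: bounded_ops_def)
  let ?S = "(\<lambda>x. vnorm W (f x)) ` {x \<in> carrier V. vnorm V x \<le> 1}"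
  have bdd: "bdd_above ?S"
  proof (rule bdd_aboveI2)
    fix x assume "x \<in> {x \<in> carrier V. vnorm V x \<le> 1}"
    then have x: "x \<in> carrier V" "vnorm V x \<le> 1" by auto
    have "vnorm W (f x) \<le> C * vnorm V x" using C x(1) .
    also have "\<dots> \<le> \<bar>C\<bar> * 1" using x by (intro mult_mono) auto
    finally show "vnorm W (f x) \<le> \<bar>C\<bar>" by simp
  qed
  show ?thesis
  proof (cases "x = \<zero>\<^bsub>V\<^esub>")
    case True
    then show ?thesis using linear_maps_zero[OF V.vec_space_axioms W.vec_space_axioms lin] by simp
  next
    case False
    then have pos: "vnorm V x > 0" using V.norm_nonneg[OF assms(4)] V.norm_eq_zero[OF assms(4)] by linarith
    define s where "s = inverse (vnorm V x)"
    have s: "s > 0" "s * vnorm V x = 1" using pos by (simp_all add: s_def)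
    let ?y = "of_real s \<odot>\<^bsub>V\<^esub> x"
    have y: "?y \<in> carrier V" "vnorm V ?y \<le> 1" using assms(4) s by (simp_all add: V.norm_sm)
    have "vnorm W (f ?y) \<le> Sup ?S" using y by (intro cSup_upper bdd) auto
    moreover have "vnorm W (f ?y) = s * vnorm W (f x)"
      using linear_mapsD[OF lin] assms(4) s by (simp add: W.norm_sm)
    ultimately have "s * vnorm W (f x) \<le> Sup ?S" by simp
    then have "vnorm W (f x) \<le> Sup ?S * vnorm V x"
      using pos by (simp add: s_def field_simps)
    then show ?thesis by (simp add: bounded_ops_def)
  qed
qed

lemma bounded_ops_norm_le:
  assumes "normed_space V" "normed_space W" "f \<in> linear_maps V W" "0 \<le> C"
    "\<And>x. x \<in> carrier V \<Longrightarrow> vnorm W (f x) \<le> C * vnorm V x"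
  shows "f \<in> carrier (bounded_ops V W)" "vnorm (bounded_ops V W) f \<le> C"
proof -
  interpret V: nspace V using assms(1) by (rule nspace.intro)
  show "f \<in> carrier (bounded_ops V W)" using assms by (auto simp: bounded_ops_def)
  have "Sup ((\<lambda>x. vnorm W (f x)) ` {x \<in> carrier V. vnorm V x \<le> 1}) \<le> C"
  proof (rule cSup_least)
    show "(\<lambda>x. vnorm W (f x)) ` {x \<in> carrier V. vnorm V x \<le> 1} \<noteq> {}"
      using V.norm_zero V.M.zero_closed by force
  next
    fix a assume "a \<in> (\<lambda>x. vnorm W (f x)) ` {x \<in> carrier V. vnorm V x \<le> 1}"
    then obtain x where x: "x \<in> carrier V" "vnorm V x \<le> 1" "a = vnorm W (f x)" by auto
    then show "a \<le> C"
      using assms(5)[OF x(1)] mult_left_mono[OF x(2) assms(4)] by simp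
  qed
  then show "vnorm (bounded_ops V W) f \<le> C" by (simp add: bounded_ops_def)
qed

lemma contractions_iff:
  assumes "normed_space V" "normed_space W"
  shows "f \<in> contractions V W \<longleftrightarrow> f \<in> linear_maps V W \<and> (\<forall>x\<in>carrier V. vnorm W (f x) \<le> vnorm V x)"
proof
  interpret V: nspace V using assms(1) by (rule nspace.intro)
  assume f: "f \<in> contractions V W"
  then have b: "f \<in> carrier (bounded_ops V W)" "vnorm (bounded_ops V W) f \<le> 1"
    by (auto simp: contractions_def)
  have "vnorm W (f x) \<le> vnorm V x" if "x \<in> carrier V" for x
    using bounded_ops_bound[OF assms b(1) that] mult_right_mono[OF b(2) V.norm_nonneg[OF that]] by simp
  then show "f \<in> linear_maps V W \<and> (\<forall>x\<in>carrier V. vnorm W (f x) \<le> vnorm V x)"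
    using b(1) by (auto simp: bounded_ops_def)
next
  assume "f \<in> linear_maps V W \<and> (\<forall>x\<in>carrier V. vnorm W (f x) \<le> vnorm V x)"
  then show "f \<in> contractions V W"
    using bounded_ops_norm_le[OF assms, of f 1] by (simp add: contractions_def)
qed

lemma dual_linear: "f \<in> carrier (dual V) \<Longrightarrow> f \<in> linear_maps V scalar_space"
  by (simp add: dual_def bounded_ops_def)

lemma dualI:
  assumes "f \<in> linear_maps V scalar_space" "\<And>x. x \<in> carrier V \<Longrightarrow> norm (f x) \<le> C * vnorm V x"
  shows "f \<in> carrier (dual V)"
  using assms by (auto simp: dual_def bounded_ops_def)

context nspace
begin

text \<open>Over the reals \<open>f = \<phi>\<close>. Over the complex numbers \<open>f x = \<phi> x - i \<phi> (i x)\<close>, whose real part is \<open>\<phi>\<close>; rotating \<open>f x\<close>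
to the positive axis reduces the bound on \<open>f\<close> to the one on \<open>\<phi>\<close>.\<close>

lemma functional_dominating_real_linear:
  assumes \<phi>: "real_linear V \<phi>" and le: "\<And>x. x \<in> carrier V \<Longrightarrow> \<phi> x \<le> vnorm V x"
  obtains f where "f \<in> carrier (dual V)" "\<And>x. x \<in> carrier V \<Longrightarrow> norm (f x) \<le> vnorm V x"
    "\<And>x. x \<in> carrier V \<Longrightarrow> \<bar>\<phi> x\<bar> \<le> norm (f x)"
proof -
  have add: "\<phi> (x \<oplus> y) = \<phi> x + \<phi> y" if "x \<in> carrier V" "y \<in> carrier V" for x y
    using \<phi> that by (simp add: real_linear_def)
  have sm: "\<phi> (of_real r \<odot> x) = r * \<phi> x" if "x \<in> carrier V" for r x
    using \<phi> that by (simp add: real_linear_def)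
  consider (real) "\<forall>c::'k. \<exists>r. c = r *\<^sub>R 1" |
      (cpl) i :: 'k where "i * i = - 1" "\<forall>c. \<exists>a b. c = a *\<^sub>R 1 + b *\<^sub>R i \<and> norm c = sqrt (a\<^sup>2 + b\<^sup>2)"
    using real_or_complex[where 'a = 'k] by blast
  then show ?thesis
  proof cases
    case real
    have of_re: "\<exists>r. c = of_real r" for c :: 'k using real by (auto simp: of_real_def)
    define f :: "'a \<Rightarrow> 'k" where "f = (\<lambda>x\<in>carrier V. of_real (\<phi> x))"
    have lin: "f \<in> linear_maps V scalar_space"
    proof -
      have "f (c \<odot> x) = c * f x" if "x \<in> carrier V" for c x
      proof -
        obtain r where "c = of_real r" using of_re by blast
        then show ?thesis using that by (simp add: f_def sm)
      qed
      moreover have "f (x \<oplus> y) = f x + f y" if "x \<in> carrier V" "y \<in> carrier V" for x y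
        using that by (simp add: f_def add)
      ultimately show ?thesis by (auto simp: linear_maps_def f_def)
    qed
    have abs: "norm (f x) = \<bar>\<phi> x\<bar>" if "x \<in> carrier V" for x using that by (simp add: f_def)
    have "\<bar>\<phi> x\<bar> \<le> vnorm V x" if x: "x \<in> carrier V" for x
      using le[OF x] le[of "of_real (-1) \<odot> x"] sm[OF x, of "-1"] x by (auto simp: norm_sm)
    then show ?thesis using lin abs by (intro that[of f] dualI[where C = 1]) auto
  next
    case (cpl i)
    \<comment> \<open>The coordinates of a scalar are unique, because no real number squares to \<open>-1\<close>.\<close>
    have indep: "a = c \<and> b = d" if "a *\<^sub>R 1 + b *\<^sub>R i = c *\<^sub>R 1 + d *\<^sub>R i" for a b c d
    proof -
      have eq: "(b - d) *\<^sub>R i = (c - a) *\<^sub>R 1"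
        using that by (simp add: algebra_simps)
      have "((b - d) *\<^sub>R i) * ((b - d) *\<^sub>R i) = - ((b - d)\<^sup>2) *\<^sub>R 1"
        using cpl(1) by (simp add: power2_eq_square)
      then have "((c - a)\<^sup>2) *\<^sub>R (1::'k) = - ((b - d)\<^sup>2) *\<^sub>R 1"
        unfolding eq by (simp add: power2_eq_square)
      then have "(c - a)\<^sup>2 = - (b - d)\<^sup>2" by (simp only: scaleR_cancel_right) auto
      then have "(c - a)\<^sup>2 + (b - d)\<^sup>2 = 0" by simp
      then show ?thesis by (simp add: sum_power2_eq_zero_iff)
    qed
    have norm_eq: "norm (a *\<^sub>R 1 + b *\<^sub>R i) = sqrt (a\<^sup>2 + b\<^sup>2)" for a b
      using cpl(2) indep by metis
    have cart: "\<exists>a b. c = of_real a + of_real b * i" for c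
      using cpl(2) by (metis scaleR_conv_of_real mult.right_neutral)
    define f :: "'a \<Rightarrow> 'k" where "f = (\<lambda>x\<in>carrier V. of_real (\<phi> x) - of_real (\<phi> (i \<odot> x)) * i)"
    have i2: "i \<odot> (i \<odot> x) = of_real (-1) \<odot> x" if "x \<in> carrier V" for x
      using that cpl(1) by (simp add: sm_assoc)
    have lin: "f \<in> linear_maps V scalar_space"
    proof -
      have "f (c \<odot> x) = c * f x" if x: "x \<in> carrier V" for c x
      proof -
        obtain a b where c: "c = of_real a + of_real b * i" using cart by blast
        have "c \<odot> x = of_real a \<odot> x \<oplus> of_real b \<odot> (i \<odot> x)"
          using x by (simp add: c sm_add_left sm_assoc)
        moreover have "i \<odot> (c \<odot> x) = of_real a \<odot> (i \<odot> x) \<oplus> of_real (- b) \<odot> x"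
        proof -
          have "i * c = of_real a * i + of_real (- b)"
            using cpl(1) by (simp add: c distrib_left mult.left_commute[of i])
          then show ?thesis using x by (simp only: sm_assoc sm_add_left sm_closed)
        qed
        ultimately have "\<phi> (c \<odot> x) = a * \<phi> x + b * \<phi> (i \<odot> x)"
            "\<phi> (i \<odot> (c \<odot> x)) = a * \<phi> (i \<odot> x) + (- b) * \<phi> x"
          using x by (simp_all only: add sm sm_closed)
        then have "f (c \<odot> x) = of_real (a * \<phi> x + b * \<phi> (i \<odot> x)) - of_real (a * \<phi> (i \<odot> x) + (- b) * \<phi> x) * i"
          using x by (simp add: f_def)
        also have "\<dots> = c * f x"
        proof -
          have "(of_real b * i) * (of_real (\<phi> (i \<odot> x)) * i) = - (of_real b * of_real (\<phi> (i \<odot> x)))"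
            using cpl(1) by (metis (no_types, lifting) mult.assoc mult.commute mult_minus1)
          then show ?thesis using x by (simp add: f_def c algebra_simps)
        qed
        finally show ?thesis .
      qed
      moreover have "f (x \<oplus> y) = f x + f y" if "x \<in> carrier V" "y \<in> carrier V" for x y
        using that by (simp add: f_def add sm_add_right algebra_simps)
      ultimately show ?thesis by (auto simp: linear_maps_def f_def)
    qed
    have nf: "norm (f x) = sqrt ((\<phi> x)\<^sup>2 + (\<phi> (i \<odot> x))\<^sup>2)" if "x \<in> carrier V" for x
      using norm_eq[of "\<phi> x" "- \<phi> (i \<odot> x)"] that by (simp add: f_def scaleR_conv_of_real)
    have "norm (f x) \<le> vnorm V x" if x: "x \<in> carrier V" for x
    proof (cases "f x = 0")
      case True then show ?thesis using x by simp
    next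
      case False
      define c where "c = of_real (norm (f x)) / f x"
      have nc: "norm c = 1" using False by (simp add: c_def norm_divide)
      have "f (c \<odot> x) = of_real (norm (f x))"
        using linear_mapsD(3)[OF lin x, of c] False by (simp add: c_def)
      then have "(\<phi> (c \<odot> x)) *\<^sub>R 1 + (- \<phi> (i \<odot> (c \<odot> x))) *\<^sub>R i = (norm (f x)) *\<^sub>R 1 + 0 *\<^sub>R i"
        using x by (simp add: f_def scaleR_conv_of_real)
      then have "norm (f x) = \<phi> (c \<odot> x)" using indep by metis
      also have "\<dots> \<le> vnorm V (c \<odot> x)" using le x by simp
      also have "\<dots> = vnorm V x" using nc x by (simp add: norm_sm)
      finally show ?thesis .
    qed
    moreover have "\<bar>\<phi> x\<bar> \<le> norm (f x)" if "x \<in> carrier V" for x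
      using nf[OF that] by (simp add: real_le_rsqrt)
    ultimately show ?thesis using lin by (intro that[of f] dualI[where C = 1]) auto
  qed
qed

text \<open>Separation with the norm, \<open>C = {x}\<close> and \<open>\<alpha> = vnorm V x\<close>.\<close>

lemma norming_functional:
  assumes x: "x \<in> carrier V"
  obtains f where "f \<in> carrier (dual V)" "\<And>y. y \<in> carrier V \<Longrightarrow> norm (f y) \<le> vnorm V y"
    "vnorm V x \<le> norm (f x)"
proof -
  obtain \<phi> where \<phi>: "real_linear V \<phi>" "\<And>y. y \<in> carrier V \<Longrightarrow> \<phi> y \<le> vnorm V y"
      "\<And>c. c \<in> {x} \<Longrightarrow> vnorm V x \<le> \<phi> c"
    by (rule separation[OF sublinear_norm convex_in_singleton[OF x], of "vnorm V x"]) auto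
  obtain f where f: "f \<in> carrier (dual V)" "\<And>y. y \<in> carrier V \<Longrightarrow> norm (f y) \<le> vnorm V y"
      "\<And>y. y \<in> carrier V \<Longrightarrow> \<bar>\<phi> y\<bar> \<le> norm (f y)"
    using functional_dominating_real_linear[OF \<phi>(1,2)] by metis
  show ?thesis
    using \<phi>(3)[of x] f(3)[OF x] by (intro that[OF f(1,2)]) auto
qed

lemma dual_separates:
  assumes "x \<in> carrier V" "y \<in> carrier V" and eq: "\<And>f. f \<in> carrier (dual V) \<Longrightarrow> f x = f y"
  shows "x = y"
proof -
  obtain f where f: "f \<in> carrier (dual V)" "vnorm V (x \<ominus> y) \<le> norm (f (x \<ominus> y))"
    using norming_functional[of "x \<ominus> y"] assms(1,2) by (metis M.minus_closed)
  have "f (x \<ominus> y) = f x + (-1) * f y"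
    using linear_mapsD(2,3)[OF dual_linear[OF f(1)]] assms by (simp add: minus_eq_sm)
  then have "vnorm V (x \<ominus> y) = 0"
    using f(2) eq[OF f(1)] norm_nonneg[OF M.minus_closed[OF assms(1,2)]] by simp
  then have "x \<ominus> y = \<zero>" using assms(1,2) by (simp add: norm_eq_zero)
  then show ?thesis using assms(1,2) by (simp add: M.minus_eq M.add.inv_solve_right')
qed

end

section \<open>Weak operator closure of convex sets\<close>

lemma linf_sum_simps [simp]:
  "x \<oplus>\<^bsub>linf_sum I X\<^esub> y = (\<lambda>i\<in>I. x i \<oplus>\<^bsub>X i\<^esub> y i)"
  "c \<odot>\<^bsub>linf_sum I X\<^esub> x = (\<lambda>i\<in>I. c \<odot>\<^bsub>X i\<^esub> x i)"
  "\<zero>\<^bsub>linf_sum I X\<^esub> = (\<lambda>i\<in>I. \<zero>\<^bsub>X i\<^esub>)"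
  by (simp_all add: linf_sum_def)

lemma linf_sum_carrierI:
  assumes "x \<in> extensional I" "\<And>i. i \<in> I \<Longrightarrow> x i \<in> carrier (X i)" "\<And>i. i \<in> I \<Longrightarrow> vnorm (X i) (x i) \<le> B"
  shows "x \<in> carrier (linf_sum I X)"
proof -
  have "bdd_above ((\<lambda>i. vnorm (X i) (x i)) ` I)" by (rule bdd_aboveI2) (rule assms(3))
  then show ?thesis using assms by (simp add: linf_sum_def PiE_def Pi_def)
qed

lemma linf_sum_carrierD:
  assumes "x \<in> carrier (linf_sum I X)"
  shows "x \<in> extensional I" "i \<in> I \<Longrightarrow> x i \<in> carrier (X i)"
    "i \<in> I \<Longrightarrow> vnorm (X i) (x i) \<le> vnorm (linf_sum I X) x"
  using assms by (auto simp: linf_sum_def PiE_def intro!: cSup_upper)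

text \<open>These sums serve twice: with a finite index set as the space in which finitely many values of an
operator are separated from a convex set, and below as the space whose quotient is the ultraproduct.\<close>

lemma vec_space_linf_sum:
  assumes "\<And>i. i \<in> I \<Longrightarrow> normed_space (X i)"
  shows "vec_space (linf_sum I X)"
proof -
  let ?L = "linf_sum I X"
  have ns: "nspace (X i)" if "i \<in> I" for i using assms that by (simp add: nspace_def)
  have vs: "vec_space (X i)" if "i \<in> I" for i
  proof -
    interpret nspace "X i" using ns that .
    show ?thesis by (rule vec_space_axioms)
  qed
  have ag: "abelian_group (X i)" if "i \<in> I" for i
    using vs[OF that] by (auto simp: vec_space_def Module.module_def)
  have am: "abelian_monoid (X i)" if "i \<in> I" for i
    using ag[OF that] by (simp add: abelian_group_def)
  note D = linf_sum_carrierD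
  have add: "x \<oplus>\<^bsub>?L\<^esub> y \<in> carrier ?L" if x: "x \<in> carrier ?L" and y: "y \<in> carrier ?L" for x y
  proof (rule linf_sum_carrierI)
    fix i assume i: "i \<in> I"
    show "(x \<oplus>\<^bsub>?L\<^esub> y) i \<in> carrier (X i)"
      using D(2)[OF x i] D(2)[OF y i] i abelian_monoid.a_closed[OF am[OF i]] by simp
    have "vnorm (X i) (x i \<oplus>\<^bsub>X i\<^esub> y i) \<le> vnorm (X i) (x i) + vnorm (X i) (y i)"
      using nspace.norm_add[OF ns[OF i] D(2)[OF x i] D(2)[OF y i]] .
    then show "vnorm (X i) ((x \<oplus>\<^bsub>?L\<^esub> y) i) \<le> vnorm ?L x + vnorm ?L y"
      using D(3)[OF x i] D(3)[OF y i] i by simp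
  qed simp
  have sm: "c \<odot>\<^bsub>?L\<^esub> x \<in> carrier ?L" if x: "x \<in> carrier ?L" for c x
  proof (rule linf_sum_carrierI)
    fix i assume i: "i \<in> I"
    show "(c \<odot>\<^bsub>?L\<^esub> x) i \<in> carrier (X i)"
      using D(2)[OF x i] i vec_space.sm_closed[OF vs[OF i]] by simp
    show "vnorm (X i) ((c \<odot>\<^bsub>?L\<^esub> x) i) \<le> norm c * vnorm ?L x"
      using nspace.norm_sm[OF ns[OF i] D(2)[OF x i], of c] D(3)[OF x i] i
      by (simp add: mult_left_mono)
  qed simp
  have zero: "\<zero>\<^bsub>?L\<^esub> \<in> carrier ?L"
    by (rule linf_sum_carrierI[where B = 0])
      (auto simp: nspace.norm_zero[OF ns] abelian_monoid.zero_closed[OF am])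
  have ext: "x = y" if "x \<in> carrier ?L" "y \<in> carrier ?L" "\<And>i. i \<in> I \<Longrightarrow> x i = y i" for x y
    using that by (auto intro: extensionalityI[OF D(1) D(1)])
  have "abelian_group ?L"
  proof (rule abelian_groupI)
    fix x assume x: "x \<in> carrier ?L"
    have "(-1) \<odot>\<^bsub>?L\<^esub> x \<oplus>\<^bsub>?L\<^esub> x = \<zero>\<^bsub>?L\<^esub>"
    proof (rule ext)
      fix i assume i: "i \<in> I"
      interpret vec_space "X i" using vs i .
      show "((-1) \<odot>\<^bsub>?L\<^esub> x \<oplus>\<^bsub>?L\<^esub> x) i = \<zero>\<^bsub>?L\<^esub> i"
        using D(2)[OF x i] i by (simp add: M.l_neg flip: neg_eq_sm)
    qed (intro add sm x zero)+
    then show "\<exists>y\<in>carrier ?L. y \<oplus>\<^bsub>?L\<^esub> x = \<zero>\<^bsub>?L\<^esub>" using sm[OF x, of "-1"] by blast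
    show "\<zero>\<^bsub>?L\<^esub> \<oplus>\<^bsub>?L\<^esub> x = x"
      by (rule ext[OF add[OF zero x] x]) (simp add: D(2)[OF x] abelian_monoid.l_zero[OF am])
  next
    fix x y z assume x: "x \<in> carrier ?L" and y: "y \<in> carrier ?L" and z: "z \<in> carrier ?L"
    show "x \<oplus>\<^bsub>?L\<^esub> y \<oplus>\<^bsub>?L\<^esub> z = x \<oplus>\<^bsub>?L\<^esub> (y \<oplus>\<^bsub>?L\<^esub> z)"
      by (rule ext[OF add[OF add[OF x y] z] add[OF x add[OF y z]]])
        (simp add: abelian_monoid.a_assoc[OF am D(2)[OF x] D(2)[OF y] D(2)[OF z]])
  next
    fix x y assume x: "x \<in> carrier ?L" and y: "y \<in> carrier ?L"
    show "x \<oplus>\<^bsub>?L\<^esub> y = y \<oplus>\<^bsub>?L\<^esub> x"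
      by (rule ext[OF add[OF x y] add[OF y x]])
        (simp add: abelian_monoid.a_comm[OF am D(2)[OF x] D(2)[OF y]])
    show "x \<oplus>\<^bsub>?L\<^esub> y \<in> carrier ?L" using add x y .
  qed (rule zero)
  then have "Module.module scalar_ring ?L"
  proof (rule moduleI[OF cring_scalar_ring], goal_cases)
    case (1 a x) then show ?case using sm by simp
  next
    case (2 a b x)
    show ?case
      by (rule ext[OF sm[OF 2(3)] add[OF sm[OF 2(3)] sm[OF 2(3)]]])
        (simp add: scalar_ring_def vec_space.sm_add_left[OF vs D(2)[OF 2(3)]])
  next
    case (3 a x y)
    show ?case
      by (rule ext[OF sm[OF add[OF 3(2,3)]] add[OF sm[OF 3(2)] sm[OF 3(3)]]])
        (simp add: vec_space.sm_add_right[OF vs D(2)[OF 3(2)] D(2)[OF 3(3)]])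
  next
    case (4 a b x)
    show ?case
      by (rule ext[OF sm[OF 4(3)] sm[OF sm[OF 4(3)]]])
        (simp add: scalar_ring_def vec_space.sm_assoc[OF vs D(2)[OF 4(3)]])
  next
    case (5 x)
    show ?case
      by (rule ext[OF sm[OF 5] 5])
        (simp add: scalar_ring_def vec_space.sm_one[OF vs D(2)[OF 5]])
  qed
  then show ?thesis by (simp add: vec_space_def)
qed

lemma bounded_ops_simps [simp]:
  "f \<oplus>\<^bsub>bounded_ops V W\<^esub> g = (\<lambda>x\<in>carrier V. f x \<oplus>\<^bsub>W\<^esub> g x)"
  "c \<odot>\<^bsub>bounded_ops V W\<^esub> f = (\<lambda>x\<in>carrier V. c \<odot>\<^bsub>W\<^esub> f x)"
  by (simp_all add: bounded_ops_def)

lemma topspace_weak_operator_topology: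
  "topspace (weak_operator_topology X) \<subseteq> carrier (bounded_ops X X)"
  by (auto simp: weak_operator_topology_def topology_generated_by_topspace)

text \<open>If no \<open>T \<in> C\<close> is close to \<open>S\<close> on \<open>F\<close>, then the convex set of the families \<open>T x - S x\<close> with \<open>x \<in> F\<close> stays outside
the unit ball of the finite power of \<open>X\<close> with the sum norm. A linear functional on this power separates
it from 0; the functional is a sum of functionals of the coordinates, and these define a weak operator
neighbourhood of \<open>S\<close> that \<open>C\<close> does not meet.\<close>

lemma wot_closure_convex_strong_approx:
  fixes X :: "('k::real_or_complex, 'a) normed_module" (structure)
  assumes X: "normed_space X" and C: "convex_in (bounded_ops X X) C"
    and S: "S \<in> weak_operator_topology X closure_of C" and F: "finite F" "F \<subseteq> carrier X"
  shows "\<exists>T\<in>C. (\<Sum>x\<in>F. vnorm X (T x \<ominus>\<^bsub>X\<^esub> S x)) < 1"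
proof (rule ccontr)
  assume far: "\<not> (\<exists>T\<in>C. (\<Sum>x\<in>F. vnorm X (T x \<ominus>\<^bsub>X\<^esub> S x)) < 1)"
  interpret nspace X using X by (rule nspace.intro)
  let ?V = "linf_sum F (\<lambda>_. X)"
  interpret V: vec_space ?V by (rule vec_space_linf_sum) (rule X)
  have CS: "S \<in> carrier (bounded_ops X X)" "C \<subseteq> carrier (bounded_ops X X)"
    using S topspace_weak_operator_topology[of X] C by (auto simp: closure_of_def convex_in_def)
  have lin: "T \<in> linear_maps X X" if "T \<in> insert S C" for T
    using that CS by (auto simp: bounded_ops_def)
  note cl = linear_mapsD(1)[OF lin]
  have memV: "z \<in> carrier ?V \<longleftrightarrow> z \<in> extensional F \<and> (\<forall>x\<in>F. z x \<in> carrier X)" for z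
    using F(1) by (auto simp: linf_sum_def PiE_def Pi_def)
  define q where "q z = (\<Sum>x\<in>F. vnorm X (z x))" for z
  have q: "sublinear ?V q"
    by (auto simp: sublinear_def memV q_def norm_sm sum_distrib_left norm_add
        intro!: sum_mono simp flip: sum.distrib)
  define d where "d T = (\<lambda>x\<in>F. T x \<ominus>\<^bsub>X\<^esub> S x)" for T
  have dV: "d T \<in> carrier ?V" if "T \<in> C" for T
    using that F(2) cl by (auto simp: memV d_def)
  have conv: "convex_in ?V (d ` C)"
    unfolding convex_in_def
  proof (intro conjI ballI allI impI)
    show "d ` C \<subseteq> carrier ?V" using dV by auto
    fix a b and u v :: real assume "a \<in> d ` C" "b \<in> d ` C" and uv: "0 \<le> u" "0 \<le> v" "u + v = 1"
    then obtain T T' where T: "T \<in> C" "T' \<in> C" "a = d T" "b = d T'" by auto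
    let ?T = "of_real u \<odot>\<^bsub>bounded_ops X X\<^esub> T \<oplus>\<^bsub>bounded_ops X X\<^esub> of_real v \<odot>\<^bsub>bounded_ops X X\<^esub> T'"
    have TC: "?T \<in> C" using C T uv unfolding convex_in_def by blast
    have "of_real u \<odot>\<^bsub>?V\<^esub> a \<oplus>\<^bsub>?V\<^esub> of_real v \<odot>\<^bsub>?V\<^esub> b = d ?T"
    proof (rule extensionalityI[where A = F])
      fix x assume x: "x \<in> F"
      then have xX: "x \<in> carrier X" using F(2) by auto
      have c: "T x \<in> carrier X" "T' x \<in> carrier X" "S x \<in> carrier X" using cl T xX by auto
      have "of_real u \<odot> ((-1) \<odot> S x) \<oplus> of_real v \<odot> ((-1) \<odot> S x) = (of_real (u + v) * (-1)) \<odot> S x"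
        using c by (simp add: sm_assoc flip: sm_add_left)
      then have "of_real u \<odot> ((-1) \<odot> S x) \<oplus> of_real v \<odot> ((-1) \<odot> S x) = (-1) \<odot> S x"
        using uv by simp
      then have "of_real u \<odot> (T x \<ominus> S x) \<oplus> of_real v \<odot> (T' x \<ominus> S x)
          = (of_real u \<odot> T x \<oplus> of_real v \<odot> T' x) \<ominus> S x"
        using c by (simp add: minus_eq_sm sm_add_right M.a_ac)
      then show "(of_real u \<odot>\<^bsub>?V\<^esub> a \<oplus>\<^bsub>?V\<^esub> of_real v \<odot>\<^bsub>?V\<^esub> b) x = d ?T x"
        using x xX by (simp add: T d_def)
    qed (auto simp: d_def)
    then show "of_real u \<odot>\<^bsub>?V\<^esub> a \<oplus>\<^bsub>?V\<^esub> of_real v \<odot>\<^bsub>?V\<^esub> b \<in> d ` C" using TC by auto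
  qed
  have "C \<noteq> {}" using S by auto
  moreover have far': "1 \<le> q c" if "c \<in> d ` C" for c
    using that far by (auto simp: q_def d_def not_less)
  ultimately obtain \<phi> where \<phi>: "real_linear ?V \<phi>" "\<And>z. z \<in> carrier ?V \<Longrightarrow> \<phi> z \<le> q z"
      "\<And>c. c \<in> d ` C \<Longrightarrow> 1 \<le> \<phi> c"
    using V.separation[OF q conv, of 1] by (metis image_is_empty)
  define e where "e x v = (\<lambda>y\<in>F. if y = x then v else \<zero>)" for x v
  have eV: "e x v \<in> carrier ?V" if "v \<in> carrier X" for x v
    using that by (auto simp: memV e_def)
  have \<phi>add: "\<phi> (y \<oplus>\<^bsub>?V\<^esub> z) = \<phi> y + \<phi> z" if "y \<in> carrier ?V" "z \<in> carrier ?V" for y z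
    using \<phi>(1) that unfolding real_linear_def by blast
  have \<phi>sm: "\<phi> (of_real r \<odot>\<^bsub>?V\<^esub> z) = r * \<phi> z" if "z \<in> carrier ?V" for r z
    using \<phi>(1) that unfolding real_linear_def by blast
  have "\<exists>f\<in>carrier (dual X). \<forall>v\<in>carrier X. \<bar>\<phi> (e x v)\<bar> \<le> norm (f v)" if x: "x \<in> F" for x
  proof -
    have "real_linear X (\<lambda>v. \<phi> (e x v))"
    proof -
      have "e x (v \<oplus> w) = e x v \<oplus>\<^bsub>?V\<^esub> e x w" if "v \<in> carrier X" "w \<in> carrier X" for v w
        using that by (auto simp: e_def fun_eq_iff)
      moreover have "e x (of_real r \<odot> v) = of_real r \<odot>\<^bsub>?V\<^esub> e x v" if "v \<in> carrier X" for r v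
        using that by (auto simp: e_def fun_eq_iff)
      ultimately show ?thesis using \<phi>add \<phi>sm eV by (simp add: real_linear_def del: linf_sum_simps)
    qed
    moreover have "\<phi> (e x v) \<le> vnorm X v" if v: "v \<in> carrier X" for v
    proof -
      have "q (e x v) = (\<Sum>y\<in>F. if y = x then vnorm X v else 0)"
        unfolding q_def by (rule sum.cong) (auto simp: e_def)
      also have "\<dots> = vnorm X v" using x F(1) by simp
      finally show ?thesis using \<phi>(2)[OF eV[OF v, of x]] by simp
    qed
    ultimately show ?thesis using functional_dominating_real_linear by metis
  qed
  then obtain f where f: "\<And>x. x \<in> F \<Longrightarrow> f x \<in> carrier (dual X)"
      "\<And>x v. x \<in> F \<Longrightarrow> v \<in> carrier X \<Longrightarrow> \<bar>\<phi> (e x v)\<bar> \<le> norm (f x v)"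
    by metis
  \<comment> \<open>The functional is the sum of its restrictions to the coordinates, by induction over the support.\<close>
  have split: "\<phi> (\<lambda>y\<in>F. if y \<in> G then z y else \<zero>) = (\<Sum>x\<in>G. \<phi> (e x (z x)))"
    if G: "finite G" "G \<subseteq> F" and z: "z \<in> carrier ?V" for z G
    using G
  proof (induction G rule: finite_induct)
    case empty
    have "(\<lambda>y\<in>F. if y \<in> {} then z y else \<zero>) = of_real 0 \<odot>\<^bsub>?V\<^esub> z"
      using z by (auto simp: memV fun_eq_iff)
    then show ?case using \<phi>sm[OF z, of 0] by (simp del: linf_sum_simps)
  next
    case (insert x G)
    let ?r = "\<lambda>y\<in>F. if y \<in> G then z y else \<zero>"
    have "(\<lambda>y\<in>F. if y \<in> insert x G then z y else \<zero>) = ?r \<oplus>\<^bsub>?V\<^esub> e x (z x)"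
      using z insert.hyps by (auto simp: memV fun_eq_iff e_def)
    moreover have "?r \<in> carrier ?V" using z by (auto simp: memV)
    moreover have "e x (z x) \<in> carrier ?V" using z insert.prems by (intro eV) (auto simp: memV)
    moreover have "\<phi> ?r = (\<Sum>x\<in>G. \<phi> (e x (z x)))" using insert.IH insert.prems by blast
    ultimately show ?case using insert.hyps \<phi>add by (simp only: sum.insert[OF insert.hyps] add.commute)
  qed
  define N where "N = (\<Inter>x\<in>F. {T \<in> carrier (bounded_ops X X). f x (T x) \<in> ball (f x (S x)) (1 / card F)})"
  have "F \<noteq> {}"
    using far' \<open>C \<noteq> {}\<close> by (force simp: q_def)
  then have cF: "card F > 0" using F(1) by (simp add: card_gt_0_iff)
  have "openin (weak_operator_topology X) N"
    unfolding N_def weak_operator_topology_def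
  proof (intro openin_INT2 topology_generated_by_Basis F(1) \<open>F \<noteq> {}\<close>)
    fix x assume "x \<in> F"
    then show "{T \<in> carrier (bounded_ops X X). f x (T x) \<in> ball (f x (S x)) (1 / card F)} \<in>
        {{T \<in> carrier (bounded_ops X X). g (T x) \<in> G} | g x G.
          g \<in> carrier (dual X) \<and> x \<in> carrier X \<and> open G}"
      using F(2) f(1) open_ball by blast
  qed
  moreover have "S \<in> N" using CS cF by (auto simp: N_def)
  ultimately obtain T where T: "T \<in> C" "T \<in> N"
    using S by (auto simp: in_closure_of)
  have "1 \<le> \<phi> (d T)" using \<phi>(3) T by simp
  also have "d T = (\<lambda>y\<in>F. if y \<in> F then d T y else \<zero>)" by (auto simp: d_def fun_eq_iff)
  also have "\<phi> \<dots> = (\<Sum>x\<in>F. \<phi> (e x (d T x)))" by (rule split) (use F dV T in auto)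
  also have "\<dots> < (\<Sum>x\<in>F. 1 / card F)"
  proof (rule sum_strict_mono[OF F(1) \<open>F \<noteq> {}\<close>])
    fix x assume x: "x \<in> F"
    then have c: "T x \<in> carrier X" "S x \<in> carrier X" using cl T F(2) by auto
    have "\<phi> (e x (d T x)) \<le> norm (f x (T x \<ominus> S x))"
      using f(2)[OF x, of "T x \<ominus> S x"] c x by (simp add: d_def)
    also have "f x (T x \<ominus> S x) = f x (T x) - f x (S x)"
      using linear_mapsD(2,3)[OF dual_linear[OF f(1)[OF x]]] c by (simp add: minus_eq_sm)
    also have "norm \<dots> < 1 / card F"
      using T(2) x by (auto simp: N_def dist_norm norm_minus_commute)
    finally show "\<phi> (e x (d T x)) < 1 / card F" .
  qed
  also have "\<dots> = 1" using cF by simp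
  finally show False by simp
qed

section \<open>Means of operators\<close>

primrec vsum :: "('k, 'a) normed_module \<Rightarrow> (nat \<Rightarrow> 'a) \<Rightarrow> nat \<Rightarrow> 'a" where
  "vsum V f 0 = \<zero>\<^bsub>V\<^esub>"
| "vsum V f (Suc n) = vsum V f n \<oplus>\<^bsub>V\<^esub> f n"

lemma vsum_cong: "(\<And>k. k < n \<Longrightarrow> f k = g k) \<Longrightarrow> vsum V f n = vsum V g n"
  by (induction n) auto

context vec_space
begin

lemma vsum_closed [simp]: "(\<And>k. k < n \<Longrightarrow> f k \<in> carrier V) \<Longrightarrow> vsum V f n \<in> carrier V"
  by (induction n) auto

lemma vsum_add:
  assumes "\<And>k. k < n \<Longrightarrow> f k \<in> carrier V" "\<And>k. k < n \<Longrightarrow> g k \<in> carrier V"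
  shows "vsum V (\<lambda>k. f k \<oplus> g k) n = vsum V f n \<oplus> vsum V g n"
  using assms by (induction n) (simp_all add: M.a_ac)

lemma vsum_sm:
  assumes "\<And>k. k < n \<Longrightarrow> f k \<in> carrier V"
  shows "vsum V (\<lambda>k. c \<odot> f k) n = c \<odot> vsum V f n"
  using assms by (induction n) (simp_all add: sm_add_right)

lemma vsum_const: "x \<in> carrier V \<Longrightarrow> vsum V (\<lambda>_. x) n = of_nat n \<odot> x"
  by (induction n) (simp_all add: sm_add_left M.a_comm)

lemma vsum_append:
  assumes "\<And>k. k < m + n \<Longrightarrow> f k \<in> carrier V"
  shows "vsum V f (m + n) = vsum V f m \<oplus> vsum V (\<lambda>k. f (m + k)) n"
  using assms by (induction n) (simp_all add: M.a_assoc)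

lemma vsum_blocks:
  assumes "\<And>k. k < L * M \<Longrightarrow> f k \<in> carrier V"
  shows "vsum V f (L * M) = vsum V (\<lambda>q. vsum V (\<lambda>r. f (q * M + r)) M) L"
  using assms
proof (induction L)
  case (Suc L)
  have "vsum V f (Suc L * M) = vsum V f (L * M + M)" by (simp add: add.commute)
  also have "\<dots> = vsum V f (L * M) \<oplus> vsum V (\<lambda>r. f (L * M + r)) M"
    by (rule vsum_append) (use Suc.prems in \<open>simp add: add.commute\<close>)
  finally show ?case using Suc by simp
qed simp

end

lemma (in nspace) norm_vsum:
  "(\<And>k. k < n \<Longrightarrow> f k \<in> carrier V) \<Longrightarrow> vnorm V (vsum V f n) \<le> (\<Sum>k<n. vnorm V (f k))"
proof (induction n)
  case (Suc n)
  have "vnorm V (vsum V f n \<oplus> f n) \<le> vnorm V (vsum V f n) + vnorm V (f n)"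
    using Suc.prems by (intro norm_add) auto
  also have "\<dots> \<le> (\<Sum>k<n. vnorm V (f k)) + vnorm V (f n)" using Suc by simp
  finally show ?case by simp
qed simp

lemma linear_maps_vsum:
  assumes "vec_space V" "vec_space W" "T \<in> linear_maps V W" "\<And>k. k < n \<Longrightarrow> f k \<in> carrier V"
  shows "T (vsum V f n) = vsum W (\<lambda>k. T (f k)) n"
  using assms(4) linear_mapsD[OF assms(3)] linear_maps_zero[OF assms(1-3)] vec_space.vsum_closed[OF assms(1)]
  by (induction n) simp_all

definition mean_op :: "('k::real_or_complex, 'a) normed_module \<Rightarrow> (nat \<Rightarrow> 'a \<Rightarrow> 'a) \<Rightarrow> nat \<Rightarrow> 'a \<Rightarrow> 'a" where
  "mean_op X \<tau> n = (\<lambda>x\<in>carrier X. of_real (1 / real n) \<odot>\<^bsub>X\<^esub> vsum X (\<lambda>k. \<tau> k x) n)"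

lemma mean_op_contraction:
  assumes X: "normed_space X" and \<tau>: "\<And>k. k < n \<Longrightarrow> \<tau> k \<in> contractions X X"
  shows "mean_op X \<tau> n \<in> contractions X X"
proof -
  interpret nspace X using X by (rule nspace.intro)
  have lin: "\<tau> k \<in> linear_maps X X" and le: "\<And>x. x \<in> carrier X \<Longrightarrow> vnorm X (\<tau> k x) \<le> vnorm X x"
    if "k < n" for k using \<tau>[OF that] by (auto simp: contractions_iff[OF X X])
  note D = linear_mapsD[OF lin]
  have "mean_op X \<tau> n \<in> linear_maps X X"
    unfolding linear_maps_def
  proof (intro CollectI conjI ballI allI)
    fix x y assume x: "x \<in> carrier X" and y: "y \<in> carrier X"
    have "vsum X (\<lambda>k. \<tau> k (x \<oplus>\<^bsub>X\<^esub> y)) n = vsum X (\<lambda>k. \<tau> k x \<oplus>\<^bsub>X\<^esub> \<tau> k y) n"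
      by (rule vsum_cong) (simp add: D x y)
    then show "mean_op X \<tau> n (x \<oplus>\<^bsub>X\<^esub> y) = mean_op X \<tau> n x \<oplus>\<^bsub>X\<^esub> mean_op X \<tau> n y"
      using x y D by (simp add: mean_op_def vsum_add sm_add_right)
  next
    fix c x assume x: "x \<in> carrier X"
    have "vsum X (\<lambda>k. \<tau> k (c \<odot>\<^bsub>X\<^esub> x)) n = vsum X (\<lambda>k. c \<odot>\<^bsub>X\<^esub> \<tau> k x) n"
      by (rule vsum_cong) (simp add: D x)
    then show "mean_op X \<tau> n (c \<odot>\<^bsub>X\<^esub> x) = c \<odot>\<^bsub>X\<^esub> mean_op X \<tau> n x"
      using x D by (simp add: mean_op_def vsum_sm sm_assoc mult.commute)
  qed (auto simp: mean_op_def D)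
  moreover have "vnorm X (mean_op X \<tau> n x) \<le> vnorm X x" if x: "x \<in> carrier X" for x
  proof -
    have "vnorm X (vsum X (\<lambda>k. \<tau> k x) n) \<le> (\<Sum>k<n. vnorm X (\<tau> k x))"
      using x D by (intro norm_vsum) auto
    also have "\<dots> \<le> (\<Sum>k<n. vnorm X x)" using x le by (intro sum_mono) auto
    finally have le_n: "vnorm X (vsum X (\<lambda>k. \<tau> k x) n) \<le> n * vnorm X x" by simp
    have "vnorm X (mean_op X \<tau> n x) = (1 / real n) * vnorm X (vsum X (\<lambda>k. \<tau> k x) n)"
      using x D by (simp add: mean_op_def norm_sm norm_divide)
    also have "\<dots> \<le> (1 / real n) * (n * vnorm X x)"
      by (rule mult_left_mono[OF le_n]) simp
    also have "\<dots> \<le> vnorm X x" using x by simp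
    finally show ?thesis .
  qed
  ultimately show ?thesis by (simp add: contractions_iff[OF X X])
qed

lemma bounded_ops_combination:
  fixes X :: "('k::real_or_complex, 'a) normed_module" (structure)
  assumes X: "normed_space X" and "S \<in> carrier (bounded_ops X X)" "T \<in> carrier (bounded_ops X X)"
  shows "a \<odot>\<^bsub>bounded_ops X X\<^esub> S \<oplus>\<^bsub>bounded_ops X X\<^esub> b \<odot>\<^bsub>bounded_ops X X\<^esub> T
    \<in> carrier (bounded_ops X X)" (is "?R \<in> _")
proof -
  interpret nspace X using X by (rule nspace.intro)
  have lin: "S \<in> linear_maps X X" "T \<in> linear_maps X X"
    using assms(2,3) by (auto simp: bounded_ops_def)
  note S = linear_mapsD[OF lin(1)] and T = linear_mapsD[OF lin(2)]
  have R: "?R x = a \<odot> S x \<oplus> b \<odot> T x" if "x \<in> carrier X" for x using that by simp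
  have "?R \<in> linear_maps X X"
    unfolding linear_maps_def
  proof (intro CollectI conjI ballI allI)
    fix x y assume x: "x \<in> carrier X" and y: "y \<in> carrier X"
    then show "?R (x \<oplus> y) = ?R x \<oplus> ?R y"
      by (simp add: S T sm_add_right M.a_ac)
  next
    fix c x assume x: "x \<in> carrier X"
    then show "?R (c \<odot> x) = c \<odot> ?R x"
      by (simp add: S T sm_add_right sm_assoc mult.commute)
  qed (auto simp: S T)
  moreover have "vnorm X (?R x)
      \<le> (norm a * vnorm (bounded_ops X X) S + norm b * vnorm (bounded_ops X X) T) * vnorm X x"
    if x: "x \<in> carrier X" for x
  proof -
    have "vnorm X (?R x) \<le> norm a * vnorm X (S x) + norm b * vnorm X (T x)"
      using norm_add[of "a \<odot> S x" "b \<odot> T x"] x S(1) T(1) by (simp add: norm_sm)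
    also have "\<dots> \<le> norm a * (vnorm (bounded_ops X X) S * vnorm X x)
        + norm b * (vnorm (bounded_ops X X) T * vnorm X x)"
      using bounded_ops_bound[OF X X] assms(2,3) x by (intro add_mono mult_left_mono) auto
    finally show ?thesis by (simp add: algebra_simps)
  qed
  ultimately show ?thesis by (auto simp: bounded_ops_def)
qed

text \<open>Asking for means of every large number of terms, rather than of some number, makes this class of
operators convex, and it later allows the number of terms to be prescribed independently of the
operator.\<close>

definition strong_limit_of_means :: "('k::real_or_complex, 'a) normed_module \<Rightarrow> ('a \<Rightarrow> 'a) set \<Rightarrow> ('a \<Rightarrow> 'a) \<Rightarrow> bool" where
  "strong_limit_of_means X \<T> T \<longleftrightarrow>
     (\<forall>F \<epsilon>. finite F \<longrightarrow> F \<subseteq> carrier X \<longrightarrow> \<epsilon> > 0 \<longrightarrow>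
        (\<forall>\<^sub>F n in sequentially. \<exists>\<tau>. (\<forall>k<n. \<tau> k \<in> \<T>) \<and>
           (\<forall>x\<in>F. vnorm X (mean_op X \<tau> n x \<ominus>\<^bsub>X\<^esub> T x) < \<epsilon>)))"

lemma mean_op_append:
  fixes X :: "('k::real_or_complex, 'a) normed_module"
  assumes X: "vec_space X" and "\<And>j. j < k \<Longrightarrow> \<sigma> j \<in> linear_maps X X" "\<And>j. j < l \<Longrightarrow> \<tau> j \<in> linear_maps X X"
    and kl: "0 < k" "0 < l" and x: "x \<in> carrier X"
  shows "mean_op X (\<lambda>j. if j < k then \<sigma> j else \<tau> (j - k)) (k + l) x
    = of_real (real k / real (k + l)) \<odot>\<^bsub>X\<^esub> mean_op X \<sigma> k x \<oplus>\<^bsub>X\<^esub>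
      of_real (real l / real (k + l)) \<odot>\<^bsub>X\<^esub> mean_op X \<tau> l x"
proof -
  interpret vec_space X by fact
  have c: "\<sigma> j x \<in> carrier X" if "j < k" for j using assms(2)[OF that] x by (rule linear_mapsD)
  have d: "\<tau> j x \<in> carrier X" if "j < l" for j using assms(3)[OF that] x by (rule linear_mapsD)
  let ?f = "\<lambda>j. (if j < k then \<sigma> j else \<tau> (j - k)) x"
  have f: "?f j \<in> carrier X" if "j < k + l" for j using that c d by auto
  have "vsum X ?f (k + l) = vsum X ?f k \<oplus>\<^bsub>X\<^esub> vsum X (\<lambda>j. ?f (k + j)) l"
    by (rule vsum_append) (rule f)
  also have "vsum X ?f k = vsum X (\<lambda>j. \<sigma> j x) k" by (rule vsum_cong) simp
  also have "vsum X (\<lambda>j. ?f (k + j)) l = vsum X (\<lambda>j. \<tau> j x) l" by (rule vsum_cong) simp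
  finally have *: "vsum X ?f (k + l) = vsum X (\<lambda>j. \<sigma> j x) k \<oplus>\<^bsub>X\<^esub> vsum X (\<lambda>j. \<tau> j x) l" .
  have "(of_real (real k / real (k + l)) * of_real (1 / real k) :: 'k) = of_real (1 / real (k + l))"
    "(of_real (real l / real (k + l)) * of_real (1 / real l) :: 'k) = of_real (1 / real (k + l))"
    using kl by (simp_all only: flip: of_real_mult) simp_all
  then show ?thesis using x c d by (simp only: mean_op_def restrict_apply' * sm_add_right sm_assoc vsum_closed)
qed

text \<open>For \<open>n\<close> terms, \<open>u S + v T\<close> is approximated by \<open>\<lfloor>u n\<rfloor>\<close> terms from a mean for \<open>S\<close> and the remaining ones from a
mean for \<open>T\<close>. Both numbers tend to infinity, as \<open>u\<close> and \<open>v\<close> are positive, and the weights differ from \<open>u\<close>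
and \<open>v\<close> by at most \<open>1 / n\<close>.\<close>

lemma strong_limit_of_means_combination:
  fixes X :: "('k::real_or_complex, 'a) normed_module" (structure)
  assumes X: "normed_space X" and \<T>: "\<T> \<subseteq> contractions X X"
    and S: "S \<in> carrier (bounded_ops X X)" "strong_limit_of_means X \<T> S"
    and T: "T \<in> carrier (bounded_ops X X)" "strong_limit_of_means X \<T> T"
    and uv: "0 < u" "0 < v" "u + v = (1::real)"
    and R: "\<And>x. x \<in> carrier X \<Longrightarrow> R x = of_real u \<odot> S x \<oplus> of_real v \<odot> T x"
  shows "strong_limit_of_means X \<T> R"
  unfolding strong_limit_of_means_def
proof (intro allI impI)
  interpret nspace X using X by (rule nspace.intro)
  fix F and \<epsilon> :: real assume F: "finite F" "F \<subseteq> carrier X" and \<epsilon>: "\<epsilon> > 0"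
  have con: "\<sigma> \<in> linear_maps X X" if "\<sigma> \<in> \<T>" for \<sigma> using that \<T> contractions_iff[OF X X] by auto
  have ST: "S x \<in> carrier X" "T x \<in> carrier X" if "x \<in> F" for x
    using that S(1) T(1) F(2) by (auto simp: bounded_ops_def linear_maps_def)
  define k where "k n = nat \<lfloor>u * real n\<rfloor>" for n
  have u1: "u < 1" using uv by simp
  have kr: "real (k n) \<le> u * n" "u * n - 1 < real (k n)" for n
    using uv(1) by (simp_all add: k_def)
  have kn: "k n \<le> n" for n
  proof -
    have "real (k n) \<le> 1 * real n" using kr(1)[of n] u1 mult_right_mono[of u 1 "real n"] by simp
    then show ?thesis by simp
  qed
  have lr: "real (n - k n) = n - real (k n)" for n using kn[of n] by (simp add: of_nat_diff)
  have k_top: "filterlim k at_top sequentially" "filterlim (\<lambda>n. n - k n) at_top sequentially"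
  proof -
    have "filterlim (\<lambda>n. u * real n - 1) at_top sequentially"
      using uv(1) by real_asymp
    then have "filterlim (\<lambda>n. real (k n)) at_top sequentially"
      by (rule filterlim_at_top_mono) (use kr(2) in \<open>auto intro!: always_eventually less_imp_le\<close>)
    then show "filterlim k at_top sequentially" by (simp add: filterlim_sequentially_iff_filterlim_real)
    have "filterlim (\<lambda>n. v * real n) at_top sequentially" using uv(2) by real_asymp
    moreover have "v * real n \<le> real (n - k n)" for n
    proof -
      have "u * real n + v * real n = real n" using uv(3) by (simp flip: distrib_right)
      then show ?thesis using kr(1)[of n] lr[of n] by linarith
    qed
    ultimately have "filterlim (\<lambda>n. real (n - k n)) at_top sequentially"
      by (auto intro: filterlim_at_top_mono always_eventually)
    then show "filterlim (\<lambda>n. n - k n) at_top sequentially"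
      by (simp add: filterlim_sequentially_iff_filterlim_real)
  qed
  define P where "P T n \<tau> \<longleftrightarrow> (\<forall>k<n. \<tau> k \<in> \<T>) \<and> (\<forall>x\<in>F. vnorm X (mean_op X \<tau> n x \<ominus> T x) < \<epsilon> / 4)" for T n \<tau>
  have "\<forall>\<^sub>F n in sequentially. \<exists>\<tau>. P S n \<tau>" "\<forall>\<^sub>F n in sequentially. \<exists>\<tau>. P T n \<tau>"
    unfolding P_def
    using S(2)[unfolded strong_limit_of_means_def, rule_format, OF F, of "\<epsilon> / 4"]
      T(2)[unfolded strong_limit_of_means_def, rule_format, OF F, of "\<epsilon> / 4"] \<epsilon> by auto
  from eventually_compose_filterlim[OF this(1) k_top(1)] eventually_compose_filterlim[OF this(2) k_top(2)]
  have ev: "\<forall>\<^sub>F n in sequentially. \<exists>\<tau>. P S (k n) \<tau>" "\<forall>\<^sub>F n in sequentially. \<exists>\<tau>. P T (n - k n) \<tau>" .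
  have ev0: "\<forall>\<^sub>F n in sequentially. k n > 0" "\<forall>\<^sub>F n in sequentially. n - k n > 0"
    using k_top[THEN eventually_compose_filterlim[OF eventually_gt_at_top[of 0]]] .
  have "\<forall>\<^sub>F n in sequentially. (vnorm X (S x) + vnorm X (T x)) * (1 / real n) < \<epsilon> / 2" for x
  proof -
    have "(\<lambda>n. (vnorm X (S x) + vnorm X (T x)) * (1 / real n)) \<longlonglongrightarrow> (vnorm X (S x) + vnorm X (T x)) * 0"
      by (intro tendsto_intros lim_1_over_n)
    then show ?thesis using \<epsilon> by (intro order_tendstoD(2)) auto
  qed
  then have "\<forall>\<^sub>F n in sequentially. \<forall>x\<in>F. (vnorm X (S x) + vnorm X (T x)) * (1 / real n) < \<epsilon> / 2"
    by (intro eventually_ball_finite F(1)) auto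
  then show "\<forall>\<^sub>F n in sequentially. \<exists>\<tau>. (\<forall>k<n. \<tau> k \<in> \<T>) \<and>
           (\<forall>x\<in>F. vnorm X (mean_op X \<tau> n x \<ominus> R x) < \<epsilon>)"
    using ev ev0
  proof eventually_elim
    case (elim n)
    obtain \<sigma> where \<sigma>: "P S (k n) \<sigma>" using elim by blast
    obtain \<tau> where \<tau>: "P T (n - k n) \<tau>" using elim by blast
    define \<rho> where "\<rho> = (\<lambda>j. if j < k n then \<sigma> j else \<tau> (j - k n))"
    define r where "r = real (k n) / real n"
    define s where "s = real (n - k n) / real n"
    have n: "n > 0" using elim by linarith
    have rs: "0 \<le> r" "0 \<le> s" "r \<le> 1" "s \<le> 1" "\<bar>r - u\<bar> \<le> 1 / n" "\<bar>s - v\<bar> \<le> 1 / n"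
    proof -
      show "0 \<le> r" "0 \<le> s" by (simp_all add: r_def s_def)
      show "r \<le> 1" using kn[of n] n by (simp add: r_def)
      show "s \<le> 1" using n by (simp add: s_def)
      have "r - u = (real (k n) - u * n) / n" using n by (simp add: r_def field_simps)
      then have "\<bar>r - u\<bar> = \<bar>real (k n) - u * n\<bar> / n" by simp
      also have "\<dots> \<le> 1 / n" using kr[of n] n by (intro divide_right_mono) auto
      finally show "\<bar>r - u\<bar> \<le> 1 / n" .
      moreover have "s = 1 - r" using n lr[of n] by (simp add: r_def s_def field_simps)
      ultimately show "\<bar>s - v\<bar> \<le> 1 / n" using uv(3) by (smt (verit))
    qed
    have "\<forall>j<n. \<rho> j \<in> \<T>" using \<sigma> \<tau> kn[of n] by (auto simp: P_def \<rho>_def)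
    moreover have "vnorm X (mean_op X \<rho> n x \<ominus> R x) < \<epsilon>" if x: "x \<in> F" for x
    proof -
      let ?a = "mean_op X \<sigma> (k n) x" and ?b = "mean_op X \<tau> (n - k n) x"
      have xX: "x \<in> carrier X" using x F by auto
      have \<sigma>l: "\<And>j. j < k n \<Longrightarrow> \<sigma> j \<in> \<T>" and \<tau>l: "\<And>j. j < n - k n \<Longrightarrow> \<tau> j \<in> \<T>"
        using \<sigma> \<tau> by (auto simp: P_def)
      have "mean_op X \<sigma> (k n) \<in> contractions X X" "mean_op X \<tau> (n - k n) \<in> contractions X X"
        using \<sigma>l \<tau>l \<T> by (auto intro!: mean_op_contraction[OF X])
      then have ab: "?a \<in> carrier X" "?b \<in> carrier X"
        using xX contractions_iff[OF X X] linear_mapsD(1) by auto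
      have m: "mean_op X \<rho> n x = of_real r \<odot> ?a \<oplus> of_real s \<odot> ?b"
        using mean_op_append[OF vec_space_axioms, of "k n" \<sigma> "n - k n" \<tau> x] con \<sigma>l \<tau>l elim kn[of n] xX
        by (simp add: \<rho>_def r_def s_def)
      note c = ab ST[OF x]
      have "(of_real r \<odot> ?a \<oplus> of_real s \<odot> ?b) \<ominus> (of_real u \<odot> S x \<oplus> of_real v \<odot> T x)
          = (of_real r \<odot> (?a \<ominus> S x) \<oplus> of_real s \<odot> (?b \<ominus> T x)) \<oplus>
            (of_real (r - u) \<odot> S x \<oplus> of_real (s - v) \<odot> T x)" (is "?l = ?rhs")
      proof -
        \<comment> \<open>The terms in \<open>S x\<close>, and likewise those in \<open>T x\<close>, add up to a single multiple.\<close>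
        have collect: "of_real (- r) \<odot> w \<oplus> of_real (r - u) \<odot> w = of_real (- u) \<odot> w"
          if "w \<in> carrier X" for r u w
          using that by (simp flip: sm_add_left)
        have "?rhs = of_real r \<odot> ?a \<oplus> of_real s \<odot> ?b \<oplus>
            ((of_real (- r) \<odot> S x \<oplus> of_real (r - u) \<odot> S x) \<oplus>
             (of_real (- s) \<odot> T x \<oplus> of_real (s - v) \<odot> T x))"
          using c by (simp add: minus_eq_sm sm_add_right sm_assoc M.a_ac)
        also have "\<dots> = ?l"
          using c unfolding collect[OF c(3)] collect[OF c(4)]
          by (simp add: minus_eq_sm sm_add_right sm_assoc M.a_ac)
        finally show ?thesis by simp
      qed
      then have dist: "vnorm X (mean_op X \<rho> n x \<ominus> R x) = vnorm X ?rhs" by (simp add: m R[OF xX])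
      have bound: "vnorm X ?rhs \<le> (r * vnorm X (?a \<ominus> S x) + s * vnorm X (?b \<ominus> T x)) +
          (\<bar>r - u\<bar> * vnorm X (S x) + \<bar>s - v\<bar> * vnorm X (T x))"
      proof -
        have n2: "vnorm X (of_real a \<odot> y \<oplus> of_real b \<odot> z) \<le> \<bar>a\<bar> * vnorm X y + \<bar>b\<bar> * vnorm X z"
          if "y \<in> carrier X" "z \<in> carrier X" for a b y z
          using norm_add[of "of_real a \<odot> y" "of_real b \<odot> z"] that by (simp add: norm_sm)
        have "vnorm X ?rhs \<le> vnorm X (of_real r \<odot> (?a \<ominus> S x) \<oplus> of_real s \<odot> (?b \<ominus> T x))
            + vnorm X (of_real (r - u) \<odot> S x \<oplus> of_real (s - v) \<odot> T x)"
          using c by (intro norm_add) auto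
        also have "\<dots> \<le> (\<bar>r\<bar> * vnorm X (?a \<ominus> S x) + \<bar>s\<bar> * vnorm X (?b \<ominus> T x)) +
          (\<bar>r - u\<bar> * vnorm X (S x) + \<bar>s - v\<bar> * vnorm X (T x))"
          using c by (intro add_mono n2) auto
        finally show ?thesis using rs(1,2) by simp
      qed
      have "r * vnorm X (?a \<ominus> S x) \<le> 1 * vnorm X (?a \<ominus> S x)" "s * vnorm X (?b \<ominus> T x) \<le> 1 * vnorm X (?b \<ominus> T x)"
        "\<bar>r - u\<bar> * vnorm X (S x) \<le> 1 / n * vnorm X (S x)" "\<bar>s - v\<bar> * vnorm X (T x) \<le> 1 / n * vnorm X (T x)"
        using rs c by (intro mult_right_mono; simp)+
      moreover have "vnorm X (?a \<ominus> S x) < \<epsilon> / 4" "vnorm X (?b \<ominus> T x) < \<epsilon> / 4"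
        using \<sigma> \<tau> x by (simp_all add: P_def)
      moreover have "1 / n * vnorm X (S x) + 1 / n * vnorm X (T x) < \<epsilon> / 2"
        using elim x by (simp add: algebra_simps add_divide_distrib)
      ultimately show ?thesis using dist bound by linarith
    qed
    ultimately show ?case by (intro exI[of _ \<rho>]) simp
  qed
qed

lemma strong_limit_of_means_cong:
  assumes S: "strong_limit_of_means X \<T> S" and eq: "\<And>x. x \<in> carrier X \<Longrightarrow> R x = S x"
  shows "strong_limit_of_means X \<T> R"
  unfolding strong_limit_of_means_def
proof (intro allI impI)
  fix F and \<epsilon> :: real assume F: "finite F" "F \<subseteq> carrier X" "\<epsilon> > 0"
  have "R x = S x" if "x \<in> F" for x using eq that F(2) by blast
  then have "(\<forall>x\<in>F. vnorm X (m x \<ominus>\<^bsub>X\<^esub> R x) < \<epsilon>) \<longleftrightarrow> (\<forall>x\<in>F. vnorm X (m x \<ominus>\<^bsub>X\<^esub> S x) < \<epsilon>)" for m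
    by simp
  then show "\<forall>\<^sub>F n in sequentially. \<exists>\<tau>. (\<forall>k<n. \<tau> k \<in> \<T>) \<and>
       (\<forall>x\<in>F. vnorm X (mean_op X \<tau> n x \<ominus>\<^bsub>X\<^esub> R x) < \<epsilon>)"
    using S[unfolded strong_limit_of_means_def, rule_format, OF F] by simp
qed

lemma conv_strong_limit_of_means:
  fixes X :: "('k::real_or_complex, 'a) normed_module" (structure)
  assumes X: "normed_space X" and \<T>: "\<T> \<subseteq> contractions X X" and T: "T \<in> conv (bounded_ops X X) \<T>"
  shows "strong_limit_of_means X \<T> T"
proof -
  interpret nspace X using X by (rule nspace.intro)
  let ?C = "{T \<in> carrier (bounded_ops X X). strong_limit_of_means X \<T> T}"
  have "convex_in (bounded_ops X X) hull \<T> \<subseteq> ?C"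
  proof (rule hull_minimal)
    show "\<T> \<subseteq> ?C"
    proof
      fix T assume T: "T \<in> \<T>"
      then have lin: "T \<in> linear_maps X X" using \<T> contractions_iff[OF X X] by auto
      have "strong_limit_of_means X \<T> T"
        unfolding strong_limit_of_means_def
      proof (intro allI impI)
        fix F and \<epsilon> :: real assume F: "finite F" "F \<subseteq> carrier X" "\<epsilon> > 0"
        have "mean_op X (\<lambda>_. T) n x \<ominus> T x = \<zero>" if "n > 0" "x \<in> F" for n x
        proof -
          have c: "x \<in> carrier X" "T x \<in> carrier X" using that F linear_mapsD(1)[OF lin] by auto
          have "(of_real (1 / real n) * of_nat n :: 'k) = 1" using that(1) by simp
          then have "mean_op X (\<lambda>_. T) n x = T x"
            using c by (simp add: mean_op_def vsum_const sm_assoc del: of_real_divide)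
          then show ?thesis using c by (simp add: a_minus_def M.r_neg)
        qed
        then show "\<forall>\<^sub>F n in sequentially. \<exists>\<tau>. (\<forall>k<n. \<tau> k \<in> \<T>) \<and>
           (\<forall>x\<in>F. vnorm X (mean_op X \<tau> n x \<ominus> T x) < \<epsilon>)"
          using F(3) T by (intro eventually_mono[OF eventually_gt_at_top[of 0]] exI[of _ "\<lambda>_. T"]) auto
      qed
      then show "T \<in> ?C" using T \<T> by (auto simp: contractions_def)
    qed
    show "convex_in (bounded_ops X X) ?C"
      unfolding convex_in_def
    proof (intro conjI ballI allI impI)
      fix S T and u v :: real assume S: "S \<in> ?C" and T: "T \<in> ?C" and uv: "0 \<le> u" "0 \<le> v" "u + v = 1"
      let ?R = "of_real u \<odot>\<^bsub>bounded_ops X X\<^esub> S \<oplus>\<^bsub>bounded_ops X X\<^esub> of_real v \<odot>\<^bsub>bounded_ops X X\<^esub> T"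
      have R: "?R \<in> carrier (bounded_ops X X)"
        using S T by (intro bounded_ops_combination X) auto
      have ST: "S x \<in> carrier X" "T x \<in> carrier X" if "x \<in> carrier X" for x
        using that S T by (auto simp: bounded_ops_def linear_maps_def)
      have "strong_limit_of_means X \<T> ?R"
      proof (cases "u = 0 \<or> v = 0")
        case True
        then show ?thesis
        proof
          assume u: "u = 0"
          then have v: "v = 1" using uv by simp
          have "?R x = T x" if "x \<in> carrier X" for x
            using ST[OF that] that by (simp add: u v)
          moreover have "strong_limit_of_means X \<T> T" using T by blast
          ultimately show ?thesis using strong_limit_of_means_cong[of X \<T> T ?R] by simp
        next
          assume v: "v = 0"
          then have u: "u = 1" using uv by simp
          have "?R x = S x" if "x \<in> carrier X" for x
            using ST[OF that] that by (simp add: u v)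
          moreover have "strong_limit_of_means X \<T> S" using S by blast
          ultimately show ?thesis using strong_limit_of_means_cong[of X \<T> S ?R] by simp
        qed
      next
        case False
        then have "0 < u" "0 < v" using uv by auto
        moreover have "?R x = of_real u \<odot> S x \<oplus> of_real v \<odot> T x" if "x \<in> carrier X" for x
          using that by simp
        ultimately show ?thesis
          using strong_limit_of_means_combination[OF X \<T>, of S T u v ?R] S T uv(3) by blast
      qed
      then show "?R \<in> ?C" using R by simp
    qed auto
  qed
  then show ?thesis using T by (auto simp: conv_def)
qed

section \<open>Dilating words of bounded length in means\<close>

text \<open>Jensen's inequality for \<open>t powr p\<close> and the positive entries; the others do not contribute to either sum.\<close>

lemma sum_le_power_mean:
  fixes a :: "'i \<Rightarrow> real"
  assumes S: "finite S" and a: "\<And>i. i \<in> S \<Longrightarrow> 0 \<le> a i" and p: "1 \<le> p"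
  shows "(\<Sum>i\<in>S. a i) \<le> real (card S) powr (1 - 1 / p) * (\<Sum>i\<in>S. a i powr p) powr (1 / p)"
proof -
  let ?P = "{i \<in> S. a i > 0}" and ?A = "\<Sum>i\<in>S. a i powr p"
  define m where "m = real (card ?P)"
  have A: "(\<Sum>i\<in>?P. a i powr p) = ?A"
    using S a by (intro sum.mono_neutral_left) (auto simp: order.order_iff_strict)
  have s: "(\<Sum>i\<in>?P. a i) = (\<Sum>i\<in>S. a i)"
    using S a by (intro sum.mono_neutral_left) (auto simp: order.order_iff_strict)
  show ?thesis
  proof (cases "?P = {}")
    case True
    then have "(\<Sum>i\<in>S. a i) = 0" using s by (metis sum.empty)
    then show ?thesis by simp
  next
    case False
    then have m: "m > 0" using S by (simp add: m_def card_gt_0_iff)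
    have s0: "0 \<le> (\<Sum>i\<in>S. a i)" using a by (rule sum_nonneg)
    have A0: "0 \<le> ?A" by (rule sum_nonneg) simp
    have "(\<Sum>i\<in>?P. (1 / m) *\<^sub>R a i) powr p \<le> (\<Sum>i\<in>?P. (1 / m) * (a i powr p))"
    proof (rule convex_on_sum[OF _ False powr_convex[OF p]])
      show "(\<Sum>i\<in>?P. 1 / m) = 1" using m by (simp add: m_def)
    qed (use S m in auto)
    then have "((\<Sum>i\<in>S. a i) / m) powr p \<le> ?A / m"
      by (simp add: A s flip: sum_divide_distrib)
    then have "(((\<Sum>i\<in>S. a i) / m) powr p) powr (1 / p) \<le> (?A / m) powr (1 / p)"
      using p by (intro powr_mono2) auto
    then have "(\<Sum>i\<in>S. a i) / m \<le> ?A powr (1 / p) / m powr (1 / p)"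
      using p m s0 A0 by (simp add: powr_powr powr_divide)
    then have "(\<Sum>i\<in>S. a i) \<le> (m / m powr (1 / p)) * ?A powr (1 / p)"
      using m by (simp add: field_simps)
    also have "m / m powr (1 / p) = m powr (1 - 1 / p)" using m by (simp add: powr_diff)
    also have "\<dots> \<le> real (card S) powr (1 - 1 / p)"
      using p S m by (intro powr_mono2) (auto simp: m_def intro: card_mono)
    finally show ?thesis by (simp add: mult_right_mono)
  qed
qed

lemma lp_power_simps [simp]:
  "carrier (lp_power p n V) = (\<Pi>\<^sub>E k\<in>{..<n}. carrier V)"
  "x \<oplus>\<^bsub>lp_power p n V\<^esub> y = (\<lambda>k\<in>{..<n}. x k \<oplus>\<^bsub>V\<^esub> y k)"
  "c \<odot>\<^bsub>lp_power p n V\<^esub> x = (\<lambda>k\<in>{..<n}. c \<odot>\<^bsub>V\<^esub> x k)"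
  "vnorm (lp_power p n V) x = (\<Sum>k<n. vnorm V (x k) powr p) powr (1 / p)"
  by (simp_all add: lp_power_def)

lemma lp_power_closed:
  assumes "vec_space V"
  shows "x \<in> carrier (lp_power p n V) \<Longrightarrow> y \<in> carrier (lp_power p n V) \<Longrightarrow>
      x \<oplus>\<^bsub>lp_power p n V\<^esub> y \<in> carrier (lp_power p n V)"
    "x \<in> carrier (lp_power p n V) \<Longrightarrow> c \<odot>\<^bsub>lp_power p n V\<^esub> x \<in> carrier (lp_power p n V)"
proof -
  interpret vec_space V by fact
  show "x \<in> carrier (lp_power p n V) \<Longrightarrow> y \<in> carrier (lp_power p n V) \<Longrightarrow>
      x \<oplus>\<^bsub>lp_power p n V\<^esub> y \<in> carrier (lp_power p n V)"
    "x \<in> carrier (lp_power p n V) \<Longrightarrow> c \<odot>\<^bsub>lp_power p n V\<^esub> x \<in> carrier (lp_power p n V)"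
    by (auto simp: PiE_def Pi_def)
qed

lemma isometric_isosD:
  assumes "f \<in> isometric_isos V W"
  shows "f \<in> linear_maps V W" "bij_betw f (carrier V) (carrier W)"
    "x \<in> carrier V \<Longrightarrow> vnorm W (f x) = vnorm V x"
  using assms by (auto simp: isometric_isos_def)

lemma isometric_isosI:
  assumes "f \<in> linear_maps V W" "bij_betw f (carrier V) (carrier W)"
    "\<And>x. x \<in> carrier V \<Longrightarrow> vnorm W (f x) = vnorm V x"
  shows "f \<in> isometric_isos V W"
  using assms by (simp add: isometric_isos_def)

lemma lp_power_twisted_shift_isometry:
  fixes p :: real
  assumes Y: "vec_space Y" and \<sigma>: "bij_betw \<sigma> {..<n} {..<n}"
    and W: "\<And>k. k < n \<Longrightarrow> W k \<in> isometric_isos Y Y"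
  shows "(\<lambda>y\<in>carrier (lp_power p n Y). \<lambda>k\<in>{..<n}. W k (y (\<sigma> k))) \<in> isometric_isos (lp_power p n Y) (lp_power p n Y)"
    (is "?U \<in> _")
proof -
  let ?L = "lp_power p n Y"
  note D = linear_mapsD[OF isometric_isosD(1)[OF W]]
  note bij = isometric_isosD(2)[OF W]
  have \<sigma>n: "\<sigma> k < n" if "k < n" for k using \<sigma> that by (auto simp: bij_betw_def)
  have comp: "y (\<sigma> k) \<in> carrier Y" if "y \<in> carrier ?L" "k < n" for y k
    using that \<sigma>n by (auto simp: PiE_def Pi_def)
  have U: "?U y = (\<lambda>k\<in>{..<n}. W k (y (\<sigma> k)))" if "y \<in> carrier ?L" for y using that by simp
  have closed: "?U y \<in> carrier ?L" if "y \<in> carrier ?L" for y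
    unfolding U[OF that] using comp[OF that] D(1) by auto
  have lin: "?U \<in> linear_maps ?L ?L"
    unfolding linear_maps_def
  proof (intro CollectI conjI ballI allI)
    show "?U \<in> carrier ?L \<rightarrow>\<^sub>E carrier ?L" using closed by auto
  next
    fix y z assume y: "y \<in> carrier ?L" and z: "z \<in> carrier ?L"
    show "?U (y \<oplus>\<^bsub>?L\<^esub> z) = ?U y \<oplus>\<^bsub>?L\<^esub> ?U z"
      unfolding U[OF lp_power_closed(1)[OF Y y z]] U[OF y] U[OF z]
      by (auto simp: fun_eq_iff D \<sigma>n comp[OF y] comp[OF z])
  next
    fix c y assume y: "y \<in> carrier ?L"
    show "?U (c \<odot>\<^bsub>?L\<^esub> y) = c \<odot>\<^bsub>?L\<^esub> ?U y"
      unfolding U[OF lp_power_closed(2)[OF Y y]] U[OF y]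
      by (auto simp: fun_eq_iff D \<sigma>n comp[OF y])
  qed
  moreover have "vnorm ?L (?U y) = vnorm ?L y" if y: "y \<in> carrier ?L" for y
  proof -
    have "(\<Sum>k<n. vnorm Y (W k (y (\<sigma> k))) powr p) = (\<Sum>k<n. vnorm Y (y (\<sigma> k)) powr p)"
      by (rule sum.cong) (auto simp: isometric_isosD(3)[OF W] comp[OF y])
    also have "\<dots> = (\<Sum>k<n. vnorm Y (y k) powr p)"
      by (rule sum.reindex_bij_betw[OF \<sigma>])
    finally show ?thesis unfolding U[OF y] by simp
  qed
  moreover have "bij_betw ?U (carrier ?L) (carrier ?L)"
    unfolding bij_betw_def
  proof (intro conjI inj_onI equalityI)
    fix y z assume y: "y \<in> carrier ?L" and z: "z \<in> carrier ?L" and eq: "?U y = ?U z"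
    have "y j = z j" if "j < n" for j
    proof -
      have "j \<in> \<sigma> ` {..<n}" using \<sigma> that by (simp add: bij_betw_def)
      then obtain k where k: "k < n" "\<sigma> k = j" by auto
      have "W k (y (\<sigma> k)) = W k (z (\<sigma> k))"
        using fun_cong[OF eq[unfolded U[OF y] U[OF z]], of k] k(1) by simp
      then have "y (\<sigma> k) = z (\<sigma> k)"
        using bij[OF k(1)] comp[OF y k(1)] comp[OF z k(1)] by (auto simp: bij_betw_def inj_on_def)
      then show ?thesis using k(2) by simp
    qed
    moreover have "y \<in> extensional {..<n}" "z \<in> extensional {..<n}" using y z by (simp_all add: PiE_def)
    ultimately show "y = z" by (intro extensionalityI[of y "{..<n}" z]) auto
  next
    show "?U ` carrier ?L \<subseteq> carrier ?L" using closed by blast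
    show "carrier ?L \<subseteq> ?U ` carrier ?L"
    proof
      fix w assume w: "w \<in> carrier ?L"
      have wk: "w k \<in> carrier Y" if "k < n" for k using w that by (auto simp: PiE_def Pi_def)
      define \<sigma>' where "\<sigma>' = inv_into {..<n} \<sigma>"
      have \<sigma>': "\<sigma>' j < n" "\<sigma> (\<sigma>' j) = j" if "j < n" for j
        using that \<sigma> inv_into_into[of j \<sigma> "{..<n}"] f_inv_into_f[of j \<sigma> "{..<n}"]
        by (auto simp: \<sigma>'_def bij_betw_def)
      have \<sigma>'': "\<sigma>' (\<sigma> k) = k" if "k < n" for k
        using that \<sigma> by (simp add: \<sigma>'_def bij_betw_def)
      define y where "y = (\<lambda>j\<in>{..<n}. inv_into (carrier Y) (W (\<sigma>' j)) (w (\<sigma>' j)))"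
      have inv: "inv_into (carrier Y) (W k) (w k) \<in> carrier Y" "W k (inv_into (carrier Y) (W k) (w k)) = w k"
        if "k < n" for k
        using bij[OF that] wk[OF that] by (auto simp: bij_betw_def inv_into_into f_inv_into_f)
      have yL: "y \<in> carrier ?L" using inv(1) \<sigma>' by (auto simp: y_def)
      have "?U y = w"
        unfolding U[OF yL]
      proof (rule extensionalityI[of _ "{..<n}"])
        show "w \<in> extensional {..<n}" using w by (simp add: PiE_def)
        fix k assume "k \<in> {..<n}"
        then show "(\<lambda>k\<in>{..<n}. W k (y (\<sigma> k))) k = w k"
          using inv(2) \<sigma>n \<sigma>'' by (simp add: y_def)
      qed simp
      then have "?U y \<in> ?U ` carrier ?L \<Longrightarrow> w \<in> ?U ` carrier ?L" by (simp only:)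
      then show "w \<in> ?U ` carrier ?L" using imageI[OF yL] .
    qed
  qed
  ultimately show ?thesis by (intro isometric_isosI)
qed

lemma linear_maps_comp:
  assumes "f \<in> linear_maps A B" "g \<in> linear_maps B C"
    and "\<And>x y. x \<in> carrier A \<Longrightarrow> y \<in> carrier A \<Longrightarrow> x \<oplus>\<^bsub>A\<^esub> y \<in> carrier A"
    and "\<And>c x. x \<in> carrier A \<Longrightarrow> c \<odot>\<^bsub>A\<^esub> x \<in> carrier A"
  shows "(\<lambda>x\<in>carrier A. g (f x)) \<in> linear_maps A C"
  using linear_mapsD[OF assms(1)] linear_mapsD[OF assms(2)] assms(3,4)
  unfolding linear_maps_def by (auto simp: PiE_def Pi_def)

lemma isometric_isos_comp:
  assumes f: "f \<in> isometric_isos A B" and g: "g \<in> isometric_isos B C"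
    and cl: "\<And>x y. x \<in> carrier A \<Longrightarrow> y \<in> carrier A \<Longrightarrow> x \<oplus>\<^bsub>A\<^esub> y \<in> carrier A"
      "\<And>c x. x \<in> carrier A \<Longrightarrow> c \<odot>\<^bsub>A\<^esub> x \<in> carrier A"
  shows "(\<lambda>x\<in>carrier A. g (f x)) \<in> isometric_isos A C"
proof -
  have "bij_betw (g \<circ> f) (carrier A) (carrier C)"
    using isometric_isosD(2)[OF f] isometric_isosD(2)[OF g] by (rule bij_betw_trans)
  then have "bij_betw (\<lambda>x\<in>carrier A. g (f x)) (carrier A) (carrier C)"
    by (simp cong: bij_betw_cong add: comp_def)
  moreover have "(\<lambda>x\<in>carrier A. g (f x)) \<in> linear_maps A C"
    by (rule linear_maps_comp[OF isometric_isosD(1)[OF f] isometric_isosD(1)[OF g] cl])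
  ultimately show ?thesis
    using isometric_isosD(3)[OF f] isometric_isosD(3)[OF g] linear_mapsD(1)[OF isometric_isosD(1)[OF f]]
    by (simp add: isometric_isos_def)
qed

lemma isometric_isos_inverse:
  assumes f: "f \<in> isometric_isos A B"
    and cl: "\<And>x y. x \<in> carrier A \<Longrightarrow> y \<in> carrier A \<Longrightarrow> x \<oplus>\<^bsub>A\<^esub> y \<in> carrier A"
      "\<And>c x. x \<in> carrier A \<Longrightarrow> c \<odot>\<^bsub>A\<^esub> x \<in> carrier A"
  obtains g where "g \<in> isometric_isos B A" "\<And>x. x \<in> carrier A \<Longrightarrow> g (f x) = x"
proof -
  let ?g = "\<lambda>z\<in>carrier B. inv_into (carrier A) f z"
  note bij = isometric_isosD(2)[OF f] and D = linear_mapsD[OF isometric_isosD(1)[OF f]]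
  have gf: "?g (f x) = x" if "x \<in> carrier A" for x
    using that D(1) bij by (simp add: bij_betw_def)
  have img: "\<exists>x\<in>carrier A. z = f x" if "z \<in> carrier B" for z
    using bij that by (auto simp: bij_betw_def)
  have "?g \<in> linear_maps B A"
    unfolding linear_maps_def
  proof (intro CollectI conjI ballI allI)
    show "?g \<in> carrier B \<rightarrow>\<^sub>E carrier A"
      using bij by (auto simp: bij_betw_def inv_into_into)
  next
    fix z w assume "z \<in> carrier B" "w \<in> carrier B"
    then obtain x y where xy: "x \<in> carrier A" "y \<in> carrier A" "z = f x" "w = f y" using img by metis
    show "?g (z \<oplus>\<^bsub>B\<^esub> w) = ?g z \<oplus>\<^bsub>A\<^esub> ?g w"
      using gf[OF cl(1)[OF xy(1,2)]] gf[OF xy(1)] gf[OF xy(2)] D(2)[OF xy(1,2)] xy(3,4) by metis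
  next
    fix c z assume "z \<in> carrier B"
    then obtain x where x: "x \<in> carrier A" "z = f x" using img by metis
    show "?g (c \<odot>\<^bsub>B\<^esub> z) = c \<odot>\<^bsub>A\<^esub> ?g z"
      using gf[OF cl(2)[OF x(1)], of c] gf[OF x(1)] D(3)[OF x(1), of c] x(2) by metis
  qed
  moreover have "bij_betw ?g (carrier B) (carrier A)"
    using bij_betw_inv_into[OF bij] by (simp cong: bij_betw_cong)
  moreover have "vnorm A (?g z) = vnorm B z" if z: "z \<in> carrier B" for z
  proof -
    obtain x where x: "x \<in> carrier A" "z = f x" using img[OF z] by metis
    show ?thesis unfolding x(2) gf[OF x(1)] using isometric_isosD(3)[OF f x(1)] by simp
  qed
  ultimately have "?g \<in> isometric_isos B A" by (intro isometric_isosI)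
  then show ?thesis using gf by (rule that)
qed

text \<open>The maps of a dilation without the identity for words. The operators to be dilated enter only through
an index set, and the contractions are described pointwise, so that \<open>V\<close> can be a power or an
ultraproduct before it is replaced by its copy in the class.\<close>

definition dilation_frame ::
    "('k::real_or_complex, 'a) normed_module \<Rightarrow> ('k, 'v) normed_module \<Rightarrow> 's set \<Rightarrow>
     ('a \<Rightarrow> 'v) \<Rightarrow> ('v \<Rightarrow> 'a) \<Rightarrow> ('s \<Rightarrow> 'v \<Rightarrow> 'v) \<Rightarrow> bool" where
  "dilation_frame X V \<S> J Q U \<longleftrightarrow>
     J \<in> linear_maps X V \<and> (\<forall>x\<in>carrier X. vnorm V (J x) \<le> vnorm X x) \<and>
     Q \<in> linear_maps V X \<and> (\<forall>v\<in>carrier V. vnorm X (Q v) \<le> vnorm V v) \<and>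
     (\<forall>s\<in>\<S>. U s \<in> isometric_isos V V)"

lemma dilation_frameI:
  assumes "J \<in> linear_maps X V" "Q \<in> linear_maps V X"
    "\<And>x. x \<in> carrier X \<Longrightarrow> vnorm V (J x) \<le> vnorm X x" "\<And>v. v \<in> carrier V \<Longrightarrow> vnorm X (Q v) \<le> vnorm V v"
    "\<And>s. s \<in> \<S> \<Longrightarrow> U s \<in> isometric_isos V V"
  shows "dilation_frame X V \<S> J Q U"
  using assms by (simp add: dilation_frame_def)

abbreviation word :: "('s \<Rightarrow> 'v \<Rightarrow> 'v) \<Rightarrow> 's list \<Rightarrow> 'v \<Rightarrow> 'v" where
  "word U ss \<equiv> foldr (\<circ>) (map U ss) id"

lemma word_Cons: "foldr (\<circ>) (T # Ts) id v = T (foldr (\<circ>) Ts id v)"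
  by simp

lemma word_closed:
  assumes "\<And>s. s \<in> set ss \<Longrightarrow> U s \<in> linear_maps V V" "v \<in> carrier V"
  shows "word U ss v \<in> carrier V"
  using assms
proof (induction ss)
  case (Cons s ss)
  have U: "U s \<in> linear_maps V V" using Cons.prems by simp
  have "word U ss v \<in> carrier V" using Cons.prems by (intro Cons.IH) auto
  from linear_mapsD(1)[OF U this] show ?case by (simp only: list.map word_Cons)
qed simp

lemma word_scale:
  assumes "\<And>s. s \<in> set ss \<Longrightarrow> U s \<in> linear_maps V V" "v \<in> carrier V"
  shows "word U ss (c \<odot>\<^bsub>V\<^esub> v) = c \<odot>\<^bsub>V\<^esub> word U ss v"
  using assms
proof (induction ss)
  case (Cons s ss)
  have U: "U s \<in> linear_maps V V" using Cons.prems by simp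
  have w: "word U ss v \<in> carrier V" using Cons.prems by (intro word_closed) auto
  have "word U ss (c \<odot>\<^bsub>V\<^esub> v) = c \<odot>\<^bsub>V\<^esub> word U ss v"
    using Cons.prems by (intro Cons.IH) auto
  then show ?case by (simp only: list.map word_Cons linear_mapsD(3)[OF U w])
qed simp

text \<open>Powers and ultraproducts belong to the class up to isometric isomorphism; conjugation by the
isomorphism carries all words along.\<close>

lemma dilation_frame_transfer:
  assumes X: "vec_space X" and \<phi>: "\<phi> \<in> isometric_isos V Z" and Z: "vec_space Z"
    and cl: "\<And>x y. x \<in> carrier V \<Longrightarrow> y \<in> carrier V \<Longrightarrow> x \<oplus>\<^bsub>V\<^esub> y \<in> carrier V"
      "\<And>c x. x \<in> carrier V \<Longrightarrow> c \<odot>\<^bsub>V\<^esub> x \<in> carrier V"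
    and frame: "dilation_frame X V \<S> J Q U"
  obtains J' Q' U' where "dilation_frame X Z \<S> J' Q' U'"
    "\<And>ss x. set ss \<subseteq> \<S> \<Longrightarrow> x \<in> carrier X \<Longrightarrow>
       Q' (word U' ss (J' x)) = Q (word U ss (J x))"
proof -
  interpret X: vec_space X by fact
  interpret Z: vec_space Z by fact
  obtain \<psi> where \<psi>: "\<psi> \<in> isometric_isos Z V" "\<And>v. v \<in> carrier V \<Longrightarrow> \<psi> (\<phi> v) = v"
    using isometric_isos_inverse[OF \<phi> cl] by metis
  have J: "J \<in> linear_maps X V" "\<And>x. x \<in> carrier X \<Longrightarrow> vnorm V (J x) \<le> vnorm X x"
    and Q: "Q \<in> linear_maps V X" "\<And>v. v \<in> carrier V \<Longrightarrow> vnorm X (Q v) \<le> vnorm V v"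
    and U: "\<And>s. s \<in> \<S> \<Longrightarrow> U s \<in> isometric_isos V V"
    using frame by (auto simp: dilation_frame_def)
  note \<phi>V = linear_mapsD(1)[OF isometric_isosD(1)[OF \<phi>]] and \<psi>Z = linear_mapsD(1)[OF isometric_isosD(1)[OF \<psi>(1)]]
  define J' where "J' = (\<lambda>x\<in>carrier X. \<phi> (J x))"
  define Q' where "Q' = (\<lambda>z\<in>carrier Z. Q (\<psi> z))"
  define W where "W s = (\<lambda>v\<in>carrier Z. U s (\<psi> v))" for s
  define U' where "U' s = (\<lambda>z\<in>carrier Z. \<phi> (W s z))" for s
  have "J' \<in> linear_maps X Z"
    unfolding J'_def by (rule linear_maps_comp[OF J(1) isometric_isosD(1)[OF \<phi>]]) auto
  moreover have "Q' \<in> linear_maps Z X"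
    unfolding Q'_def by (rule linear_maps_comp[OF isometric_isosD(1)[OF \<psi>(1)] Q(1)]) auto
  moreover have "U' s \<in> isometric_isos Z Z" if "s \<in> \<S>" for s
  proof -
    have "W s \<in> isometric_isos Z V"
      unfolding W_def by (rule isometric_isos_comp[OF \<psi>(1) U[OF that]]) auto
    from isometric_isos_comp[OF this \<phi>] show ?thesis unfolding U'_def by auto
  qed
  moreover have "vnorm Z (J' x) \<le> vnorm X x" if "x \<in> carrier X" for x
    using that J(2) isometric_isosD(3)[OF \<phi>] linear_mapsD(1)[OF J(1)] by (simp add: J'_def)
  moreover have "vnorm X (Q' z) \<le> vnorm Z z" if "z \<in> carrier Z" for z
    using that Q(2)[OF \<psi>Z[OF that]] isometric_isosD(3)[OF \<psi>(1) that] by (simp add: Q'_def)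
  ultimately have "dilation_frame X Z \<S> J' Q' U'" by (intro dilation_frameI)
  moreover have "Q' (word U' ss (J' x)) = Q (word U ss (J x))"
    if ss: "set ss \<subseteq> \<S>" and x: "x \<in> carrier X" for ss x
  proof -
    have JV: "J x \<in> carrier V" using linear_mapsD(1)[OF J(1) x] .
    have wV: "word U ts (J x) \<in> carrier V" if "set ts \<subseteq> \<S>" for ts
      using that JV isometric_isosD(1)[OF U] by (intro word_closed) auto
    have "word U' ss (J' x) = \<phi> (word U ss (J x))"
      using ss
    proof (induction ss)
      case Nil then show ?case using x by (simp add: J'_def)
    next
      case (Cons s ss)
      then have w: "word U ss (J x) \<in> carrier V" using wV by simp
      have IH: "word U' ss (J' x) = \<phi> (word U ss (J x))"
        using Cons.prems by (intro Cons.IH) auto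
      have "U' s z = \<phi> (U s (\<psi> z))" if "z \<in> carrier Z" for z using that by (simp add: U'_def W_def)
      from this[OF \<phi>V[OF w]] show ?case
        by (simp only: list.map word_Cons IH \<psi>(2)[OF w])
    qed
    then show ?thesis using wV[OF ss] \<phi>V \<psi>(2) by (simp add: Q'_def)
  qed
  ultimately show ?thesis by (rule that)
qed

text \<open>The number \<open>k\<close> is read in base \<open>M\<close>, lowest digit first, and the \<open>j\<close>-th digit selects an element for the
\<open>j\<close>-th letter of the word.\<close>

primrec digit_word :: "nat \<Rightarrow> ('s \<Rightarrow> nat \<Rightarrow> 't) \<Rightarrow> 's list \<Rightarrow> nat \<Rightarrow> 't list" where
  "digit_word M \<tau> [] k = []"
| "digit_word M \<tau> (s # ss) k = \<tau> s (k mod M) # digit_word M \<tau> ss (k div M)"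

text \<open>A short word does not see the digit that the rotation below has moved to the top.\<close>

lemma digit_word_high_digit:
  "0 < M \<Longrightarrow> length ss \<le> n \<Longrightarrow> digit_word M \<tau> ss (a + b * M ^ n) = digit_word M \<tau> ss a"
proof (induction ss arbitrary: n a)
  case (Cons s ss)
  then obtain m where n: "n = Suc m" "length ss \<le> m" by (cases n) auto
  have e: "a + b * M ^ n = a + (b * M ^ m) * M" by (simp add: n)
  have "(a + b * M ^ n) mod M = a mod M" unfolding e by simp
  moreover have "(a + b * M ^ n) div M = a div M + b * M ^ m" unfolding e using Cons.prems by simp
  ultimately show ?case using Cons.IH[OF Cons.prems(1) n(2)] by simp
qed simp

lemma set_digit_word:
  assumes "0 < M" "\<And>s k. s \<in> set ss \<Longrightarrow> k < M \<Longrightarrow> \<tau> s k \<in> \<T>"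
  shows "set (digit_word M \<tau> ss k) \<subseteq> \<T>"
  using assms by (induction ss arbitrary: k) auto

text \<open>This map moves the lowest of \<open>n + 1\<close> digits to the top; both the moved digit and the others can be
recovered.\<close>

lemma digit_rotation_bij:
  assumes M: "0 < (M::nat)"
  shows "bij_betw (\<lambda>k. k div M + (k mod M) * M ^ n) {..<M ^ Suc n} {..<M ^ Suc n}" (is "bij_betw ?\<sigma> _ _")
proof -
  have q: "k div M < M ^ n" if "k < M ^ Suc n" for k
    using that M by (simp add: div_less_iff_less_mult mult.commute)
  have lo: "?\<sigma> k mod M ^ n = k div M" and hi: "?\<sigma> k div M ^ n = k mod M" if "k < M ^ Suc n" for k
    using q[OF that] M by auto
  have "?\<sigma> k < M ^ Suc n" if "k < M ^ Suc n" for k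
  proof -
    have "?\<sigma> k < M ^ n + (k mod M) * M ^ n" using q[OF that] by simp
    also have "\<dots> = Suc (k mod M) * M ^ n" by simp
    also have "\<dots> \<le> M * M ^ n" using M by (intro mult_right_mono) (auto simp: Suc_le_eq)
    finally show ?thesis by simp
  qed
  then have "?\<sigma> ` {..<M ^ Suc n} \<subseteq> {..<M ^ Suc n}" by auto
  moreover have "inj_on ?\<sigma> {..<M ^ Suc n}"
  proof (rule inj_onI)
    fix k l assume "k \<in> {..<M ^ Suc n}" "l \<in> {..<M ^ Suc n}" "?\<sigma> k = ?\<sigma> l"
    then have "k div M = l div M" "k mod M = l mod M" using lo hi by (metis lessThan_iff)+
    then show "k = l" by (metis div_mult_mod_eq)
  qed
  ultimately show ?thesis by (simp add: bij_betw_def endo_inj_surj)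
qed

text \<open>Expanding a product of means: each letter consumes one digit, and summing over that digit replaces the
selected element by \<open>M\<close> times the mean. Digits beyond the length of the word only contribute factors \<open>M\<close>.\<close>

lemma vsum_digit_word:
  assumes X: "normed_space X" and M: "0 < M" and \<tau>: "\<And>s k. s \<in> set ss \<Longrightarrow> k < M \<Longrightarrow> \<tau> s k \<in> contractions X X"
    and y: "y \<in> carrier X" and len: "length ss \<le> n"
  shows "vsum X (\<lambda>k. foldr (\<circ>) (digit_word M \<tau> ss k) id y) (M ^ n)
    = of_nat (M ^ n) \<odot>\<^bsub>X\<^esub> word (\<lambda>s. mean_op X (\<tau> s) M) ss y"
  using \<tau> len
proof (induction ss arbitrary: n)
  case Nil
  interpret nspace X using X by (rule nspace.intro)
  show ?case using vsum_const[OF y] by simp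
next
  case (Cons s ss)
  interpret nspace X using X by (rule nspace.intro)
  obtain m where n: "n = Suc m" "length ss \<le> m" using Cons.prems(2) by (cases n) auto
  let ?A = "mean_op X (\<tau> s) M"
  let ?w = "word (\<lambda>s. mean_op X (\<tau> s) M) ss y"
  define h where "h q = foldr (\<circ>) (digit_word M \<tau> ss q) id y" for q
  have lin: "T \<in> linear_maps X X" if "T \<in> contractions X X" for T
    using that contractions_iff[OF X X] by blast
  have hX: "h q \<in> carrier X" for q
  proof -
    have "set (digit_word M \<tau> ss q) \<subseteq> contractions X X"
      using Cons.prems(1) M by (intro set_digit_word) auto
    then have "word (\<lambda>T. T) (digit_word M \<tau> ss q) y \<in> carrier X"
      using y lin by (intro word_closed) auto
    then show ?thesis by (simp add: h_def)
  qed
  have \<tau>s: "\<tau> s r \<in> contractions X X" if "r < M" for r using Cons.prems(1) that by simp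
  have A: "?A \<in> linear_maps X X" using \<tau>s by (intro lin mean_op_contraction[OF X])
  have IH: "vsum X h (M ^ m) = of_nat (M ^ m) \<odot>\<^bsub>X\<^esub> ?w"
    unfolding h_def using Cons.prems(1) by (intro Cons.IH n(2)) auto
  have wX: "?w \<in> carrier X"
    using Cons.prems(1) y by (intro word_closed lin mean_op_contraction[OF X]) auto
  have inner: "vsum X (\<lambda>r. foldr (\<circ>) (digit_word M \<tau> (s # ss) (q * M + r)) id y) M = of_nat M \<odot>\<^bsub>X\<^esub> ?A (h q)" for q
  proof -
    have "vsum X (\<lambda>r. foldr (\<circ>) (digit_word M \<tau> (s # ss) (q * M + r)) id y) M = vsum X (\<lambda>r. \<tau> s r (h q)) M"
      using M by (intro vsum_cong) (simp add: h_def)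
    also have "\<dots> = of_nat M \<odot>\<^bsub>X\<^esub> ?A (h q)"
    proof -
      have "vsum X (\<lambda>r. \<tau> s r (h q)) M \<in> carrier X"
        using linear_mapsD(1)[OF lin[OF \<tau>s] hX] by (intro vsum_closed)
      then show ?thesis using hX M by (simp add: mean_op_def sm_assoc)
    qed
    finally show ?thesis .
  qed
  have clos: "foldr (\<circ>) (digit_word M \<tau> (s # ss) k) id y \<in> carrier X" for k
    using linear_mapsD(1)[OF lin[OF \<tau>s] hX, of "k mod M"] M by (simp add: h_def)
  have "vsum X (\<lambda>k. foldr (\<circ>) (digit_word M \<tau> (s # ss) k) id y) (M ^ n)
      = vsum X (\<lambda>q. of_nat M \<odot>\<^bsub>X\<^esub> ?A (h q)) (M ^ m)"
    using vsum_blocks[where L = "M ^ m" and M = M, OF clos] by (simp only: n(1) inner power_Suc mult.commute)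
  also have "\<dots> = of_nat M \<odot>\<^bsub>X\<^esub> ?A (vsum X h (M ^ m))"
    using linear_maps_vsum[OF vec_space_axioms vec_space_axioms A, of "M ^ m" h] hX linear_mapsD(1)[OF A]
    by (simp add: vsum_sm)
  also have "\<dots> = of_nat (M ^ n) \<odot>\<^bsub>X\<^esub> ?A ?w"
    unfolding IH using linear_mapsD[OF A] wX by (simp add: sm_assoc n(1))
  finally show ?case by (simp only: list.map word_Cons)
qed

text \<open>The dilation on a power of \<open>Y\<close>. In coordinate \<open>k\<close> the isometry for \<open>s\<close> applies \<open>U (\<tau> s d)\<close>, where \<open>d\<close> is the lowest digit
of \<open>k\<close>, to the coordinate at the rotated index. Hence coordinate \<open>k\<close> of the image of a diagonal vector
under a word is the dilated word selected by the digits of \<open>k\<close>, and averaging over \<open>k\<close> gives the product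
of the means.\<close>

lemma finite_dilation_of_means:
  fixes p :: real and \<tau> :: "'s \<Rightarrow> nat \<Rightarrow> 'a \<Rightarrow> 'a"
    and X :: "('k::real_or_complex, 'a) normed_module"
  assumes p: "1 < p" and X: "normed_space X" and Y: "normed_space Y" and M: "0 < M"
    and frame: "dilation_frame X Y \<T> J Q U"
    and \<T>: "\<T> \<subseteq> contractions X X"
    and dil: "\<And>Ts x. set Ts \<subseteq> \<T> \<Longrightarrow> x \<in> carrier X \<Longrightarrow> foldr (\<circ>) Ts id x = Q (word U Ts (J x))"
    and \<tau>: "\<And>s k. s \<in> \<S> \<Longrightarrow> k < M \<Longrightarrow> \<tau> s k \<in> \<T>"
  obtains J' Q' U' where "dilation_frame X (lp_power p (M ^ Suc n) Y) \<S> J' Q' U'"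
    "\<And>ss x. set ss \<subseteq> \<S> \<Longrightarrow> length ss \<le> Suc n \<Longrightarrow> x \<in> carrier X \<Longrightarrow>
       Q' (word U' ss (J' x)) = word (\<lambda>s. mean_op X (\<tau> s) M) ss x"
proof -
  interpret X: nspace X using X by (rule nspace.intro)
  interpret Y: nspace Y using Y by (rule nspace.intro)
  define L where "L = M ^ Suc n"
  let ?L = "lp_power p L Y"
  have L: "real L > 0" using M by (simp add: L_def)
  have J: "J \<in> linear_maps X Y" "\<And>x. x \<in> carrier X \<Longrightarrow> vnorm Y (J x) \<le> vnorm X x"
    and Q: "Q \<in> linear_maps Y X" "\<And>v. v \<in> carrier Y \<Longrightarrow> vnorm X (Q v) \<le> vnorm Y v"
    and U: "\<And>T. T \<in> \<T> \<Longrightarrow> U T \<in> isometric_isos Y Y"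
    using frame by (auto simp: dilation_frame_def)
  note JD = linear_mapsD[OF J(1)] and QD = linear_mapsD[OF Q(1)]
  \<comment> \<open>The diagonal embedding has norm \<open>L powr (1 / p)\<close>, and summing the coordinates has norm \<open>L powr (1 - 1 / p)\<close>.\<close>
  define c where "c = real L powr (- 1 / p)"
  define d where "d = real L powr (1 / p - 1)"
  have c0: "0 < c" and d0: "0 < d" using L by (simp_all add: c_def d_def)
  have dLc: "d * real L * c = 1"
  proof -
    have "d * real L * c = real L powr (1 / p - 1) * real L powr 1 * real L powr (- 1 / p)"
      using L by (simp add: d_def c_def)
    also have "\<dots> = real L powr (1 / p - 1 + 1 + - 1 / p)" by (simp only: powr_add)
    also have "\<dots> = 1" using L by simp
    finally show ?thesis .
  qed
  define J' where "J' = (\<lambda>x\<in>carrier X. \<lambda>k\<in>{..<L}. of_real c \<odot>\<^bsub>Y\<^esub> J x)"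
  define Q' where "Q' = (\<lambda>y\<in>carrier ?L. of_real d \<odot>\<^bsub>X\<^esub> vsum X (\<lambda>k. Q (y k)) L)"
  define \<sigma> where "\<sigma> k = k div M + (k mod M) * M ^ n" for k
  define U' where "U' s = (\<lambda>y\<in>carrier ?L. \<lambda>k\<in>{..<L}. U (\<tau> s (k mod M)) (y (\<sigma> k)))" for s
  have \<sigma>: "bij_betw \<sigma> {..<L} {..<L}" unfolding \<sigma>_def L_def by (rule digit_rotation_bij[OF M])
  have U': "U' s \<in> isometric_isos ?L ?L" if "s \<in> \<S>" for s
    unfolding U'_def using \<tau>[OF that] M U
    by (intro lp_power_twisted_shift_isometry[OF Y.vec_space_axioms \<sigma>]) auto
  have comp: "y k \<in> carrier Y" if "y \<in> carrier ?L" "k < L" for y k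
    using that by (auto simp: PiE_def Pi_def)
  have J'lin: "J' \<in> linear_maps X ?L"
    unfolding linear_maps_def
    by (auto simp: J'_def JD Y.sm_add_right Y.sm_assoc mult.commute fun_eq_iff)
  have Q'lin: "Q' \<in> linear_maps ?L X"
    unfolding linear_maps_def
  proof (intro CollectI conjI ballI allI)
    show "Q' \<in> carrier ?L \<rightarrow>\<^sub>E carrier X"
      using QD(1) by (auto simp: Q'_def intro!: X.vsum_closed)
  next
    fix y z assume y: "y \<in> carrier ?L" and z: "z \<in> carrier ?L"
    have "vsum X (\<lambda>k. Q ((y \<oplus>\<^bsub>?L\<^esub> z) k)) L = vsum X (\<lambda>k. Q (y k) \<oplus>\<^bsub>X\<^esub> Q (z k)) L"
      by (rule vsum_cong) (simp add: QD comp[OF y] comp[OF z])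
    also have "\<dots> = vsum X (\<lambda>k. Q (y k)) L \<oplus>\<^bsub>X\<^esub> vsum X (\<lambda>k. Q (z k)) L"
      by (rule X.vsum_add) (simp_all add: QD comp[OF y] comp[OF z])
    finally show "Q' (y \<oplus>\<^bsub>?L\<^esub> z) = Q' y \<oplus>\<^bsub>X\<^esub> Q' z"
      using y z lp_power_closed(1)[OF Y.vec_space_axioms y z] QD(1) comp[OF y] comp[OF z]
      by (simp add: Q'_def X.sm_add_right del: lp_power_simps)
  next
    fix a y assume y: "y \<in> carrier ?L"
    have "vsum X (\<lambda>k. Q ((a \<odot>\<^bsub>?L\<^esub> y) k)) L = vsum X (\<lambda>k. a \<odot>\<^bsub>X\<^esub> Q (y k)) L"
      by (rule vsum_cong) (simp add: QD comp[OF y])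
    also have "\<dots> = a \<odot>\<^bsub>X\<^esub> vsum X (\<lambda>k. Q (y k)) L"
      by (rule X.vsum_sm) (simp add: QD comp[OF y])
    finally show "Q' (a \<odot>\<^bsub>?L\<^esub> y) = a \<odot>\<^bsub>X\<^esub> Q' y"
      using y lp_power_closed(2)[OF Y.vec_space_axioms y] QD(1) comp[OF y]
      by (simp add: Q'_def X.sm_assoc mult.commute del: lp_power_simps)
  qed
  have J'norm: "vnorm ?L (J' x) \<le> vnorm X x" if x: "x \<in> carrier X" for x
  proof -
    have "vnorm ?L (J' x) = (real L * (c * vnorm Y (J x)) powr p) powr (1 / p)"
      using x JD(1)[OF x] c0 by (simp add: J'_def Y.norm_sm)
    also have "real L * (c * vnorm Y (J x)) powr p = vnorm Y (J x) powr p"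
    proof -
      have "c powr p = real L powr (- 1 / p * p)" by (simp only: c_def powr_powr)
      then have "c powr p = inverse (real L)" using p L by (simp add: powr_minus)
      then show ?thesis using L c0 JD(1)[OF x] by (simp add: powr_mult)
    qed
    also have "(vnorm Y (J x) powr p) powr (1 / p) = vnorm Y (J x)"
      using p JD(1)[OF x] by (simp add: powr_powr)
    finally show ?thesis using J(2)[OF x] by simp
  qed
  have Q'norm: "vnorm X (Q' y) \<le> vnorm ?L y" if y: "y \<in> carrier ?L" for y
  proof -
    have Qy: "Q (y k) \<in> carrier X" if "k < L" for k using QD(1) comp[OF y that] .
    have "vnorm X (Q' y) = d * vnorm X (vsum X (\<lambda>k. Q (y k)) L)"
      using y d0 Qy by (simp add: Q'_def X.norm_sm del: lp_power_simps)
    also have "\<dots> \<le> d * (\<Sum>k<L. vnorm Y (y k))"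
    proof (rule mult_left_mono)
      have "vnorm X (vsum X (\<lambda>k. Q (y k)) L) \<le> (\<Sum>k<L. vnorm X (Q (y k)))"
        using Qy by (rule X.norm_vsum)
      also have "\<dots> \<le> (\<Sum>k<L. vnorm Y (y k))" using Q(2) comp[OF y] by (intro sum_mono) auto
      finally show "vnorm X (vsum X (\<lambda>k. Q (y k)) L) \<le> (\<Sum>k<L. vnorm Y (y k))" .
    qed (use d0 in simp)
    also have "\<dots> \<le> d * (real L powr (1 - 1 / p) * vnorm ?L y)"
      using sum_le_power_mean[of "{..<L}" "\<lambda>k. vnorm Y (y k)" p] comp[OF y] p d0
      by (intro mult_left_mono) auto
    also have "\<dots> = vnorm ?L y"
    proof -
      have "d * real L powr (1 - 1 / p) = 1" using L by (simp add: d_def flip: powr_add)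
      then show ?thesis by (simp flip: mult.assoc)
    qed
    finally show ?thesis .
  qed
  have "dilation_frame X ?L \<S> J' Q' U'"
    using J'lin Q'lin J'norm Q'norm U' by (rule dilation_frameI)
  moreover have "Q' (word U' ss (J' x)) = word (\<lambda>s. mean_op X (\<tau> s) M) ss x"
    if ss: "set ss \<subseteq> \<S>" and len: "length ss \<le> Suc n" and x: "x \<in> carrier X" for ss x
  proof -
    let ?x = "of_real c \<odot>\<^bsub>X\<^esub> x"
    have \<tau>T: "\<tau> s k \<in> \<T>" if "s \<in> set ts" "set ts \<subseteq> \<S>" "k < M" for s ts k using \<tau> that by auto
    have w: "word U' ts (J' x) \<in> carrier ?L" if "set ts \<subseteq> \<S>" for ts
      using that isometric_isosD(1)[OF U'] linear_mapsD(1)[OF J'lin x] by (intro word_closed) auto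
    have coord: "word U' ts (J' x) k = word U (digit_word M \<tau> ts k) (J ?x)"
      if "set ts \<subseteq> \<S>" "length ts \<le> Suc n" "k < L" for ts k
      using that
    proof (induction ts arbitrary: k)
      case Nil
      then show ?case using x JD(3)[OF x] by (simp add: J'_def)
    next
      case (Cons s ts)
      have \<sigma>k: "\<sigma> k < L" using \<sigma> Cons.prems(3) by (auto simp: bij_betw_def)
      have "digit_word M \<tau> ts (\<sigma> k) = digit_word M \<tau> ts (k div M)"
        unfolding \<sigma>_def using Cons.prems(2) by (intro digit_word_high_digit[OF M]) simp
      moreover have "word U' ts (J' x) (\<sigma> k) = word U (digit_word M \<tau> ts (\<sigma> k)) (J ?x)"
        using Cons.prems by (intro Cons.IH \<sigma>k) auto
      ultimately have "word U' ts (J' x) (\<sigma> k) = word U (digit_word M \<tau> ts (k div M)) (J ?x)"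
        by (simp only:)
      moreover have "U' s y k = U (\<tau> s (k mod M)) (y (\<sigma> k))" if "y \<in> carrier ?L" for y
        using that Cons.prems(3) by (simp add: U'_def del: lp_power_simps)
      moreover have "word U' ts (J' x) \<in> carrier ?L" using Cons.prems(1) by (intro w) simp
      ultimately show ?case by (simp only: list.map word_Cons digit_word.simps)
    qed
    let ?W = "\<lambda>x. word (\<lambda>s. mean_op X (\<tau> s) M) ss x"
    have lin: "mean_op X (\<tau> s) M \<in> linear_maps X X" if "s \<in> set ss" for s
    proof -
      have "mean_op X (\<tau> s) M \<in> contractions X X"
        using \<tau>T[OF that ss] \<T> by (intro mean_op_contraction[OF X]) auto
      then show ?thesis using contractions_iff[OF X X] by blast
    qed
    have W: "?W x \<in> carrier X" "?W ?x = of_real c \<odot>\<^bsub>X\<^esub> ?W x"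
      by (rule word_closed[OF lin x], assumption) (rule word_scale[OF lin x])
    have "vsum X (\<lambda>k. Q (word U' ss (J' x) k)) L = vsum X (\<lambda>k. foldr (\<circ>) (digit_word M \<tau> ss k) id ?x) L"
    proof (rule vsum_cong)
      fix k assume k: "k < L"
      have dT: "set (digit_word M \<tau> ss k) \<subseteq> \<T>"
        using \<tau>T ss by (intro set_digit_word[OF M]) auto
      have xX: "?x \<in> carrier X" using x by simp
      show "Q (word U' ss (J' x) k) = foldr (\<circ>) (digit_word M \<tau> ss k) id ?x"
        unfolding coord[OF ss len k] dil[OF dT xX] ..
    qed
    also have "\<dots> = of_nat L \<odot>\<^bsub>X\<^esub> ?W ?x"
      unfolding L_def using \<tau>T[OF _ ss] \<T> x by (intro vsum_digit_word[OF X M] len) auto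
    finally have sum: "vsum X (\<lambda>k. Q (word U' ss (J' x) k)) L
        = of_nat L \<odot>\<^bsub>X\<^esub> (of_real c \<odot>\<^bsub>X\<^esub> ?W x)"
      unfolding W(2) .
    have "Q' (word U' ss (J' x))
        = of_real d \<odot>\<^bsub>X\<^esub> vsum X (\<lambda>k. Q (word U' ss (J' x) k)) L"
      by (simp only: Q'_def restrict_apply' w[OF ss])
    also have "\<dots> = (of_real d * (of_nat L * of_real c)) \<odot>\<^bsub>X\<^esub> ?W x"
      unfolding sum by (simp only: X.sm_assoc X.sm_closed W(1))
    also have "of_real d * (of_nat L * of_real c) = (of_real (d * real L * c) :: 'k)"
      by (simp add: mult.assoc)
    also have "of_real (d * real L * c) \<odot>\<^bsub>X\<^esub> ?W x = ?W x"
      unfolding dLc of_real_1 by (rule X.sm_one[OF W(1)])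
    finally show ?thesis .
  qed
  ultimately show ?thesis unfolding L_def by (rule that)
qed

section \<open>Ultrafilters and scalar limits\<close>

text \<open>A minimal proper filter is an ultrafilter: if it does not contain the complement of \<open>P\<close>, adding \<open>P\<close> to it gives a
proper filter, which by minimality is the same one.\<close>

lemma ultrafilter_below:
  fixes F :: "'i filter"
  assumes F: "F \<noteq> bot"
  obtains U where "U \<le> F" "U \<noteq> bot" "\<And>P. eventually P U \<or> eventually (\<lambda>x. \<not> P x) U"
proof -
  define A where "A = {G. G \<noteq> bot \<and> G \<le> F}"
  have "\<exists>U\<in>A. \<forall>G\<in>A. U \<ge> G \<longrightarrow> G = U"
  proof (rule predicate_Zorn)
    show "partial_order_on A (relation_of (\<ge>) A)"
      by (rule partial_order_on_relation_ofI) auto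
  next
    fix C assume C: "C \<in> Chains (relation_of (\<ge>) A)"
    have CA: "C \<subseteq> A" and total: "\<And>G H. G \<in> C \<Longrightarrow> H \<in> C \<Longrightarrow> G \<le> H \<or> H \<le> G"
      using C by (auto simp: Chains_def relation_of_def)
    show "\<exists>u\<in>A. \<forall>G\<in>C. G \<ge> u"
    proof (cases "C = {}")
      case True then show ?thesis using F by (auto simp: A_def)
    next
      case False
      have base: "\<exists>x\<in>C. x \<le> inf G H" if "G \<in> C" "H \<in> C" for G H
        using total[OF that]
      proof
        assume "G \<le> H"
        then show ?thesis using that(1) by (intro bexI[of _ G]) auto
      next
        assume "H \<le> G"
        then show ?thesis using that(2) by (intro bexI[of _ H]) auto
      qed
      have "\<not> eventually (\<lambda>_. False) (Inf C)"
        using CA by (subst eventually_Inf_base[OF False base]) (auto simp: A_def trivial_limit_def)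
      then have "Inf C \<noteq> bot" by (simp add: trivial_limit_def)
      moreover have "Inf C \<le> F"
      proof -
        obtain G where "G \<in> C" using False by blast
        then show ?thesis using CA Inf_lower[of G C] by (auto simp: A_def)
      qed
      ultimately show ?thesis by (intro bexI[of _ "Inf C"]) (auto simp: A_def intro: Inf_lower)
    qed
  qed
  then obtain U where U: "U \<noteq> bot" "U \<le> F" and min: "\<And>G. G \<in> A \<Longrightarrow> G \<le> U \<Longrightarrow> G = U"
    by (auto simp: A_def)
  have "eventually P U \<or> eventually (\<lambda>x. \<not> P x) U" for P
  proof (cases "eventually (\<lambda>x. \<not> P x) U")
    case False
    let ?G = "inf U (principal {x. P x})"
    have "?G \<noteq> bot"
    proof
      assume "?G = bot"
      then have "eventually (\<lambda>_. False) ?G" by simp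
      then show False using False by (simp add: eventually_inf_principal)
    qed
    moreover have "?G \<le> U" by simp
    moreover have "?G \<le> F" by (rule order_trans[OF inf_le1 U(2)])
    ultimately have "?G = U" by (intro min) (simp_all add: A_def)
    moreover have "eventually P ?G" by (simp add: eventually_inf_principal)
    ultimately show ?thesis by simp
  qed simp
  then show ?thesis using U by (intro that) auto
qed

text \<open>The scalar field is the continuous image of the real line or the plane, and balls are contained in
images of boxes.\<close>

lemma scalar_ball_in_compact:
  "\<exists>K :: 'k::real_or_complex set. compact K \<and> {c. norm c \<le> B} \<subseteq> K"
proof -
  consider (real) "\<forall>c::'k. \<exists>r. c = r *\<^sub>R 1" |
      (cpl) i :: 'k where "\<forall>c. \<exists>a b. c = a *\<^sub>R 1 + b *\<^sub>R i \<and> norm c = sqrt (a\<^sup>2 + b\<^sup>2)"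
    using real_or_complex[where 'a = 'k] by blast
  then show ?thesis
  proof cases
    case real
    have "compact ((\<lambda>r. r *\<^sub>R (1::'k)) ` {- B..B})"
      by (intro compact_continuous_image continuous_intros compact_Icc)
    moreover have "{c. norm c \<le> B} \<subseteq> (\<lambda>r. r *\<^sub>R (1::'k)) ` {- B..B}"
    proof
      fix c :: 'k assume c: "c \<in> {c. norm c \<le> B}"
      obtain r where r: "c = r *\<^sub>R 1" using real by blast
      then have "r \<in> {- B..B}" using c by auto
      then show "c \<in> (\<lambda>r. r *\<^sub>R (1::'k)) ` {- B..B}" unfolding r by (rule imageI)
    qed
    ultimately show ?thesis by blast
  next
    case (cpl i)
    let ?g = "\<lambda>z :: real \<times> real. fst z *\<^sub>R (1::'k) + snd z *\<^sub>R i"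
    have "compact (?g ` ({- B..B} \<times> {- B..B}))"
      by (intro compact_continuous_image continuous_intros compact_Times compact_Icc)
    moreover have "{c. norm c \<le> B} \<subseteq> ?g ` ({- B..B} \<times> {- B..B})"
    proof
      fix c :: 'k assume c: "c \<in> {c. norm c \<le> B}"
      obtain a b where ab: "c = a *\<^sub>R 1 + b *\<^sub>R i" "norm c = sqrt (a\<^sup>2 + b\<^sup>2)" using cpl by blast
      have "\<bar>a\<bar> \<le> norm c" "\<bar>b\<bar> \<le> norm c" unfolding ab(2) by (auto intro: real_le_rsqrt)
      then have "(a, b) \<in> {- B..B} \<times> {- B..B}" using c by auto
      then have "?g (a, b) \<in> ?g ` ({- B..B} \<times> {- B..B})" by (rule imageI)
      then show "c \<in> ?g ` ({- B..B} \<times> {- B..B})" using ab(1) by simp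
    qed
    ultimately show ?thesis by blast
  qed
qed

lemma bounded_scalars_converge_along_ultrafilter:
  fixes g :: "'i \<Rightarrow> 'k::real_or_complex"
  assumes bot: "U \<noteq> bot" and ultra: "\<And>P. eventually P U \<or> eventually (\<lambda>i. \<not> P i) U"
    and bdd: "\<forall>\<^sub>F i in U. norm (g i) \<le> B"
  shows "\<exists>l. (g \<longlongrightarrow> l) U"
proof -
  obtain K :: "'k set" where K: "compact K" "{c. norm c \<le> B} \<subseteq> K" using scalar_ball_in_compact by blast
  have "filtermap g U \<noteq> bot" using bot by (simp add: filtermap_bot_iff)
  moreover have "eventually (\<lambda>x. x \<in> K) (filtermap g U)"
    unfolding eventually_filtermap using bdd by eventually_elim (use K(2) in auto)
  ultimately obtain l where l: "inf (nhds l) (filtermap g U) \<noteq> bot"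
    using K(1)[unfolded compact_filter, rule_format, of "filtermap g U"] by blast
  have "(g \<longlongrightarrow> l) U"
  proof (rule topological_tendstoI)
    fix S assume S: "open S" "l \<in> S"
    show "eventually (\<lambda>i. g i \<in> S) U"
    proof (rule ccontr)
      assume "\<not> ?thesis"
      then have "eventually (\<lambda>i. g i \<notin> S) U" using ultra by blast
      then have "eventually (\<lambda>x. x \<notin> S) (filtermap g U)" by (simp add: eventually_filtermap)
      moreover have "eventually (\<lambda>x. x \<in> S) (nhds l)" using S by (rule eventually_nhds_in_open)
      ultimately have "eventually (\<lambda>_. False) (inf (nhds l) (filtermap g U))"
        unfolding eventually_inf by blast
      then show False using l by (simp add: trivial_limit_def)
    qed
  qed
  then show ?thesis by blast
qed

section \<open>Quotient spaces\<close>

lemma quotient_space_simps [simp]: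
  "carrier (quotient_space V N) = a_rcosets\<^bsub>V\<^esub> N"
  "A \<oplus>\<^bsub>quotient_space V N\<^esub> B = A <+>\<^bsub>V\<^esub> B"
  "c \<odot>\<^bsub>quotient_space V N\<^esub> A = (\<Union>a\<in>A. N +>\<^bsub>V\<^esub> (c \<odot>\<^bsub>V\<^esub> a))"
  "vnorm (quotient_space V N) A = Inf (vnorm V ` A)"
  by (simp_all add: quotient_space_def)

locale quotient = vec_space V for V :: "('k::real_or_complex, 'a) normed_module" (structure) +
  fixes N
  assumes N: "submodule N scalar_ring V"
begin

sublocale abelian_subgroup N V
  by (intro abelian_subgroupI3 additive_subgroup.intro M.abelian_group_axioms submodule.axioms(1)[OF N])

lemma N_sm: "h \<in> N \<Longrightarrow> c \<odot> h \<in> N"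
  using submodule.smult_closed[OF N, of c h] by (simp add: scalar_ring_def)

lemma mem_coset_iff: "x \<in> N +> z \<longleftrightarrow> (\<exists>h\<in>N. x = h \<oplus> z)"
  by (auto simp: a_r_coset_def')

lemma coset_carrier: "z \<in> carrier V \<Longrightarrow> x \<in> N +> z \<Longrightarrow> x \<in> carrier V"
  using a_subset by (auto simp: mem_coset_iff)

lemma coset_in_quotient: "z \<in> carrier V \<Longrightarrow> N +> z \<in> a_rcosets N"
  by (auto simp: A_RCOSETS_def')

lemma quotient_cases:
  assumes "A \<in> a_rcosets N"
  obtains z where "z \<in> carrier V" "A = N +> z"
  using assms by (auto simp: A_RCOSETS_def')

lemma coset_absorb: "h \<in> N \<Longrightarrow> z \<in> carrier V \<Longrightarrow> N +> (h \<oplus> z) = N +> z"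
  using a_coset_add_assoc[of N h z] a_rcos_const[of h] a_subset by auto

lemma coset_sm:
  assumes z: "z \<in> carrier V"
  shows "(\<Union>a\<in>N +> z. N +> (c \<odot> a)) = N +> (c \<odot> z)"
proof -
  have "N +> (c \<odot> a) = N +> (c \<odot> z)" if a: "a \<in> N +> z" for a
  proof -
    obtain h where h: "h \<in> N" "a = h \<oplus> z" using a by (auto simp: mem_coset_iff)
    have hV: "h \<in> carrier V" using h(1) a_subset by blast
    show ?thesis
      unfolding h(2) sm_add_right[OF hV z] by (rule coset_absorb[OF N_sm[OF h(1)] sm_closed[OF z]])
  qed
  moreover have "N +> z \<noteq> {}" using a_rcos_self[OF z] by blast
  ultimately show ?thesis by auto
qed

lemma quotient_closed:
  "A \<in> a_rcosets N \<Longrightarrow> B \<in> a_rcosets N \<Longrightarrow> A <+> B \<in> a_rcosets N"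
  "A \<in> a_rcosets N \<Longrightarrow> (\<Union>a\<in>A. N +> (c \<odot> a)) \<in> a_rcosets N"
  by (erule quotient_cases, erule quotient_cases, simp add: a_rcos_sum coset_in_quotient)
    (erule quotient_cases, simp add: coset_sm coset_in_quotient)

lemma quotient_map:
  assumes X: "normed_space X" and j: "j \<in> linear_maps X V" "\<And>x. x \<in> carrier X \<Longrightarrow> vnorm V (j x) \<le> vnorm X x"
    and nonneg: "\<And>z. z \<in> carrier V \<Longrightarrow> 0 \<le> vnorm V z"
  shows "(\<lambda>x\<in>carrier X. N +> j x) \<in> linear_maps X (quotient_space V N)"
    "x \<in> carrier X \<Longrightarrow> vnorm (quotient_space V N) (N +> j x) \<le> vnorm X x"
proof -
  interpret X: nspace X using X by (rule nspace.intro)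
  note D = linear_mapsD[OF j(1)]
  show "(\<lambda>x\<in>carrier X. N +> j x) \<in> linear_maps X (quotient_space V N)"
    unfolding linear_maps_def
    by (auto simp: D coset_in_quotient a_rcos_sum coset_sm)
  assume x: "x \<in> carrier X"
  have "Inf (vnorm V ` (N +> j x)) \<le> vnorm V (j x)"
  proof (rule cInf_lower)
    show "bdd_below (vnorm V ` (N +> j x))"
      by (rule bdd_belowI2[of _ 0]) (rule nonneg[OF coset_carrier[OF D(1)[OF x]]])
    show "vnorm V (j x) \<in> vnorm V ` (N +> j x)"
      by (rule imageI) (rule a_rcos_self[OF D(1)[OF x]])
  qed
  then show "vnorm (quotient_space V N) (N +> j x) \<le> vnorm X x" using j(2)[OF x] by simp
qed

lemma quotient_lift:
  assumes q: "q \<in> linear_maps V X" "\<And>h. h \<in> N \<Longrightarrow> q h = \<zero>\<^bsub>X\<^esub>" and X: "normed_space X"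
    and le: "\<And>z. z \<in> carrier V \<Longrightarrow> vnorm X (q z) \<le> vnorm V z"
  obtains q' where "q' \<in> linear_maps (quotient_space V N) X" "\<And>z. z \<in> carrier V \<Longrightarrow> q' (N +> z) = q z"
    "\<And>A. A \<in> a_rcosets N \<Longrightarrow> vnorm X (q' A) \<le> vnorm (quotient_space V N) A"
proof -
  interpret X: nspace X using X by (rule nspace.intro)
  note D = linear_mapsD[OF q(1)]
  have const: "q a = q z" if z: "z \<in> carrier V" and a: "a \<in> N +> z" for a z
  proof -
    obtain h where h: "h \<in> N" "a = h \<oplus> z" using a by (auto simp: mem_coset_iff)
    have hV: "h \<in> carrier V" using h(1) a_subset by blast
    show ?thesis unfolding h(2) D(2)[OF hV z] q(2)[OF h(1)] using D(1)[OF z] by simp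
  qed
  define q' where "q' = (\<lambda>A\<in>a_rcosets N. q (SOME a. a \<in> A))"
  have q': "q' (N +> z) = q z" if z: "z \<in> carrier V" for z
  proof -
    have "(SOME a. a \<in> N +> z) \<in> N +> z" using a_rcos_self[OF z] by (rule someI)
    from const[OF z this] show ?thesis by (simp add: q'_def coset_in_quotient[OF z])
  qed
  have "q' \<in> linear_maps (quotient_space V N) X"
    unfolding linear_maps_def
  proof (intro CollectI conjI ballI allI)
    have "q' A \<in> carrier X" if "A \<in> a_rcosets N" for A
      using that q' D(1) by (auto elim!: quotient_cases)
    then show "q' \<in> carrier (quotient_space V N) \<rightarrow>\<^sub>E carrier X" by (auto simp: q'_def)
  next
    fix A B assume "A \<in> carrier (quotient_space V N)" "B \<in> carrier (quotient_space V N)"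
    then obtain y z where yz: "y \<in> carrier V" "A = N +> y" "z \<in> carrier V" "B = N +> z"
      by (auto elim!: quotient_cases)
    then show "q' (A \<oplus>\<^bsub>quotient_space V N\<^esub> B) = q' A \<oplus>\<^bsub>X\<^esub> q' B"
      by (simp add: a_rcos_sum q' D)
  next
    fix c A assume "A \<in> carrier (quotient_space V N)"
    then obtain y where y: "y \<in> carrier V" "A = N +> y"
      by (auto elim!: quotient_cases)
    then show "q' (c \<odot>\<^bsub>quotient_space V N\<^esub> A) = c \<odot>\<^bsub>X\<^esub> q' A"
      by (simp add: coset_sm q' D)
  qed
  moreover have "vnorm X (q' A) \<le> vnorm (quotient_space V N) A" if A: "A \<in> a_rcosets N" for A
  proof -
    obtain z where z: "z \<in> carrier V" "A = N +> z" by (rule quotient_cases[OF A])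
    have "vnorm X (q z) \<le> Inf (vnorm V ` (N +> z))"
    proof (rule cInf_greatest)
      show "vnorm V ` (N +> z) \<noteq> {}" using a_rcos_self[OF z(1)] by blast
      fix r assume "r \<in> vnorm V ` (N +> z)"
      then obtain a where a: "a \<in> N +> z" "r = vnorm V a" by blast
      show "vnorm X (q z) \<le> r"
        using le[OF coset_carrier[OF z(1) a(1)]] unfolding const[OF z(1) a(1)] a(2) .
    qed
    then show ?thesis using q'[OF z(1)] z(2) by simp
  qed
  ultimately show ?thesis using that[of q'] q' by simp
qed

text \<open>The induced map sends a coset to its image as a set. The norms occurring in the coset and in its image
are the same, hence so are their infima.\<close>

lemma quotient_isometry:
  assumes u: "u \<in> isometric_isos V V" and uN: "u ` N = N"
  shows "(\<lambda>A\<in>a_rcosets N. u ` A) \<in> isometric_isos (quotient_space V N) (quotient_space V N)"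
    "z \<in> carrier V \<Longrightarrow> u ` (N +> z) = N +> u z"
proof -
  note D = linear_mapsD[OF isometric_isosD(1)[OF u]] and bij = isometric_isosD(2)[OF u]
  let ?V = "quotient_space V N" and ?U = "\<lambda>A\<in>a_rcosets N. u ` A"
  have img: "u ` (N +> z) = N +> u z" if z: "z \<in> carrier V" for z
  proof -
    have NV: "h \<in> carrier V" if "h \<in> N" for h using that a_subset by blast
    have "u ` (N +> z) = (\<lambda>h. u (h \<oplus> z)) ` N" by (auto simp: a_r_coset_def' image_iff)
    also have "\<dots> = (\<lambda>h. u h \<oplus> u z) ` N" by (rule image_cong) (simp_all add: D NV z)
    also have "\<dots> = (\<lambda>h. h \<oplus> u z) ` (u ` N)" by (simp add: image_image)
    also have "\<dots> = N +> u z" unfolding uN by (auto simp: a_r_coset_def')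
    finally show ?thesis .
  qed
  then show "z \<in> carrier V \<Longrightarrow> u ` (N +> z) = N +> u z" .
  have Uz: "?U (N +> z) = N +> u z" if "z \<in> carrier V" for z
    using that by (simp add: coset_in_quotient img)
  show "?U \<in> isometric_isos ?V ?V"
  proof (rule isometric_isosI)
    show "?U \<in> linear_maps ?V ?V"
      unfolding linear_maps_def
    proof (intro CollectI conjI ballI allI)
      have "u ` A \<in> a_rcosets N" if "A \<in> a_rcosets N" for A
        using that img D(1) coset_in_quotient by (auto elim!: quotient_cases)
      then show "?U \<in> carrier ?V \<rightarrow>\<^sub>E carrier ?V" by auto
    next
      fix A B assume "A \<in> carrier ?V" "B \<in> carrier ?V"
      then obtain y z where yz: "y \<in> carrier V" "A = N +> y" "z \<in> carrier V" "B = N +> z"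
        by (auto elim!: quotient_cases)
      have yzV: "y \<oplus> z \<in> carrier V" using yz by simp
      show "?U (A \<oplus>\<^bsub>?V\<^esub> B) = ?U A \<oplus>\<^bsub>?V\<^esub> ?U B"
        unfolding yz(2,4) quotient_space_simps a_rcos_sum[OF yz(1,3)] Uz[OF yzV] Uz[OF yz(1)] Uz[OF yz(3)]
          a_rcos_sum[OF D(1)[OF yz(1)] D(1)[OF yz(3)]] D(2)[OF yz(1,3)] ..
    next
      fix c A assume "A \<in> carrier ?V"
      then obtain y where y: "y \<in> carrier V" "A = N +> y"
        by (auto elim!: quotient_cases)
      show "?U (c \<odot>\<^bsub>?V\<^esub> A) = c \<odot>\<^bsub>?V\<^esub> ?U A"
        unfolding y(2) quotient_space_simps coset_sm[OF y(1)] Uz[OF sm_closed[OF y(1)]] Uz[OF y(1)]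
          coset_sm[OF D(1)[OF y(1)]] D(3)[OF y(1)] ..
    qed
    show "bij_betw ?U (carrier ?V) (carrier ?V)"
      unfolding bij_betw_def
    proof (intro conjI inj_onI)
      fix A B assume "A \<in> carrier ?V" "B \<in> carrier ?V" and eq: "?U A = ?U B"
      then have AB: "A \<in> a_rcosets N" "B \<in> a_rcosets N" by simp_all
      then have "A \<subseteq> carrier V" "B \<subseteq> carrier V"
        using coset_carrier by (auto elim!: quotient_cases)
      moreover have "u ` A = u ` B" using eq AB by simp
      moreover have "inj_on u (carrier V)" using bij by (simp add: bij_betw_def)
      ultimately show "A = B" by (simp add: inj_on_image_eq_iff)
    next
      show "?U ` carrier ?V = carrier ?V"
      proof (intro equalityI subsetI)
        fix B assume "B \<in> ?U ` carrier ?V"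
        then obtain A where A: "B = ?U A" "A \<in> a_rcosets N" by auto
        obtain z where "z \<in> carrier V" "A = N +> z" by (rule quotient_cases[OF A(2)])
        with A(1) have z: "z \<in> carrier V" "B = ?U (N +> z)" by simp_all
        show "B \<in> carrier ?V" unfolding z(2) Uz[OF z(1)] by (simp add: coset_in_quotient[OF D(1)[OF z(1)]])
      next
        fix B assume "B \<in> carrier ?V"
        then obtain w where w: "w \<in> carrier V" "B = N +> w" by (auto elim!: quotient_cases)
        have "w \<in> u ` carrier V" using bij w(1) by (simp add: bij_betw_def)
        then obtain z where z: "z \<in> carrier V" "w = u z" by blast
        have "?U (N +> z) \<in> ?U ` carrier ?V" by (rule imageI) (simp add: coset_in_quotient[OF z(1)])
        then show "B \<in> ?U ` carrier ?V" unfolding Uz[OF z(1)] w(2) z(2) .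
      qed
    qed
    fix A assume A: "A \<in> carrier ?V"
    then have AV: "A \<subseteq> carrier V" using coset_carrier by (auto elim!: quotient_cases)
    have "vnorm V ` u ` A = vnorm V ` A"
      unfolding image_image using isometric_isosD(3)[OF u] AV by (intro image_cong) auto
    then show "vnorm ?V (?U A) = vnorm ?V A" using A by simp
  qed
qed

end

section \<open>Dilations on ultraproducts\<close>

lemma linf_sum_isometry:
  assumes Z: "\<And>i. i \<in> I \<Longrightarrow> normed_space (Z i)" and W: "\<And>i. i \<in> I \<Longrightarrow> W i \<in> isometric_isos (Z i) (Z i)"
  shows "(\<lambda>z\<in>carrier (linf_sum I Z). \<lambda>i\<in>I. W i (z i)) \<in> isometric_isos (linf_sum I Z) (linf_sum I Z)"
    (is "?U \<in> _")
proof -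
  let ?L = "linf_sum I Z"
  interpret L: vec_space ?L by (rule vec_space_linf_sum) (rule Z)
  note WD = linear_mapsD[OF isometric_isosD(1)[OF W]] and C = linf_sum_carrierD
  have U: "?U z = (\<lambda>i\<in>I. W i (z i))" if "z \<in> carrier ?L" for z using that by simp
  have norm_i: "vnorm (Z i) (W i (z i)) = vnorm (Z i) (z i)" if "z \<in> carrier ?L" "i \<in> I" for z i
    using isometric_isosD(3)[OF W[OF that(2)] C(2)[OF that]] .
  have closed: "?U z \<in> carrier ?L" if z: "z \<in> carrier ?L" for z
    unfolding U[OF z]
    by (rule linf_sum_carrierI[where B = "vnorm ?L z"])
      (simp_all add: WD(1) C(2)[OF z] norm_i[OF z] C(3)[OF z])
  have eqI: "x = y" if "x \<in> extensional I" "y \<in> extensional I" "\<And>i. i \<in> I \<Longrightarrow> x i = y i" for x y :: "_ \<Rightarrow> _"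
    using that by (rule extensionalityI)
  show ?thesis
  proof (rule isometric_isosI)
    show "?U \<in> linear_maps ?L ?L"
      unfolding linear_maps_def
    proof (intro CollectI conjI ballI allI)
      show "?U \<in> carrier ?L \<rightarrow>\<^sub>E carrier ?L" using closed by auto
    next
      fix y z assume y: "y \<in> carrier ?L" and z: "z \<in> carrier ?L"
      show "?U (y \<oplus>\<^bsub>?L\<^esub> z) = ?U y \<oplus>\<^bsub>?L\<^esub> ?U z"
        unfolding U[OF L.M.a_closed[OF y z]] U[OF y] U[OF z]
        by (rule eqI) (simp_all add: WD C(2)[OF y] C(2)[OF z])
    next
      fix c z assume z: "z \<in> carrier ?L"
      show "?U (c \<odot>\<^bsub>?L\<^esub> z) = c \<odot>\<^bsub>?L\<^esub> ?U z"
        unfolding U[OF L.sm_closed[OF z]] U[OF z]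
        by (rule eqI) (simp_all add: WD C(2)[OF z])
    qed
    show "bij_betw ?U (carrier ?L) (carrier ?L)"
      unfolding bij_betw_def
    proof (intro conjI inj_onI)
      fix y z assume y: "y \<in> carrier ?L" and z: "z \<in> carrier ?L" and eq: "?U y = ?U z"
      show "y = z"
      proof (rule eqI[OF C(1)[OF y] C(1)[OF z]])
        fix i assume i: "i \<in> I"
        have "W i (y i) = W i (z i)" using fun_cong[OF eq[unfolded U[OF y] U[OF z]], of i] i by simp
        then show "y i = z i"
          using isometric_isosD(2)[OF W[OF i]] C(2)[OF y i] C(2)[OF z i] by (simp add: bij_betw_def inj_on_def)
      qed
    next
      show "?U ` carrier ?L = carrier ?L"
      proof (intro equalityI subsetI)
        fix w assume "w \<in> ?U ` carrier ?L"
        then show "w \<in> carrier ?L" using closed by blast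
      next
        fix w assume w: "w \<in> carrier ?L"
        have inv: "inv_into (carrier (Z i)) (W i) (w i) \<in> carrier (Z i)"
            "W i (inv_into (carrier (Z i)) (W i) (w i)) = w i" if i: "i \<in> I" for i
          using isometric_isosD(2)[OF W[OF i]] C(2)[OF w i]
          by (auto simp: bij_betw_def inv_into_into f_inv_into_f)
        define z where "z = (\<lambda>i\<in>I. inv_into (carrier (Z i)) (W i) (w i))"
        have z: "z \<in> carrier ?L"
        proof (rule linf_sum_carrierI[where B = "vnorm ?L w"])
          fix i assume i: "i \<in> I"
          show "z i \<in> carrier (Z i)" using inv(1)[OF i] i by (simp add: z_def)
          show "vnorm (Z i) (z i) \<le> vnorm ?L w"
            using isometric_isosD(3)[OF W[OF i] inv(1)[OF i]] inv(2)[OF i] C(3)[OF w i] i by (simp add: z_def)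
        qed (simp add: z_def)
        have "?U z = w"
          unfolding U[OF z] by (rule eqI) (simp_all add: z_def inv(2) C(1)[OF w])
        then show "w \<in> ?U ` carrier ?L" using imageI[OF z, of ?U] by (simp only:)
      qed
    qed
    show "vnorm ?L (?U z) = vnorm ?L z" if z: "z \<in> carrier ?L" for z
    proof -
      have "(\<lambda>i. vnorm (Z i) ((\<lambda>i\<in>I. W i (z i)) i)) ` I = (\<lambda>i. vnorm (Z i) (z i)) ` I"
        by (rule image_cong) (simp_all add: norm_i[OF z])
      then show ?thesis unfolding U[OF z] by (simp add: linf_sum_def)
    qed
  qed
qed

lemma bounded_ops_norm_nonneg:
  assumes V: "normed_space V" and W: "normed_space W" and f: "f \<in> carrier (bounded_ops V W)"
  shows "0 \<le> vnorm (bounded_ops V W) f"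
proof -
  interpret V: nspace V using V by (rule nspace.intro)
  interpret W: nspace W using W by (rule nspace.intro)
  let ?c = "vnorm (bounded_ops V W) f" and ?S = "(\<lambda>x. vnorm W (f x)) ` {x \<in> carrier V. vnorm V x \<le> 1}"
  have "bdd_above ?S"
  proof (rule bdd_aboveI2)
    fix x assume "x \<in> {x \<in> carrier V. vnorm V x \<le> 1}"
    then have x: "x \<in> carrier V" "vnorm V x \<le> 1" by auto
    have "vnorm W (f x) \<le> ?c * vnorm V x" by (rule bounded_ops_bound[OF V W f x(1)])
    also have "\<dots> \<le> \<bar>?c\<bar> * 1" using x by (intro mult_mono) auto
    finally show "vnorm W (f x) \<le> \<bar>?c\<bar>" by simp
  qed
  moreover have "0 \<in> ?S"
  proof (rule image_eqI)
    have lin: "f \<in> linear_maps V W" using f by (simp add: bounded_ops_def)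
    show "0 = vnorm W (f \<zero>\<^bsub>V\<^esub>)"
      by (simp add: linear_maps_zero[OF V.vec_space_axioms W.vec_space_axioms lin])
  qed simp
  ultimately have "0 \<le> Sup ?S" by (intro cSup_upper)
  then show ?thesis by (simp add: bounded_ops_def)
qed

lemma dual_bound:
  assumes X: "normed_space X" and f: "f \<in> carrier (dual X)"
  shows "x \<in> carrier X \<Longrightarrow> norm (f x) \<le> vnorm (dual X) f * vnorm X x" "0 \<le> vnorm (dual X) f"
  using bounded_ops_bound[OF X normed_space_scalar_space, of f x]
    bounded_ops_norm_nonneg[OF X normed_space_scalar_space, of f] f
  by (simp_all add: dual_def)

lemma dual_minus:
  assumes "normed_space X" and f: "f \<in> carrier (dual X)" and "x \<in> carrier X" "y \<in> carrier X"
  shows "f (x \<ominus>\<^bsub>X\<^esub> y) = f x - f y"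
proof -
  interpret nspace X using assms(1) by (rule nspace.intro)
  show ?thesis
    using linear_mapsD(2,3)[OF dual_linear[OF f]] assms(3,4) by (simp add: minus_eq_sm)
qed

text \<open>The limits of \<open>f (w i)\<close> define a bounded functional of \<open>f\<close>, which by reflexivity is evaluation at a vector.\<close>

lemma weak_limit_along_ultrafilter:
  fixes X :: "('k::real_or_complex, 'a) normed_module"
  assumes X: "normed_space X" and refl: "reflexive X" and U: "ultrafilter_on I U"
    and w: "\<And>i. i \<in> I \<Longrightarrow> w i \<in> carrier X" "\<And>i. i \<in> I \<Longrightarrow> vnorm X (w i) \<le> B"
  shows "\<exists>v\<in>carrier X. \<forall>f\<in>carrier (dual X). ((\<lambda>i. f (w i)) \<longlongrightarrow> f v) U"
proof -
  interpret nspace X using X by (rule nspace.intro)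
  have bot: "U \<noteq> bot" and ultra: "\<And>P. eventually P U \<or> eventually (\<lambda>i. \<not> P i) U"
    and evI: "eventually (\<lambda>i. i \<in> I) U"
    using U by (auto simp: ultrafilter_on_def le_principal)
  have bound: "norm (f (w i)) \<le> vnorm (dual X) f * B" if "f \<in> carrier (dual X)" "i \<in> I" for f i
    using dual_bound(1)[OF X that(1) w(1)[OF that(2)]]
      mult_left_mono[OF w(2)[OF that(2)] dual_bound(2)[OF X that(1)]] by simp
  have "\<exists>l. ((\<lambda>i. f (w i)) \<longlongrightarrow> l) U" if f: "f \<in> carrier (dual X)" for f
  proof (rule bounded_scalars_converge_along_ultrafilter[OF bot ultra])
    show "\<forall>\<^sub>F i in U. norm (f (w i)) \<le> vnorm (dual X) f * B"
      using evI by eventually_elim (rule bound[OF f])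
  qed
  then obtain l where l: "\<And>f. f \<in> carrier (dual X) \<Longrightarrow> ((\<lambda>i. f (w i)) \<longlongrightarrow> l f) U" by metis
  define \<Phi> where "\<Phi> = (\<lambda>f\<in>carrier (dual X). l f)"
  have uniq: "\<Phi> f = c" if "f \<in> carrier (dual X)" "((\<lambda>i. f (w i)) \<longlongrightarrow> c) U" for f c
    using tendsto_unique[OF bot l[OF that(1)] that(2)] that(1) by (simp add: \<Phi>_def)
  have closed: "f \<oplus>\<^bsub>dual X\<^esub> g \<in> carrier (dual X)" "c \<odot>\<^bsub>dual X\<^esub> f \<in> carrier (dual X)"
    if f: "f \<in> carrier (dual X)" and g: "g \<in> carrier (dual X)" for f g c
  proof -
    note fD = linear_mapsD(2,3)[OF dual_linear[OF f]] and gD = linear_mapsD(2,3)[OF dual_linear[OF g]]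
    show "f \<oplus>\<^bsub>dual X\<^esub> g \<in> carrier (dual X)"
    proof (rule dualI[where C = "vnorm (dual X) f + vnorm (dual X) g"])
      show "f \<oplus>\<^bsub>dual X\<^esub> g \<in> linear_maps X scalar_space"
        by (auto simp: linear_maps_def dual_def fD gD algebra_simps)
      fix x assume x: "x \<in> carrier X"
      have "norm (f x + g x) \<le> norm (f x) + norm (g x)" by (rule norm_triangle_ineq)
      also have "\<dots> \<le> vnorm (dual X) f * vnorm X x + vnorm (dual X) g * vnorm X x"
        by (intro add_mono dual_bound(1)[OF X] f g x)
      finally show "norm ((f \<oplus>\<^bsub>dual X\<^esub> g) x) \<le> (vnorm (dual X) f + vnorm (dual X) g) * vnorm X x"
        using x by (simp add: dual_def algebra_simps)
    qed
    show "c \<odot>\<^bsub>dual X\<^esub> f \<in> carrier (dual X)"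
    proof (rule dualI[where C = "norm c * vnorm (dual X) f"])
      show "c \<odot>\<^bsub>dual X\<^esub> f \<in> linear_maps X scalar_space"
        by (auto simp: linear_maps_def dual_def fD algebra_simps)
      fix x assume x: "x \<in> carrier X"
      show "norm ((c \<odot>\<^bsub>dual X\<^esub> f) x) \<le> norm c * vnorm (dual X) f * vnorm X x"
        using dual_bound(1)[OF X f x] x by (simp add: dual_def norm_mult mult_left_mono mult.assoc)
    qed
  qed
  have w_ev: "((\<lambda>i. g (w i)) \<longlongrightarrow> c) U" if "(h \<longlongrightarrow> c) U" "\<And>i. i \<in> I \<Longrightarrow> h i = g (w i)" for g h c
  proof (rule Lim_transform_eventually[OF that(1)])
    show "\<forall>\<^sub>F i in U. h i = g (w i)" using evI by eventually_elim (rule that(2))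
  qed
  have "\<Phi> \<in> carrier (dual (dual X))"
  proof (rule dualI[where C = B])
    show "\<Phi> \<in> linear_maps (dual X) scalar_space"
      unfolding linear_maps_def
    proof (intro CollectI conjI ballI allI)
      show "\<Phi> \<in> carrier (dual X) \<rightarrow>\<^sub>E carrier scalar_space" by (simp add: \<Phi>_def)
    next
      fix f g assume f: "f \<in> carrier (dual X)" and g: "g \<in> carrier (dual X)"
      have "((\<lambda>i. (f \<oplus>\<^bsub>dual X\<^esub> g) (w i)) \<longlongrightarrow> l f + l g) U"
        by (rule w_ev[OF tendsto_add[OF l[OF f] l[OF g]]]) (simp add: dual_def w(1))
      then show "\<Phi> (f \<oplus>\<^bsub>dual X\<^esub> g) = \<Phi> f \<oplus>\<^bsub>scalar_space\<^esub> \<Phi> g"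
        using uniq[OF closed(1)[OF f g]] f g by (simp add: \<Phi>_def)
    next
      fix c f assume f: "f \<in> carrier (dual X)"
      have "((\<lambda>i. (c \<odot>\<^bsub>dual X\<^esub> f) (w i)) \<longlongrightarrow> c * l f) U"
        by (rule w_ev[OF tendsto_mult[OF tendsto_const l[OF f]]]) (simp add: dual_def w(1))
      then show "\<Phi> (c \<odot>\<^bsub>dual X\<^esub> f) = c \<odot>\<^bsub>scalar_space\<^esub> \<Phi> f"
        using uniq[OF closed(2)[OF f f]] f by (simp add: \<Phi>_def)
    qed
    fix f assume f: "f \<in> carrier (dual X)"
    have "norm (l f) \<le> vnorm (dual X) f * B"
    proof (rule tendsto_upperbound[OF tendsto_norm[OF l[OF f]] _ bot])
      show "\<forall>\<^sub>F i in U. norm (f (w i)) \<le> vnorm (dual X) f * B"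
        using evI by eventually_elim (rule bound[OF f])
    qed
    then show "norm (\<Phi> f) \<le> B * vnorm (dual X) f" using f by (simp add: \<Phi>_def mult.commute)
  qed
  then obtain v where v: "v \<in> carrier X" "\<And>f. f \<in> carrier (dual X) \<Longrightarrow> \<Phi> f = f v"
    using refl unfolding reflexive_def by blast
  have "((\<lambda>i. f (w i)) \<longlongrightarrow> f v) U" if f: "f \<in> carrier (dual X)" for f
    using l[OF f] v(2)[OF f] f by (simp add: \<Phi>_def)
  then show ?thesis using v(1) by blast
qed

lemma submodule_null_families:
  assumes Z: "\<And>i. i \<in> I \<Longrightarrow> normed_space (Z i)" and U: "U \<le> principal I"
  shows "submodule (null_families I U Z) scalar_ring (linf_sum I Z)"
proof -
  let ?L = "linf_sum I Z" and ?N = "null_families I U Z"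
  interpret L: vec_space ?L by (rule vec_space_linf_sum) (rule Z)
  have evI: "eventually (\<lambda>i. i \<in> I) U" using U by (simp add: le_principal)
  note C = linf_sum_carrierD(2)
  have dom: "x \<in> ?N" if x: "x \<in> carrier ?L" and b: "(b \<longlongrightarrow> 0) U" "\<And>i. i \<in> I \<Longrightarrow> vnorm (Z i) (x i) \<le> b i" for x b
  proof -
    have "((\<lambda>i. vnorm (Z i) (x i)) \<longlongrightarrow> 0) U"
    proof (rule tendsto_sandwich[OF _ _ tendsto_const b(1)])
      show "\<forall>\<^sub>F i in U. 0 \<le> vnorm (Z i) (x i)"
        using evI by eventually_elim (rule nspace.norm_nonneg[OF nspace.intro[OF Z] C[OF x]])
      show "\<forall>\<^sub>F i in U. vnorm (Z i) (x i) \<le> b i"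
        using evI by eventually_elim (rule b(2))
    qed
    then show ?thesis using x by (simp add: null_families_def)
  qed
  have ND: "x \<in> carrier ?L" "((\<lambda>i. vnorm (Z i) (x i)) \<longlongrightarrow> 0) U" if "x \<in> ?N" for x
    using that by (auto simp: null_families_def)
  have sm: "c \<odot>\<^bsub>?L\<^esub> x \<in> ?N" if x: "x \<in> ?N" for c x
  proof (rule dom[OF L.sm_closed[OF ND(1)[OF x]]])
    show "((\<lambda>i. norm c * vnorm (Z i) (x i)) \<longlongrightarrow> 0) U"
      using tendsto_mult[OF tendsto_const ND(2)[OF x], of "norm c"] by simp
    show "vnorm (Z i) ((c \<odot>\<^bsub>?L\<^esub> x) i) \<le> norm c * vnorm (Z i) (x i)" if i: "i \<in> I" for i
      using nspace.norm_sm[OF nspace.intro[OF Z[OF i]] C[OF ND(1)[OF x] i], of c] i by simp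
  qed
  show ?thesis
  proof (rule L.submoduleI)
    show "?N \<subseteq> carrier ?L" using ND(1) by blast
    show "\<zero>\<^bsub>?L\<^esub> \<in> ?N"
      by (rule dom[OF L.M.zero_closed tendsto_const]) (simp add: nspace.norm_zero[OF nspace.intro[OF Z]])
    show "\<ominus>\<^bsub>?L\<^esub> x \<in> ?N" if x: "x \<in> ?N" for x
      unfolding L.neg_eq_sm[OF ND(1)[OF x]] by (rule sm[OF x])
    show "x \<oplus>\<^bsub>?L\<^esub> y \<in> ?N" if x: "x \<in> ?N" and y: "y \<in> ?N" for x y
    proof (rule dom[OF L.M.a_closed[OF ND(1)[OF x] ND(1)[OF y]]])
      show "((\<lambda>i. vnorm (Z i) (x i) + vnorm (Z i) (y i)) \<longlongrightarrow> 0) U"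
        using tendsto_add[OF ND(2)[OF x] ND(2)[OF y]] by simp
      show "vnorm (Z i) ((x \<oplus>\<^bsub>?L\<^esub> y) i) \<le> vnorm (Z i) (x i) + vnorm (Z i) (y i)" if i: "i \<in> I" for i
        using nspace.norm_add[OF nspace.intro[OF Z[OF i]] C[OF ND(1)[OF x] i] C[OF ND(1)[OF y] i]] i by simp
    qed
    show "c \<odot>\<^bsub>?L\<^esub> x \<in> ?N" if "x \<in> ?N" for c x using that by (rule sm)
  qed
qed

text \<open>The embeddings and the isometries act coordinatewise on bounded families and descend to cosets. The
projections \<open>Q i\<close> are combined into the weak limit of \<open>Q i (z i)\<close>; it vanishes on null families and is a
contraction because norming functionals detect the norm of the limit. On a word it gives the
limit of the words dilated at the indices.\<close>

lemma ultraproduct_dilation: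
  fixes X :: "('k::real_or_complex, 'a) normed_module"
  assumes X: "normed_space X" and refl: "reflexive X" and I: "I \<noteq> {}" and U: "ultrafilter_on I U"
    and Z: "\<And>i. i \<in> I \<Longrightarrow> normed_space (Z i)"
    and frame: "\<And>i. i \<in> I \<Longrightarrow> dilation_frame X (Z i) \<S> (J i) (Q i) (V i)"
    and W: "\<And>ss x. set ss \<subseteq> \<S> \<Longrightarrow> x \<in> carrier X \<Longrightarrow> W ss x \<in> carrier X"
    and lim: "\<And>ss x. set ss \<subseteq> \<S> \<Longrightarrow> x \<in> carrier X \<Longrightarrow>
      ((\<lambda>i. vnorm X (Q i (word (V i) ss (J i x)) \<ominus>\<^bsub>X\<^esub> W ss x)) \<longlongrightarrow> 0) U"
  obtains J' Q' V' where "dilation_frame X (ultraproduct I U Z) \<S> J' Q' V'"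
    "\<And>ss x. set ss \<subseteq> \<S> \<Longrightarrow> x \<in> carrier X \<Longrightarrow> Q' (word V' ss (J' x)) = W ss x"
proof -
  interpret X: nspace X using X by (rule nspace.intro)
  define L where "L = linf_sum I Z"
  define N where "N = null_families I U Z"
  interpret L: vec_space L unfolding L_def by (rule vec_space_linf_sum) (rule Z)
  have bot: "U \<noteq> bot" and leI: "U \<le> principal I" using U by (auto simp: ultrafilter_on_def)
  have evI: "eventually (\<lambda>i. i \<in> I) U" using leI by (simp add: le_principal)
  interpret quotient L N
    by (intro quotient.intro L.vec_space_axioms quotient_axioms.intro)
      (use submodule_null_families[OF Z leI] in \<open>simp add: N_def L_def\<close>)
  note C = linf_sum_carrierD[of _ I Z, folded L_def]
  have J: "J i \<in> linear_maps X (Z i)" "\<And>x. x \<in> carrier X \<Longrightarrow> vnorm (Z i) (J i x) \<le> vnorm X x"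
    and Q: "Q i \<in> linear_maps (Z i) X" "\<And>v. v \<in> carrier (Z i) \<Longrightarrow> vnorm X (Q i v) \<le> vnorm (Z i) v"
    and V: "\<And>s. s \<in> \<S> \<Longrightarrow> V i s \<in> isometric_isos (Z i) (Z i)" if "i \<in> I" for i
    using frame[OF that] by (auto simp: dilation_frame_def)
  note JD = linear_mapsD[OF J(1)] and QD = linear_mapsD[OF Q(1)]
  have nonneg: "0 \<le> vnorm L z" if z: "z \<in> carrier L" for z
  proof -
    obtain i where i: "i \<in> I" using I by blast
    show ?thesis
      using nspace.norm_nonneg[OF nspace.intro[OF Z[OF i]] C(2)[OF z i]] C(3)[OF z i] by linarith
  qed
  have ND: "x \<in> N \<longleftrightarrow> x \<in> carrier L \<and> ((\<lambda>i. vnorm (Z i) (x i)) \<longlongrightarrow> 0) U" for x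
    by (simp add: N_def L_def null_families_def)
  define j where "j = (\<lambda>x\<in>carrier X. \<lambda>i\<in>I. J i x)"
  have jL: "j x \<in> carrier L" if x: "x \<in> carrier X" for x
    unfolding L_def by (rule linf_sum_carrierI[where B = "vnorm X x"]) (simp_all add: j_def x JD J(2))
  have jlin: "j \<in> linear_maps X L"
    unfolding linear_maps_def
  proof (intro CollectI conjI ballI allI)
    show "j \<in> carrier X \<rightarrow>\<^sub>E carrier L" using jL by (auto simp: j_def)
    show "j (x \<oplus>\<^bsub>X\<^esub> y) = j x \<oplus>\<^bsub>L\<^esub> j y" if "x \<in> carrier X" "y \<in> carrier X" for x y
      using that by (auto simp: j_def L_def JD fun_eq_iff)
    show "j (c \<odot>\<^bsub>X\<^esub> x) = c \<odot>\<^bsub>L\<^esub> j x" if "x \<in> carrier X" for c x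
      using that by (auto simp: j_def L_def JD fun_eq_iff)
  qed
  have jnorm: "vnorm L (j x) \<le> vnorm X x" if x: "x \<in> carrier X" for x
  proof -
    have "Sup ((\<lambda>i. vnorm (Z i) (j x i)) ` I) \<le> vnorm X x"
      using I x J(2) by (intro cSup_least) (auto simp: j_def)
    then show ?thesis by (simp add: L_def linf_sum_def)
  qed
  define v where "v s = (\<lambda>z\<in>carrier L. \<lambda>i\<in>I. V i s (z i))" for s
  have viso: "v s \<in> isometric_isos L L" if "s \<in> \<S>" for s
    unfolding v_def L_def using V that by (intro linf_sum_isometry Z)
  have vi: "v s z i = V i s (z i)" if "z \<in> carrier L" "i \<in> I" for s z i
    using that by (simp add: v_def)
  have vN: "v s ` N = N" if s: "s \<in> \<S>" for s
  proof -
    have iff: "v s z \<in> N \<longleftrightarrow> z \<in> N" if z: "z \<in> carrier L" for z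
    proof -
      have "\<forall>\<^sub>F i in U. vnorm (Z i) (v s z i) = vnorm (Z i) (z i)"
        using evI
      proof eventually_elim
        case (elim i)
        show ?case unfolding vi[OF z elim] by (rule isometric_isosD(3)[OF V[OF elim s] C(2)[OF z elim]])
      qed
      then have "((\<lambda>i. vnorm (Z i) (v s z i)) \<longlongrightarrow> 0) U \<longleftrightarrow> ((\<lambda>i. vnorm (Z i) (z i)) \<longlongrightarrow> 0) U"
        by (rule tendsto_cong)
      then show ?thesis using z linear_mapsD(1)[OF isometric_isosD(1)[OF viso[OF s]] z] by (simp add: ND)
    qed
    show ?thesis
    proof (intro equalityI subsetI)
      fix w assume "w \<in> v s ` N"
      then obtain z where "z \<in> N" "w = v s z" by blast
      then show "w \<in> N" using iff[of z] ND[of z] by simp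
    next
      fix w assume w: "w \<in> N"
      have "w \<in> v s ` carrier L"
        using isometric_isosD(2)[OF viso[OF s]] w ND by (simp add: bij_betw_def)
      then obtain z where z: "z \<in> carrier L" "w = v s z" by blast
      then have "z \<in> N" using iff[OF z(1)] w by simp
      then show "w \<in> v s ` N" unfolding z(2) by (rule imageI)
    qed
  qed
  have qex: "\<exists>x\<in>carrier X. \<forall>f\<in>carrier (dual X). ((\<lambda>i. f (Q i (z i))) \<longlongrightarrow> f x) U" if z: "z \<in> carrier L" for z
  proof (rule weak_limit_along_ultrafilter[OF X refl U])
    fix i assume i: "i \<in> I"
    show "Q i (z i) \<in> carrier X" using QD(1)[OF i C(2)[OF z i]] .
    show "vnorm X (Q i (z i)) \<le> vnorm L z" using Q(2)[OF i C(2)[OF z i]] C(3)[OF z i] by simp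
  qed
  \<comment> \<open>The limit is unique since functionals separate points; this makes its choice linear in \<open>z\<close>.\<close>
  define q where "q = (\<lambda>z\<in>carrier L. SOME x. x \<in> carrier X \<and> (\<forall>f\<in>carrier (dual X). ((\<lambda>i. f (Q i (z i))) \<longlongrightarrow> f x) U))"
  have q: "q z \<in> carrier X \<and> (\<forall>f\<in>carrier (dual X). ((\<lambda>i. f (Q i (z i))) \<longlongrightarrow> f (q z)) U)"
    if z: "z \<in> carrier L" for z
    using someI_ex[OF qex[OF z, unfolded Bex_def]] z by (simp add: q_def)
  have qX: "q z \<in> carrier X" if "z \<in> carrier L" for z using q[OF that] by blast
  have qlim: "((\<lambda>i. f (Q i (z i))) \<longlongrightarrow> f (q z)) U" if "z \<in> carrier L" "f \<in> carrier (dual X)" for f z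
    using q[OF that(1)] that(2) by blast
  have q_unique: "q z = x" if z: "z \<in> carrier L" and x: "x \<in> carrier X"
    and l: "\<And>f. f \<in> carrier (dual X) \<Longrightarrow> ((\<lambda>i. f (Q i (z i))) \<longlongrightarrow> f x) U" for z x
    by (rule X.dual_separates[OF qX[OF z] x]) (rule tendsto_unique[OF bot qlim[OF z] l])
  have ev_cong: "(g \<longlongrightarrow> c) U" if "(h \<longlongrightarrow> c) U" "\<And>i. i \<in> I \<Longrightarrow> h i = g i" for g h :: "_ \<Rightarrow> 'k" and c
  proof (rule Lim_transform_eventually[OF that(1)])
    show "\<forall>\<^sub>F i in U. h i = g i" using evI by eventually_elim (rule that(2))
  qed
  have qlin: "q \<in> linear_maps L X"
    unfolding linear_maps_def
  proof (intro CollectI conjI ballI allI)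
    show "q \<in> carrier L \<rightarrow>\<^sub>E carrier X" using qX by (auto simp: q_def)
  next
    fix y z assume y: "y \<in> carrier L" and z: "z \<in> carrier L"
    show "q (y \<oplus>\<^bsub>L\<^esub> z) = q y \<oplus>\<^bsub>X\<^esub> q z"
    proof (rule q_unique[OF L.M.a_closed[OF y z] X.M.a_closed[OF qX[OF y] qX[OF z]]])
      fix f assume f: "f \<in> carrier (dual X)"
      note fD = linear_mapsD[OF dual_linear[OF f]]
      have "((\<lambda>i. f (Q i (y i)) + f (Q i (z i))) \<longlongrightarrow> f (q y) + f (q z)) U"
        by (rule tendsto_add[OF qlim[OF y f] qlim[OF z f]])
      then have "((\<lambda>i. f (Q i ((y \<oplus>\<^bsub>L\<^esub> z) i))) \<longlongrightarrow> f (q y) + f (q z)) U"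
        by (rule ev_cong) (simp add: L_def QD C(2)[OF y] C(2)[OF z] fD)
      then show "((\<lambda>i. f (Q i ((y \<oplus>\<^bsub>L\<^esub> z) i))) \<longlongrightarrow> f (q y \<oplus>\<^bsub>X\<^esub> q z)) U"
        by (simp add: fD qX y z)
    qed
  next
    fix c z assume z: "z \<in> carrier L"
    show "q (c \<odot>\<^bsub>L\<^esub> z) = c \<odot>\<^bsub>X\<^esub> q z"
    proof (rule q_unique[OF L.sm_closed[OF z] X.sm_closed[OF qX[OF z]]])
      fix f assume f: "f \<in> carrier (dual X)"
      note fD = linear_mapsD[OF dual_linear[OF f]]
      have "((\<lambda>i. c * f (Q i (z i))) \<longlongrightarrow> c * f (q z)) U"
        by (rule tendsto_mult[OF tendsto_const qlim[OF z f]])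
      then have "((\<lambda>i. f (Q i ((c \<odot>\<^bsub>L\<^esub> z) i))) \<longlongrightarrow> c * f (q z)) U"
        by (rule ev_cong) (simp add: L_def QD C(2)[OF z] fD)
      then show "((\<lambda>i. f (Q i ((c \<odot>\<^bsub>L\<^esub> z) i))) \<longlongrightarrow> f (c \<odot>\<^bsub>X\<^esub> q z)) U"
        by (simp add: fD qX z)
    qed
  qed
  have qN: "q h = \<zero>\<^bsub>X\<^esub>" if h: "h \<in> N" for h
  proof (rule q_unique)
    show hL: "h \<in> carrier L" using h ND by blast
    fix f assume f: "f \<in> carrier (dual X)"
    have "((\<lambda>i. f (Q i (h i))) \<longlongrightarrow> 0) U"
    proof (rule tendsto_0_le)
      show "((\<lambda>i. vnorm (Z i) (h i)) \<longlongrightarrow> 0) U" using h ND by blast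
      show "\<forall>\<^sub>F i in U. norm (f (Q i (h i))) \<le> norm (vnorm (Z i) (h i)) * vnorm (dual X) f"
        using evI
      proof eventually_elim
        case (elim i)
        have "norm (f (Q i (h i))) \<le> vnorm (dual X) f * vnorm X (Q i (h i))"
          by (rule dual_bound(1)[OF X f QD(1)[OF elim C(2)[OF hL elim]]])
        also have "\<dots> \<le> vnorm (dual X) f * vnorm (Z i) (h i)"
          by (rule mult_left_mono[OF Q(2)[OF elim C(2)[OF hL elim]] dual_bound(2)[OF X f]])
        also have "\<dots> \<le> vnorm (dual X) f * norm (vnorm (Z i) (h i))"
          by (rule mult_left_mono[OF _ dual_bound(2)[OF X f]]) simp
        finally show ?case by (simp add: mult.commute)
      qed
    qed
    moreover have "f \<zero>\<^bsub>X\<^esub> = 0"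
      using linear_mapsD(3)[OF dual_linear[OF f], of "\<zero>\<^bsub>X\<^esub>" 0] by simp
    ultimately show "((\<lambda>i. f (Q i (h i))) \<longlongrightarrow> f \<zero>\<^bsub>X\<^esub>) U" by simp
  qed simp
  have qnorm: "vnorm X (q z) \<le> vnorm L z" if z: "z \<in> carrier L" for z
  proof -
    obtain f where f: "f \<in> carrier (dual X)" "\<And>y. y \<in> carrier X \<Longrightarrow> norm (f y) \<le> vnorm X y"
      "vnorm X (q z) \<le> norm (f (q z))"
      using X.norming_functional[OF qX[OF z]] by blast
    have "norm (f (q z)) \<le> vnorm L z"
    proof (rule tendsto_upperbound[OF tendsto_norm[OF qlim[OF z f(1)]] _ bot])
      show "\<forall>\<^sub>F i in U. norm (f (Q i (z i))) \<le> vnorm L z"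
        using evI
      proof eventually_elim
        case (elim i)
        show ?case
          using f(2)[OF QD(1)[OF elim C(2)[OF z elim]]] Q(2)[OF elim C(2)[OF z elim]] C(3)[OF z elim] by linarith
      qed
    qed
    then show ?thesis using f(3) by simp
  qed
  obtain Q' where Q': "Q' \<in> linear_maps (quotient_space L N) X" "\<And>z. z \<in> carrier L \<Longrightarrow> Q' (N +>\<^bsub>L\<^esub> z) = q z"
    "\<And>A. A \<in> a_rcosets\<^bsub>L\<^esub> N \<Longrightarrow> vnorm X (Q' A) \<le> vnorm (quotient_space L N) A"
    using quotient_lift[OF qlin qN X qnorm] by blast
  define J' where "J' = (\<lambda>x\<in>carrier X. N +>\<^bsub>L\<^esub> j x)"
  define V' where "V' s = (\<lambda>A\<in>a_rcosets\<^bsub>L\<^esub> N. v s ` A)" for s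
  have ultra_eq: "ultraproduct I U Z = quotient_space L N"
    by (simp add: ultraproduct_def L_def N_def)
  have "dilation_frame X (ultraproduct I U Z) \<S> J' Q' V'"
    unfolding ultra_eq
  proof (rule dilation_frameI)
    show "J' \<in> linear_maps X (quotient_space L N)"
      unfolding J'_def by (rule quotient_map(1)[OF X jlin jnorm nonneg])
    show "Q' \<in> linear_maps (quotient_space L N) X" by (rule Q'(1))
    show "vnorm (quotient_space L N) (J' x) \<le> vnorm X x" if "x \<in> carrier X" for x
      using quotient_map(2)[OF X jlin jnorm nonneg that] that by (simp add: J'_def)
    show "vnorm X (Q' A) \<le> vnorm (quotient_space L N) A" if "A \<in> carrier (quotient_space L N)" for A
      using Q'(3) that by simp
    show "V' s \<in> isometric_isos (quotient_space L N) (quotient_space L N)" if "s \<in> \<S>" for s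
      unfolding V'_def by (rule quotient_isometry(1)[OF viso[OF that] vN[OF that]])
  qed
  moreover have "Q' (word V' ss (J' x)) = W ss x" if ss: "set ss \<subseteq> \<S>" and x: "x \<in> carrier X" for ss x
  proof -
    have wL: "word v ts (j x) \<in> carrier L" if "set ts \<subseteq> \<S>" for ts
      using that isometric_isosD(1)[OF viso] jL[OF x] by (intro word_closed) auto
    have coset: "word V' ts (J' x) = N +>\<^bsub>L\<^esub> word v ts (j x)" if "set ts \<subseteq> \<S>" for ts
      using that
    proof (induction ts)
      case Nil then show ?case using x by (simp add: J'_def)
    next
      case (Cons s ts)
      have s: "s \<in> \<S>" and ts: "set ts \<subseteq> \<S>" using Cons.prems by auto
      have app: "V' s (N +>\<^bsub>L\<^esub> z) = N +>\<^bsub>L\<^esub> v s z" if z: "z \<in> carrier L" for z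
        using quotient_isometry(2)[OF viso[OF s] vN[OF s] z] coset_in_quotient[OF z] by (simp add: V'_def)
      show ?case by (simp only: list.map word_Cons Cons.IH[OF ts] app[OF wL[OF ts]])
    qed
    have coord: "word v ts (j x) i = word (V i) ts (J i x)"
      if "set ts \<subseteq> \<S>" "i \<in> I" for ts i
      using that
    proof (induction ts)
      case Nil then show ?case using x by (simp add: j_def)
    next
      case (Cons s ts)
      have ts: "set ts \<subseteq> \<S>" using Cons.prems by auto
      show ?case by (simp only: list.map word_Cons vi[OF wL[OF ts] Cons.prems(2)] Cons.IH[OF ts Cons.prems(2)])
    qed
    let ?w = "word v ss (j x)"
    have "q ?w = W ss x"
    proof (rule q_unique[OF wL[OF ss] W[OF ss x]])
      fix f assume f: "f \<in> carrier (dual X)"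
      have "((\<lambda>i. f (Q i (?w i)) - f (W ss x)) \<longlongrightarrow> 0) U"
      proof (rule tendsto_0_le[OF lim[OF ss x]])
        show "\<forall>\<^sub>F i in U. norm (f (Q i (?w i)) - f (W ss x))
          \<le> norm (vnorm X (Q i (word (V i) ss (J i x)) \<ominus>\<^bsub>X\<^esub> W ss x)) * vnorm (dual X) f"
          using evI
        proof eventually_elim
          case (elim i)
          have QX: "Q i (?w i) \<in> carrier X" by (rule QD(1)[OF elim C(2)[OF wL[OF ss] elim]])
          have "norm (f (Q i (?w i)) - f (W ss x)) = norm (f (Q i (?w i) \<ominus>\<^bsub>X\<^esub> W ss x))"
            by (simp only: dual_minus[OF X f QX W[OF ss x]])
          also have "\<dots> \<le> vnorm (dual X) f * vnorm X (Q i (?w i) \<ominus>\<^bsub>X\<^esub> W ss x)"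
            by (rule dual_bound(1)[OF X f X.M.minus_closed[OF QX W[OF ss x]]])
          also have "\<dots> \<le> norm (vnorm X (Q i (?w i) \<ominus>\<^bsub>X\<^esub> W ss x)) * vnorm (dual X) f"
            using dual_bound(2)[OF X f] by (simp add: mult.commute mult_left_mono)
          finally show ?case unfolding coord[OF ss elim] .
        qed
      qed
      then show "((\<lambda>i. f (Q i (?w i))) \<longlongrightarrow> f (W ss x)) U" by (simp only: LIM_zero_iff)
    qed
    then show ?thesis unfolding coset[OF ss] Q'(2)[OF wL[OF ss]] .
  qed
  ultimately show ?thesis by (rule that)
qed

text \<open>Letter by letter: \<open>A w' - S w = A (w' - w) + (A w - S w)\<close>, where the first term is controlled because \<open>A\<close> is a
contraction and the second by strong convergence at the fixed vector \<open>w\<close>.\<close>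

lemma word_strong_convergence:
  fixes X :: "('k::real_or_complex, 'a) normed_module"
  assumes X: "normed_space X" and A: "\<And>s d. s \<in> \<S> \<Longrightarrow> A d s \<in> contractions X X"
    and S: "\<And>s. s \<in> \<S> \<Longrightarrow> s \<in> linear_maps X X"
    and lim: "\<And>s y. s \<in> \<S> \<Longrightarrow> y \<in> carrier X \<Longrightarrow> ((\<lambda>d. vnorm X (A d s y \<ominus>\<^bsub>X\<^esub> s y)) \<longlongrightarrow> 0) F"
    and ss: "set ss \<subseteq> \<S>" and x: "x \<in> carrier X"
  shows "((\<lambda>d. vnorm X (word (A d) ss x \<ominus>\<^bsub>X\<^esub> foldr (\<circ>) ss id x)) \<longlongrightarrow> 0) F"
  using ss
proof (induction ss)
  case Nil
  interpret nspace X using X by (rule nspace.intro)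
  have "x \<ominus>\<^bsub>X\<^esub> x = \<zero>\<^bsub>X\<^esub>" using x by (simp add: a_minus_def M.r_neg)
  then show ?case by simp
next
  case (Cons s ss)
  interpret nspace X using X by (rule nspace.intro)
  have s: "s \<in> \<S>" and sub: "set ss \<subseteq> \<S>" using Cons.prems by auto
  have Al: "A d t \<in> linear_maps X X" "\<And>y. y \<in> carrier X \<Longrightarrow> vnorm X (A d t y) \<le> vnorm X y" if "t \<in> \<S>" for d t
    using A[OF that] contractions_iff[OF X X] by auto
  let ?w = "foldr (\<circ>) ss id x"
  have "word (\<lambda>s. s) ss x \<in> carrier X"
    using S sub x by (intro word_closed) auto
  then have w: "?w \<in> carrier X" by simp
  have wd: "word (A d) ss x \<in> carrier X" for d
    using Al(1) sub x by (intro word_closed) auto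
  show ?case
  proof (rule tendsto_sandwich)
    show "((\<lambda>_. 0) \<longlongrightarrow> (0::real)) F" by (rule tendsto_const)
    show "((\<lambda>d. vnorm X (word (A d) ss x \<ominus>\<^bsub>X\<^esub> ?w) + vnorm X (A d s ?w \<ominus>\<^bsub>X\<^esub> s ?w)) \<longlongrightarrow> 0) F"
      using tendsto_add[OF Cons.IH[OF sub] lim[OF s w]] by (simp only: add_0_left)
    have sw: "s ?w \<in> carrier X" by (rule linear_mapsD(1)[OF S[OF s] w])
    have le: "vnorm X (A d s (word (A d) ss x) \<ominus>\<^bsub>X\<^esub> s ?w)
        \<le> vnorm X (word (A d) ss x \<ominus>\<^bsub>X\<^esub> ?w) + vnorm X (A d s ?w \<ominus>\<^bsub>X\<^esub> s ?w)" for d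
    proof -
      note AD = linear_mapsD(1)[OF Al(1)[OF s, of d]]
      have "vnorm X (A d s (word (A d) ss x) \<ominus>\<^bsub>X\<^esub> A d s ?w)
          \<le> vnorm X (word (A d) ss x \<ominus>\<^bsub>X\<^esub> ?w)"
        using Al(2)[OF s M.minus_closed[OF wd w], of d d]
        unfolding linear_maps_minus[OF vec_space_axioms vec_space_axioms Al(1)[OF s] wd w] .
      then show ?thesis
        using norm_minus_triangle[OF AD[OF wd[of d]] AD[OF w] sw] by linarith
    qed
    show "\<forall>\<^sub>F d in F. 0 \<le> vnorm X (word (A d) (s # ss) x \<ominus>\<^bsub>X\<^esub> foldr (\<circ>) (s # ss) id x)"
      unfolding list.map word_Cons
      by (intro always_eventually allI norm_nonneg M.minus_closed linear_mapsD(1)[OF Al(1)[OF s] wd] sw)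
    show "\<forall>\<^sub>F d in F. vnorm X (word (A d) (s # ss) x \<ominus>\<^bsub>X\<^esub> foldr (\<circ>) (s # ss) id x)
      \<le> vnorm X (word (A d) ss x \<ominus>\<^bsub>X\<^esub> ?w) + vnorm X (A d s ?w \<ominus>\<^bsub>X\<^esub> s ?w)"
      unfolding list.map word_Cons by (intro always_eventually allI le)
  qed
qed

section \<open>The closed convex hull\<close>

text \<open>The hull is an intersection of convex sets. The family of these sets is nonempty, as it contains the
set of all bounded operators; the empty intersection would not consist of bounded operators.\<close>

lemma convex_in_conv:
  assumes X: "normed_space X" and \<T>: "\<T> \<subseteq> carrier (bounded_ops X X)"
  shows "convex_in (bounded_ops X X) (conv (bounded_ops X X) \<T>)"
proof -
  let ?B = "bounded_ops X X"
  let ?\<C> = "{C. convex_in ?B C \<and> \<T> \<subseteq> C}"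
  have "carrier ?B \<in> ?\<C>"
    using \<T> bounded_ops_combination[OF X] by (auto simp: convex_in_def simp del: bounded_ops_simps)
  moreover have "of_real u \<odot>\<^bsub>?B\<^esub> S \<oplus>\<^bsub>?B\<^esub> of_real v \<odot>\<^bsub>?B\<^esub> T \<in> \<Inter>?\<C>"
    if "S \<in> \<Inter>?\<C>" "T \<in> \<Inter>?\<C>" "0 \<le> u" "0 \<le> v" "u + v = 1" for S T u v
  proof (rule InterI)
    fix C assume C: "C \<in> ?\<C>"
    then have "S \<in> C" "T \<in> C" using that(1,2) by blast+
    then show "of_real u \<odot>\<^bsub>?B\<^esub> S \<oplus>\<^bsub>?B\<^esub> of_real v \<odot>\<^bsub>?B\<^esub> T \<in> C"
      using C that(3-5) by (simp add: convex_in_def del: bounded_ops_simps)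
  qed
  ultimately have "convex_in ?B (\<Inter>?\<C>)"
    by (simp add: convex_in_def Inter_lower del: bounded_ops_simps Inter_iff)
  then show ?thesis by (simp add: conv_def hull_def)
qed

lemma wot_closure_conv_means_approx:
  fixes X :: "('k::real_or_complex, 'a) normed_module" (structure)
  assumes X: "normed_space X" and \<T>: "\<T> \<subseteq> contractions X X"
    and S: "S \<in> weak_operator_topology X closure_of conv (bounded_ops X X) \<T>"
    and F: "finite F" "F \<subseteq> carrier X"
  shows "\<forall>\<^sub>F n in sequentially. \<exists>\<tau>. (\<forall>k<n. \<tau> k \<in> \<T>) \<and> (\<forall>x\<in>F. vnorm X (mean_op X \<tau> n x \<ominus> S x) < 1)"
proof -
  interpret nspace X using X by (rule nspace.intro)
  have \<T>B: "\<T> \<subseteq> carrier (bounded_ops X X)" using \<T> by (auto simp: contractions_def)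
  note cv = convex_in_conv[OF X \<T>B]
  obtain T where T: "T \<in> conv (bounded_ops X X) \<T>" and d: "(\<Sum>x\<in>F. vnorm X (T x \<ominus> S x)) < 1"
    using wot_closure_convex_strong_approx[OF X cv S F] by blast
  have SB: "S \<in> carrier (bounded_ops X X)"
    using S topspace_weak_operator_topology[of X] by (auto simp: closure_of_def)
  have TB: "T \<in> carrier (bounded_ops X X)" using cv T by (auto simp: convex_in_def)
  have ST: "S x \<in> carrier X" "T x \<in> carrier X" if "x \<in> F" for x
    using that SB TB F(2) by (auto simp: bounded_ops_def linear_maps_def)
  define \<epsilon> where "\<epsilon> = 1 - (\<Sum>x\<in>F. vnorm X (T x \<ominus> S x))"
  have "\<epsilon> > 0" using d by (simp add: \<epsilon>_def)
  from conv_strong_limit_of_means[OF X \<T> T, unfolded strong_limit_of_means_def, rule_format, OF F this]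
  show ?thesis
  proof eventually_elim
    case (elim n)
    then obtain \<tau> where \<tau>: "\<forall>k<n. \<tau> k \<in> \<T>" "\<And>x. x \<in> F \<Longrightarrow> vnorm X (mean_op X \<tau> n x \<ominus> T x) < \<epsilon>" by blast
    have "vnorm X (mean_op X \<tau> n x \<ominus> S x) < 1" if x: "x \<in> F" for x
    proof -
      have "mean_op X \<tau> n \<in> contractions X X" using \<tau>(1) \<T> by (intro mean_op_contraction[OF X]) auto
      then have "mean_op X \<tau> n \<in> linear_maps X X" using contractions_iff[OF X X] by blast
      from linear_mapsD(1)[OF this] have m: "mean_op X \<tau> n x \<in> carrier X" using x F(2) by blast
      have "vnorm X (T x \<ominus> S x) \<le> (\<Sum>x\<in>F. vnorm X (T x \<ominus> S x))"
        by (rule member_le_sum[OF x _ F(1)]) (simp add: ST)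
      then show ?thesis
        using norm_minus_triangle[OF m ST(2)[OF x] ST(1)[OF x]] \<tau>(2)[OF x] unfolding \<epsilon>_def by linarith
    qed
    then show ?case using \<tau>(1) by (intro exI[of _ \<tau>]) simp
  qed
qed

text \<open>The multiples of a nonzero vector by natural numbers are distinct. Being infinite is what makes room in
\<open>X\<close> for the index set of the ultraproduct.\<close>

lemma infinite_carrier:
  assumes X: "vec_space X" and x: "x \<in> carrier X" "x \<noteq> \<zero>\<^bsub>X\<^esub>"
  shows "infinite (carrier X)"
proof -
  interpret vec_space X by fact
  have "inj (\<lambda>n. of_nat n \<odot>\<^bsub>X\<^esub> x)"
  proof (rule injI, rule ccontr)
    fix m n :: nat assume eq: "of_nat m \<odot>\<^bsub>X\<^esub> x = of_nat n \<odot>\<^bsub>X\<^esub> x" and "m \<noteq> n"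
    let ?c = "of_nat m - of_nat n"
    have "?c \<odot>\<^bsub>X\<^esub> x = of_nat m \<odot>\<^bsub>X\<^esub> x \<oplus>\<^bsub>X\<^esub> (- of_nat n) \<odot>\<^bsub>X\<^esub> x"
      using sm_add_left[OF x(1), of "of_nat m" "- of_nat n"] by simp
    also have "\<dots> = of_nat n \<odot>\<^bsub>X\<^esub> x \<oplus>\<^bsub>X\<^esub> (- of_nat n) \<odot>\<^bsub>X\<^esub> x" by (simp only: eq)
    also have "\<dots> = \<zero>\<^bsub>X\<^esub>" using sm_add_left[OF x(1), of "of_nat n" "- of_nat n"] x(1) by simp
    finally have "inverse ?c \<odot>\<^bsub>X\<^esub> (?c \<odot>\<^bsub>X\<^esub> x) = \<zero>\<^bsub>X\<^esub>" by simp
    then show False using x \<open>m \<noteq> n\<close> by (simp add: sm_assoc)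
  qed
  then have "infinite (range (\<lambda>n. of_nat n \<odot>\<^bsub>X\<^esub> x))" by (rule range_inj_infinite)
  moreover have "range (\<lambda>n. of_nat n \<odot>\<^bsub>X\<^esub> x) \<subseteq> carrier X" using x(1) by auto
  ultimately show ?thesis by (rule infinite_super[rotated])
qed

lemma inj_finite_subsets_times_nat:
  assumes "infinite A"
  shows "\<exists>e :: 'a set \<times> nat \<Rightarrow> 'a. inj_on e (Fpow A \<times> UNIV) \<and> e ` (Fpow A \<times> UNIV) \<subseteq> A"
proof -
  have "|Fpow A| \<le>o |A|"
    using eqpoll_Fpow[OF assms] by (simp add: eqpoll_iff_card_of_ordIso ordIso_imp_ordLeq)
  moreover have "|UNIV :: nat set| \<le>o |A|" using assms by (simp add: infinite_iff_card_of_nat)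
  ultimately have "|Fpow A \<times> (UNIV :: nat set)| \<le>o |A|"
    using assms by (intro card_of_Times_ordLeq_infinite)
  then show ?thesis by (simp add: card_of_ordLeq)
qed

text \<open>A property holds along this filter if for all sufficiently large finite \<open>F \<subseteq> A\<close> it holds for all sufficiently large
\<open>n\<close>, where the bound on \<open>n\<close> may depend on \<open>F\<close>. For a limit in the product order the bound would have to be
independent of \<open>F\<close>.\<close>

definition iterated_limit :: "'a set \<Rightarrow> ('a set \<times> nat) filter" where
  "iterated_limit A = Abs_filter (\<lambda>P.
     \<forall>\<^sub>F F in finite_subsets_at_top A. \<forall>\<^sub>F n in sequentially. P (F, n))"

lemma eventually_iterated_limit:
  "eventually P (iterated_limit A) \<longleftrightarrow>
     (\<forall>\<^sub>F F in finite_subsets_at_top A. \<forall>\<^sub>F n in sequentially. P (F, n))"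
  unfolding iterated_limit_def
proof (rule eventually_Abs_filter, rule is_filter.intro)
  fix P Q :: "'a set \<times> nat \<Rightarrow> bool"
  assume P: "\<forall>\<^sub>F F in finite_subsets_at_top A. \<forall>\<^sub>F n in sequentially. P (F, n)"
    and Q: "\<forall>\<^sub>F F in finite_subsets_at_top A. \<forall>\<^sub>F n in sequentially. Q (F, n)"
  from P Q show "\<forall>\<^sub>F F in finite_subsets_at_top A. \<forall>\<^sub>F n in sequentially. P (F, n) \<and> Q (F, n)"
    by eventually_elim (rule eventually_conj)
next
  fix P Q :: "'a set \<times> nat \<Rightarrow> bool"
  assume PQ: "\<forall>x. P x \<longrightarrow> Q x"
    and P: "\<forall>\<^sub>F F in finite_subsets_at_top A. \<forall>\<^sub>F n in sequentially. P (F, n)"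
  from P show "\<forall>\<^sub>F F in finite_subsets_at_top A. \<forall>\<^sub>F n in sequentially. Q (F, n)"
    by eventually_elim (erule eventually_mono, simp add: PQ)
qed simp

lemma iterated_limit_neq_bot: "iterated_limit A \<noteq> bot"
proof
  assume "iterated_limit A = bot"
  then have "eventually (\<lambda>_. False) (iterated_limit A)" by simp
  then show False by (simp add: eventually_iterated_limit)
qed

text \<open>Accuracy 1 on \<open>F\<close> is enough: once \<open>F\<close> contains \<open>y / \<epsilon>\<close>, it means accuracy \<open>\<epsilon>\<close> at \<open>y\<close>.\<close>

lemma iterated_limit_strong_convergence:
  assumes X: "normed_space X" and y: "y \<in> carrier X"
    and A: "\<And>F n. A (F, n) \<in> linear_maps X X" and S: "S \<in> linear_maps X X"
    and approx: "\<And>F. finite F \<Longrightarrow> F \<subseteq> carrier X \<Longrightarrow>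
      \<forall>\<^sub>F n in sequentially. \<forall>x\<in>F. vnorm X (A (F, n) x \<ominus>\<^bsub>X\<^esub> S x) < 1"
  shows "((\<lambda>d. vnorm X (A d y \<ominus>\<^bsub>X\<^esub> S y)) \<longlongrightarrow> 0) (iterated_limit (carrier X))"
proof (rule tendstoI)
  interpret nspace X using X by (rule nspace.intro)
  fix \<epsilon> :: real assume \<epsilon>: "\<epsilon> > 0"
  let ?c = "of_real (1 / \<epsilon>)"
  have cy: "?c \<odot>\<^bsub>X\<^esub> y \<in> carrier X" using y by simp
  have "\<forall>\<^sub>F F in finite_subsets_at_top (carrier X). finite F \<and> F \<subseteq> carrier X \<and> ?c \<odot>\<^bsub>X\<^esub> y \<in> F"
    unfolding eventually_finite_subsets_at_top using cy by (intro exI[of _ "{?c \<odot>\<^bsub>X\<^esub> y}"]) auto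
  then show "\<forall>\<^sub>F d in iterated_limit (carrier X). dist (vnorm X (A d y \<ominus>\<^bsub>X\<^esub> S y)) 0 < \<epsilon>"
    unfolding eventually_iterated_limit
  proof eventually_elim
    case (elim F)
    then have "\<forall>\<^sub>F n in sequentially. \<forall>x\<in>F. vnorm X (A (F, n) x \<ominus>\<^bsub>X\<^esub> S x) < 1"
      by (intro approx) auto
    then show ?case
    proof eventually_elim
      case (elim n)
      have c: "A (F, n) y \<in> carrier X" "S y \<in> carrier X" using y linear_mapsD(1)[OF A] linear_mapsD(1)[OF S] by auto
      have "vnorm X (A (F, n) (?c \<odot>\<^bsub>X\<^esub> y) \<ominus>\<^bsub>X\<^esub> S (?c \<odot>\<^bsub>X\<^esub> y)) < 1"
        using elim \<open>finite F \<and> F \<subseteq> carrier X \<and> ?c \<odot>\<^bsub>X\<^esub> y \<in> F\<close> by blast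
      also have "A (F, n) (?c \<odot>\<^bsub>X\<^esub> y) \<ominus>\<^bsub>X\<^esub> S (?c \<odot>\<^bsub>X\<^esub> y) = ?c \<odot>\<^bsub>X\<^esub> (A (F, n) y \<ominus>\<^bsub>X\<^esub> S y)"
        using c unfolding linear_mapsD(3)[OF A y] linear_mapsD(3)[OF S y]
        by (simp add: minus_eq_sm sm_add_right sm_assoc)
      finally have "(1 / \<epsilon>) * vnorm X (A (F, n) y \<ominus>\<^bsub>X\<^esub> S y) < 1"
        using c \<epsilon> by (simp add: norm_sm norm_divide)
      then show ?case using \<epsilon> c by (simp add: field_simps)
    qed
  qed
qed

lemma simultaneous_dilationI:
  assumes "Y \<in> \<X>" "J \<in> contractions X Y" "Q \<in> contractions Y X" "\<And>T. T \<in> \<T> \<Longrightarrow> U T \<in> isometric_isos Y Y"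
    "\<And>Ts x. set Ts \<subseteq> \<T> \<Longrightarrow> x \<in> carrier X \<Longrightarrow> foldr (\<circ>) Ts id x = Q (word U Ts (J x))"
  shows "simultaneous_dilation \<X> X \<T>"
  unfolding simultaneous_dilation_def
  by (intro bexI[of _ Y] bexI[of _ J] bexI[of _ Q] exI[of _ U] conjI ballI allI impI assms)

text \<open>The zero space has to be treated separately, since its finite carrier is too small for the index set.\<close>

lemma simultaneous_dilation_trivial_space:
  assumes X: "normed_space X" "X \<in> \<X>" and zero: "carrier X = {\<zero>\<^bsub>X\<^esub>}" and \<S>: "\<S> \<subseteq> linear_maps X X"
  shows "simultaneous_dilation \<X> X \<S>"
proof -
  interpret nspace X using X(1) by (rule nspace.intro)
  let ?id = "\<lambda>x\<in>carrier X. x"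
  have lin: "?id \<in> linear_maps X X" by (auto simp: linear_maps_def)
  then have con: "?id \<in> contractions X X" by (simp add: contractions_iff[OF X(1) X(1)])
  have iso: "?id \<in> isometric_isos X X"
    by (rule isometric_isosI[OF lin]) (simp_all add: zero bij_betw_def)
  show ?thesis
  proof (rule simultaneous_dilationI[OF X(2) con con iso])
    fix Ts x assume Ts: "set Ts \<subseteq> \<S>" and x: "x \<in> carrier X"
    have "word (\<lambda>T. T) Ts x \<in> carrier X"
      using Ts \<S> x by (intro word_closed) auto
    then have "foldr (\<circ>) Ts id x = \<zero>\<^bsub>X\<^esub>" using zero by simp
    moreover have id: "?id y = \<zero>\<^bsub>X\<^esub>" if "y \<in> carrier X" for y using that zero by simp
    have "word (\<lambda>_. ?id) Ts (?id x) \<in> carrier X"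
      using x by (intro word_closed[OF lin]) simp
    ultimately show "foldr (\<circ>) Ts id x = ?id (word (\<lambda>_. ?id) Ts (?id x))"
      by (simp only: id)
  qed
qed

theorem theorem2p9:
  fixes p :: real
    and \<X> :: "('k::real_or_complex, 'u) normed_module set"
    and X :: "('k, 'u) normed_module"
    and \<T> :: "('u \<Rightarrow> 'u) set"
  assumes "1 < p"
    and "\<forall>Z\<in>\<X>. banach_space Z"
    and "assumptions_A p (carrier X) \<X>"
    and "X \<in> \<X>"
    and "\<T> \<subseteq> carrier (bounded_ops X X)"
    and "simultaneous_dilation \<X> X \<T>"
  shows "simultaneous_dilation \<X> X
    (weak_operator_topology X closure_of conv (bounded_ops X X) \<T>)"
proof -
  let ?\<S> = "weak_operator_topology X closure_of conv (bounded_ops X X) \<T>"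
  have ns: "normed_space Z" if "Z \<in> \<X>" for Z using assms(2) that by (auto simp: banach_space_def)
  have X: "normed_space X" by (rule ns[OF assms(4)])
  interpret nspace X using X by (rule nspace.intro)
  have \<S>B: "?\<S> \<subseteq> carrier (bounded_ops X X)"
    using topspace_weak_operator_topology[of X] by (auto simp: closure_of_def)
  have \<S>lin: "?\<S> \<subseteq> linear_maps X X" using \<S>B by (auto simp: bounded_ops_def)
  show ?thesis
  proof (cases "carrier X = {\<zero>\<^bsub>X\<^esub>} \<or> \<T> = {}")
    case True
    then show ?thesis
    proof
      assume "carrier X = {\<zero>\<^bsub>X\<^esub>}"
      then show ?thesis by (rule simultaneous_dilation_trivial_space[OF X assms(4) _ \<S>lin])
    next
      assume "\<T> = {}"
      moreover have "convex_in (bounded_ops X X) hull {} = {}"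
        by (rule hull_same) (simp add: convex_in_def)
      ultimately show ?thesis using assms(6) by (simp add: conv_def)
    qed
  next
    case False
    then obtain T0 where T0: "T0 \<in> \<T>" by blast
    obtain x0 where "x0 \<in> carrier X" "x0 \<noteq> \<zero>\<^bsub>X\<^esub>" using False M.zero_closed by blast
    then have inf: "infinite (carrier X)" by (rule infinite_carrier[OF vec_space_axioms])
    obtain Y J Q U where Y: "Y \<in> \<X>" and J: "J \<in> contractions X Y" and Q: "Q \<in> contractions Y X"
      and U: "\<forall>T\<in>\<T>. U T \<in> isometric_isos Y Y"
      and dil: "\<forall>Ts. set Ts \<subseteq> \<T> \<longrightarrow>
        (\<forall>x\<in>carrier X. foldr (\<circ>) Ts id x = Q (word U Ts (J x)))"
      using assms(6) unfolding simultaneous_dilation_def by (elim bexE exE conjE)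
    note U = U[rule_format] and dil = dil[rule_format]
    note nsY = ns[OF Y]
    interpret Y: nspace Y using nsY by (rule nspace.intro)
    have J': "J \<in> linear_maps X Y" "\<And>x. x \<in> carrier X \<Longrightarrow> vnorm Y (J x) \<le> vnorm X x"
      using J contractions_iff[OF X nsY] by auto
    have Q': "Q \<in> linear_maps Y X" "\<And>y. y \<in> carrier Y \<Longrightarrow> vnorm X (Q y) \<le> vnorm Y y"
      using Q contractions_iff[OF nsY X] by auto
    have frame: "dilation_frame X Y \<T> J Q U" using J'(1) Q'(1) J'(2) Q'(2) U by (rule dilation_frameI)
    have \<T>con: "\<T> \<subseteq> contractions X X"
    proof
      fix T assume T: "T \<in> \<T>"
      have "T \<in> linear_maps X X" using assms(5) T by (auto simp: bounded_ops_def)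
      moreover have "vnorm X (T x) \<le> vnorm X x" if x: "x \<in> carrier X" for x
      proof -
        have Jx: "J x \<in> carrier Y" by (rule linear_mapsD(1)[OF J'(1) x])
        have UJ: "U T (J x) \<in> carrier Y" by (rule linear_mapsD(1)[OF isometric_isosD(1)[OF U[OF T]] Jx])
        have "T x = Q (U T (J x))" using dil[of "[T]" x] T x by simp
        then show ?thesis
          using Q'(2)[OF UJ] isometric_isosD(3)[OF U[OF T] Jx] J'(2)[OF x] by simp
      qed
      ultimately show "T \<in> contractions X X" by (simp add: contractions_iff[OF X X])
    qed
    define good where "good F n S \<tau> \<longleftrightarrow> (\<forall>k<n. \<tau> k \<in> \<T>) \<and> (\<forall>x\<in>F. vnorm X (mean_op X \<tau> n x \<ominus>\<^bsub>X\<^esub> S x) < 1)"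
      for F n S and \<tau> :: "nat \<Rightarrow> 'u \<Rightarrow> 'u"
    \<comment> \<open>Where \<open>n\<close> terms are too few for \<open>S\<close> and \<open>F\<close>, any element of \<open>\<T>\<close> serves as a default.\<close>
    define \<tau> where "\<tau> F n S = (if \<exists>\<tau>. good F n S \<tau> then SOME \<tau>. good F n S \<tau> else (\<lambda>_. T0))" for F n S
    have \<tau>\<T>: "\<tau> F n S k \<in> \<T>" if "k < n" for F n S k
    proof (cases "\<exists>\<tau>. good F n S \<tau>")
      case True
      then have "good F n S (\<tau> F n S)" using someI_ex[OF True] by (simp add: \<tau>_def)
      then show ?thesis using that by (simp add: good_def)
    qed (simp add: \<tau>_def T0)
    have approx: "\<forall>\<^sub>F n in sequentially. \<forall>x\<in>F. vnorm X (mean_op X (\<tau> F (Suc n) S) (Suc n) x \<ominus>\<^bsub>X\<^esub> S x) < 1"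
      if S: "S \<in> ?\<S>" and F: "finite F" "F \<subseteq> carrier X" for S F
    proof -
      have "\<forall>\<^sub>F n in sequentially. \<exists>\<tau>. good F n S \<tau>"
        unfolding good_def by (rule wot_closure_conv_means_approx[OF X \<T>con S F])
      then have "\<forall>\<^sub>F n in sequentially. \<exists>\<tau>. good F (Suc n) S \<tau>"
        by (subst eventually_sequentially_Suc)
      then show ?thesis
      proof eventually_elim
        case (elim n)
        then have "good F (Suc n) S (\<tau> F (Suc n) S)" using someI_ex[OF elim] by (simp add: \<tau>_def)
        then show ?case by (simp add: good_def)
      qed
    qed
    define A where "A d S = mean_op X (\<tau> (fst d) (Suc (snd d)) S) (Suc (snd d))" for d S
    have Acon: "A d S \<in> contractions X X" for d S
      unfolding A_def using \<tau>\<T> \<T>con by (intro mean_op_contraction[OF X]) auto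
    have Alin: "A d S \<in> linear_maps X X" for d S using Acon contractions_iff[OF X X] by blast
    \<comment> \<open>At the index \<open>(F, n)\<close>, all operators of the closure are replaced by means of \<open>n + 1\<close> elements, and words of length up to \<open>n + 1\<close> are dilated.\<close>
    define P where "P d Z J Q V \<longleftrightarrow> Z \<in> \<X> \<and> dilation_frame X Z ?\<S> J Q V \<and>
      (\<forall>ss x. set ss \<subseteq> ?\<S> \<longrightarrow> length ss \<le> Suc (snd d) \<longrightarrow> x \<in> carrier X \<longrightarrow>
        Q (word V ss (J x)) = word (A d) ss x)"
      for d :: "'u set \<times> nat" and Z :: "('k, 'u) normed_module" and J Q and V :: "('u \<Rightarrow> 'u) \<Rightarrow> 'u \<Rightarrow> 'u"
    have "\<exists>Z J Q V. P d Z J Q V" for d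
    proof -
      let ?n = "snd d" and ?M = "Suc (snd d)"
      let ?L = "lp_power p (?M ^ Suc ?n) Y"
      have \<tau>S: "\<tau> (fst d) ?M S k \<in> \<T>" if "S \<in> ?\<S>" "k < ?M" for S k using \<tau>\<T> that(2) .
      obtain J1 Q1 V1 where 1: "dilation_frame X ?L ?\<S> J1 Q1 V1"
        "\<And>ss x. set ss \<subseteq> ?\<S> \<Longrightarrow> length ss \<le> Suc ?n \<Longrightarrow> x \<in> carrier X \<Longrightarrow>
          Q1 (word V1 ss (J1 x)) = word (\<lambda>s. mean_op X (\<tau> (fst d) ?M s) ?M) ss x"
        by (rule finite_dilation_of_means[where \<tau> = "\<tau> (fst d) ?M" and \<S> = ?\<S> and M = ?M and n = ?n,
            OF assms(1) X nsY zero_less_Suc frame \<T>con dil \<tau>S];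
          (assumption | rule that, assumption, simp only:))
      have "1 \<le> ?M ^ Suc ?n" by (rule one_le_power) simp
      then have "belongs_to ?L \<X>"
        by (rule assms(3)[unfolded assumptions_A_def, THEN conjunct1, rule_format, OF Y])
      then obtain Z \<phi> where Z: "Z \<in> \<X>" "\<phi> \<in> isometric_isos ?L Z" unfolding belongs_to_def by blast
      interpret Z: nspace Z using ns[OF Z(1)] by (rule nspace.intro)
      obtain J2 Q2 V2 where 2: "dilation_frame X Z ?\<S> J2 Q2 V2"
        "\<And>ss x. set ss \<subseteq> ?\<S> \<Longrightarrow> x \<in> carrier X \<Longrightarrow>
          Q2 (word V2 ss (J2 x)) = Q1 (word V1 ss (J1 x))"
        by (rule dilation_frame_transfer[OF vec_space_axioms Z(2) Z.vec_space_axioms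
          lp_power_closed[OF Y.vec_space_axioms] 1(1)];
          (assumption | rule that, assumption, simp only:))
      have "P d Z J2 Q2 V2"
        unfolding P_def A_def
      proof (intro conjI allI impI Z(1) 2(1))
        fix ss x assume ss: "set ss \<subseteq> ?\<S>" "length ss \<le> Suc ?n" and x: "x \<in> carrier X"
        show "Q2 (word V2 ss (J2 x)) = word (\<lambda>S. mean_op X (\<tau> (fst d) ?M S) ?M) ss x"
          unfolding 2(2)[OF ss(1) x] by (rule 1(2)[OF ss x])
      qed
      then show ?thesis by blast
    qed
    then obtain Zd Jd Qd Vd where Pd: "\<And>d. P d (Zd d) (Jd d) (Qd d) (Vd d)" by metis
    have Zd: "Zd d \<in> \<X>" and frame_d: "dilation_frame X (Zd d) ?\<S> (Jd d) (Qd d) (Vd d)" for d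
      using Pd[of d] by (simp_all add: P_def)
    have word_d: "Qd d (word (Vd d) ss (Jd d x)) = word (A d) ss x"
      if "set ss \<subseteq> ?\<S>" "length ss \<le> Suc (snd d)" "x \<in> carrier X" for d ss x
      using Pd[of d] that unfolding P_def by blast
    let ?G = "iterated_limit (carrier X)" and ?D = "Fpow (carrier X) \<times> (UNIV :: nat set)"
    \<comment> \<open>The pairs \<open>(F, n)\<close> are coded as vectors of \<open>X\<close>, so that the index set is a subset of the carrier.\<close>
    obtain e :: "'u set \<times> nat \<Rightarrow> 'u" where e: "inj_on e ?D" "e ` ?D \<subseteq> carrier X"
      using inj_finite_subsets_times_nat[OF inf] by blast
    define g where "g = inv_into ?D e"
    have ge: "g (e d) = d" if "d \<in> ?D" for d using e(1) that by (simp add: g_def)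
    have evD: "\<forall>\<^sub>F d in ?G. d \<in> ?D"
      unfolding eventually_iterated_limit eventually_finite_subsets_at_top by (auto simp: Fpow_def)
    let ?I = "e ` ?D"
    have "filtermap e ?G \<noteq> bot" using iterated_limit_neq_bot by (simp add: filtermap_bot_iff)
    then obtain \<U> where \<U>: "\<U> \<le> filtermap e ?G" "\<U> \<noteq> bot"
        "\<And>P. eventually P \<U> \<or> eventually (\<lambda>i. \<not> P i) \<U>"
      by (rule ultrafilter_below) (rule that, assumption, assumption, simp only:)
    have le_I: "filtermap e ?G \<le> principal ?I"
      unfolding le_principal eventually_filtermap using evD by eventually_elim (rule imageI)
    have ultra: "ultrafilter_on ?I \<U>"
      unfolding ultrafilter_on_def by (intro conjI allI \<U> order_trans[OF \<U>(1) le_I])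
    have I: "?I \<noteq> {}" by (auto simp: Fpow_def)
    define Z where "Z i = Zd (g i)" for i
    have lim: "((\<lambda>i. vnorm X (Qd (g i) (word (Vd (g i)) ss (Jd (g i) x)) \<ominus>\<^bsub>X\<^esub> foldr (\<circ>) ss id x)) \<longlongrightarrow> 0) \<U>"
      if ss: "set ss \<subseteq> ?\<S>" and x: "x \<in> carrier X" for ss x
    proof (rule tendsto_mono[OF \<U>(1)])
      have "((\<lambda>d. vnorm X (word (A d) ss x \<ominus>\<^bsub>X\<^esub> foldr (\<circ>) ss id x)) \<longlongrightarrow> 0) ?G"
      proof (rule word_strong_convergence[OF X _ _ _ ss x])
        show "A d S \<in> contractions X X" for d S by (rule Acon)
        show "S \<in> linear_maps X X" if "S \<in> ?\<S>" for S using \<S>lin that by blast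
        show "((\<lambda>d. vnorm X (A d S y \<ominus>\<^bsub>X\<^esub> S y)) \<longlongrightarrow> 0) ?G" if S: "S \<in> ?\<S>" and y: "y \<in> carrier X" for S y
        proof (rule iterated_limit_strong_convergence[OF X y, where A = "\<lambda>d. A d S"])
          show "S \<in> linear_maps X X" using \<S>lin S by blast
          show "\<forall>\<^sub>F n in sequentially. \<forall>x\<in>F. vnorm X (A (F, n) S x \<ominus>\<^bsub>X\<^esub> S x) < 1"
            if "finite F" "F \<subseteq> carrier X" for F
            unfolding A_def fst_conv snd_conv by (rule approx[OF S that])
        qed (rule Alin)
      qed
      moreover have "\<forall>\<^sub>F d in ?G. length ss \<le> Suc (snd d)"
        unfolding eventually_iterated_limit snd_conv
      proof (rule always_eventually, rule allI)
        show "\<forall>\<^sub>F n in sequentially. length ss \<le> Suc n"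
          using eventually_ge_at_top[of "length ss"] by eventually_elim simp
      qed
      then have "\<forall>\<^sub>F d in ?G. vnorm X (word (A d) ss x \<ominus>\<^bsub>X\<^esub> foldr (\<circ>) ss id x)
          = vnorm X (Qd (g (e d)) (word (Vd (g (e d))) ss (Jd (g (e d)) x)) \<ominus>\<^bsub>X\<^esub> foldr (\<circ>) ss id x)"
        using evD
      proof eventually_elim
        case (elim d)
        show ?case unfolding ge[OF elim(2)] word_d[OF ss elim(1) x] ..
      qed
      ultimately have "((\<lambda>d. vnorm X (Qd (g (e d)) (word (Vd (g (e d))) ss (Jd (g (e d)) x)) \<ominus>\<^bsub>X\<^esub> foldr (\<circ>) ss id x)) \<longlongrightarrow> 0) ?G"
        by (rule Lim_transform_eventually)
      then show "((\<lambda>i. vnorm X (Qd (g i) (word (Vd (g i)) ss (Jd (g i) x)) \<ominus>\<^bsub>X\<^esub> foldr (\<circ>) ss id x)) \<longlongrightarrow> 0) (filtermap e ?G)"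
        by (simp only: filterlim_filtermap)
    qed
    have W: "foldr (\<circ>) ss id x \<in> carrier X" if ss: "set ss \<subseteq> ?\<S>" and x: "x \<in> carrier X" for ss x
    proof -
      have "word (\<lambda>s. s) ss x \<in> carrier X" using ss \<S>lin x by (intro word_closed) auto
      then show ?thesis by simp
    qed
    have refl: "reflexive X"
      by (rule assms(3)[unfolded assumptions_A_def, THEN conjunct2, THEN conjunct2, rule_format, OF assms(4)])
    have nZ: "normed_space (Z i)" if "i \<in> ?I" for i unfolding Z_def by (rule ns[OF Zd])
    have frZ: "dilation_frame X (Z i) ?\<S> (Jd (g i)) (Qd (g i)) (Vd (g i))" if "i \<in> ?I" for i
      unfolding Z_def by (rule frame_d)
    obtain J3 Q3 V3 where 3: "dilation_frame X (ultraproduct ?I \<U> Z) ?\<S> J3 Q3 V3"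
      "\<And>ss x. set ss \<subseteq> ?\<S> \<Longrightarrow> x \<in> carrier X \<Longrightarrow> Q3 (word V3 ss (J3 x)) = foldr (\<circ>) ss id x"
        by (rule ultraproduct_dilation[OF X refl I ultra nZ frZ W lim];
          (assumption | rule that, assumption, simp only:))
    have "?I \<lesssim> carrier X" using e(2) by (rule subset_imp_lepoll)
    then have "?I \<noteq> {} \<and> ?I \<lesssim> carrier X \<and> (\<forall>i\<in>?I. Z i \<in> \<X>) \<and> ultrafilter_on ?I \<U>"
      using I ultra Zd by (simp add: Z_def)
    then have "belongs_to (ultraproduct ?I \<U> Z) \<X>"
      by (rule assms(3)[unfolded assumptions_A_def, THEN conjunct2, THEN conjunct1, THEN spec, THEN spec, THEN spec, THEN mp])
    then obtain Z' \<phi> where Z': "Z' \<in> \<X>" "\<phi> \<in> isometric_isos (ultraproduct ?I \<U> Z) Z'"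
      unfolding belongs_to_def by blast
    note nZ' = ns[OF Z'(1)]
    interpret Z': nspace Z' using nZ' by (rule nspace.intro)
    interpret UL: quotient "linf_sum ?I Z" "null_families ?I \<U> Z"
      using vec_space_linf_sum[of ?I Z, OF nZ] submodule_null_families[of ?I Z \<U>, OF nZ] ultra
      by (intro quotient.intro quotient_axioms.intro) (auto simp: ultrafilter_on_def)
    have closed_add: "A \<oplus>\<^bsub>ultraproduct ?I \<U> Z\<^esub> B \<in> carrier (ultraproduct ?I \<U> Z)"
      if "A \<in> carrier (ultraproduct ?I \<U> Z)" "B \<in> carrier (ultraproduct ?I \<U> Z)" for A B
      using that unfolding ultraproduct_def quotient_space_simps by (rule UL.quotient_closed(1))
    have closed_sm: "c \<odot>\<^bsub>ultraproduct ?I \<U> Z\<^esub> A \<in> carrier (ultraproduct ?I \<U> Z)"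
      if "A \<in> carrier (ultraproduct ?I \<U> Z)" for A c
      using that unfolding ultraproduct_def quotient_space_simps by (rule UL.quotient_closed(2))
    obtain J4 Q4 V4 where 4: "dilation_frame X Z' ?\<S> J4 Q4 V4"
      "\<And>ss x. set ss \<subseteq> ?\<S> \<Longrightarrow> x \<in> carrier X \<Longrightarrow>
        Q4 (word V4 ss (J4 x)) = Q3 (word V3 ss (J3 x))"
        by (rule dilation_frame_transfer[OF vec_space_axioms Z'(2) Z'.vec_space_axioms closed_add closed_sm 3(1)];
          (assumption | rule that, assumption, simp only:))
    have V4: "V4 s \<in> isometric_isos Z' Z'" if "s \<in> ?\<S>" for s
      using 4(1) that by (simp add: dilation_frame_def)
    have "J4 \<in> contractions X Z'" "Q4 \<in> contractions Z' X"
      using 4(1) by (simp_all add: dilation_frame_def contractions_iff[OF X nZ'] contractions_iff[OF nZ' X])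
    then show ?thesis
    proof (rule simultaneous_dilationI[OF Z'(1) _ _ V4])
      fix ss x assume ss: "set ss \<subseteq> ?\<S>" and x: "x \<in> carrier X"
      show "foldr (\<circ>) ss id x = Q4 (word V4 ss (J4 x))"
        unfolding 4(2)[OF ss x] 3(2)[OF ss x] ..
    qed
  qed
qed

end
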